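(* Let $T$ be a quasilocal integral domain with nonzero maximal ideal $M$, let $k=T/M$, and let $\varphi:T\to k$ be the canonical surjection. Let $D$ be a proper subring of $k$, $R=\varphi^{-1}(D)$, and $F=qf(D)$ the quotient field of $D$ (inside $k$). Then: (a) $w\text{-}\dim_v(R)=w\text{-}\dim_v(D)+\dim_v(T)+\operatorname{tr.deg.}(k/F)$. (b) $R$ is a $w$-Jaffard domain if and only if $D$ is a $w$-Jaffard domain, $T$ is a Jaffard domain, and $k$ is algebraic over $F$.
   Context: All rings are commutative integral domains with identity; $qf(R)$ is the quotient field of $R$, and an overring of $R$ is a ring between $R$ and $qf(R)$. Quasilocal means having a unique maximal ideal (no Noetherian assumption). $F(R)$ denotes the set of nonzero fractional ideals of $R$ and $f(R)$ the set of nonzero finitely generated fractional ideals. For $A\in F(R)$ put $A^{-1}=\{x\in qf(R): xA\subseteq R\}$, $A^v=(A^{-1})^{-1}$, and $A^w=\{x\in qf(R): xJ\subseteq A \text{ for some } J\subseteq R,\ J\in f(R),\ J^v=R\}$. A nonzero ideal $I$ of $R$ is a $w$-ideal if $I^w=I$; a $w$-prime ideal is a prime ideal that is a ($\neq 0$) $w$-ideal. The $w$-dimension is $w\text{-}\dim(R)=\sup\{n : P_1\subsetneq\cdots\subsetneq P_n,\ P_i \text{ } w\text{-prime ideals of } R\}$, with $w\text{-}\dim(R)=0$ if there are no $w$-prime ideals. A valuation overring $V$ of $R$ is a $w$-valuation overring if $F^w\subseteq FV$ for every $F\in f(R)$; the $w$-valuative dimension is $w\text{-}\dim_v(R)=\sup\{\dim(V):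 V \text{ a } w\text{-valuation overring of } R\}$. $\dim$ is Krull dimension; the valuative dimension is $\dim_v(R)=\sup\{\dim(V): V \text{ a valuation overring of } R\}$. $R$ is a Jaffard domain if $\dim(R)=\dim_v(R)<\infty$, and a $w$-Jaffard domain if $w\text{-}\dim(R)=w\text{-}\dim_v(R)<\infty$. All dimensions take values in $\{0,1,2,\dots\}\cup\{\infty\}$, with an infinite transcendence degree read as $\infty$. *)

theory Defs
  imports
    "HOL-Algebra.Finite_Extensions"
    "HOL-Algebra.Ideal_Product"
    "HOL-Algebra.QuotRing"
    "HOL-Library.Multiset"
    "HOL-Library.Extended_Nat"
begin

text \<open>
  Integral domains are represented as subrings \<open>R\<close> of an ambient field \<open>K\<close>. The field \<open>K\<close> may be
  larger than the quotient field of \<open>R\<close>: every notion below only refers to elements of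
  \<open>quot_field K R\<close>, computed inside \<open>K\<close>. The ring \<open>R\<close> itself is the record
  \<open>K\<lparr>carrier := R\<rparr>\<close>. Dimensions and transcendence degrees are extended naturals.
\<close>

definition quot_field :: "('a, 'm) ring_scheme \<Rightarrow> 'a set \<Rightarrow> 'a set" where
  "quot_field K R = {a \<otimes>\<^bsub>K\<^esub> inv\<^bsub>K\<^esub> b | a b. a \<in> R \<and> b \<in> R \<and> b \<noteq> \<zero>\<^bsub>K\<^esub>}"

definition overring :: "('a, 'm) ring_scheme \<Rightarrow> 'a set \<Rightarrow> 'a set \<Rightarrow> bool" where
  "overring K R S \<longleftrightarrow> subring S K \<and> R \<subseteq> S \<and> S \<subseteq> quot_field K R"


section \<open>Fractional ideals and the \<open>v\<close>- and \<open>w\<close>-operations\<close>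

definition frac_ideals :: "('a, 'm) ring_scheme \<Rightarrow> 'a set \<Rightarrow> 'a set set" where
  "frac_ideals K R = {A. A \<noteq> {\<zero>\<^bsub>K\<^esub>} \<and> A \<subseteq> quot_field K R \<and> additive_subgroup A K \<and>
     (\<forall>r\<in>R. \<forall>a\<in>A. r \<otimes>\<^bsub>K\<^esub> a \<in> A) \<and>
     (\<exists>d\<in>R. d \<noteq> \<zero>\<^bsub>K\<^esub> \<and> (\<forall>a\<in>A. d \<otimes>\<^bsub>K\<^esub> a \<in> R))}"

text \<open>\<open>ring.Span K R us\<close> is \<open>R u\<^sub>1 + \<dots> + R u\<^sub>n\<close>; its definition makes sense for a subring \<open>R\<close>,
  although most library lemmas about it are stated for subfields.\<close>

definition fg_frac_ideals :: "('a, 'm) ring_scheme \<Rightarrow> 'a set \<Rightarrow> 'a set set" where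
  "fg_frac_ideals K R = {A \<in> frac_ideals K R. \<exists>us. set us \<subseteq> A \<and> A = ring.Span K R us}"

definition ideal_inverse :: "('a, 'm) ring_scheme \<Rightarrow> 'a set \<Rightarrow> 'a set \<Rightarrow> 'a set" where
  "ideal_inverse K R A = {x \<in> quot_field K R. \<forall>a\<in>A. x \<otimes>\<^bsub>K\<^esub> a \<in> R}"

definition v_closure :: "('a, 'm) ring_scheme \<Rightarrow> 'a set \<Rightarrow> 'a set \<Rightarrow> 'a set" where
  "v_closure K R A = ideal_inverse K R (ideal_inverse K R A)"

definition w_closure :: "('a, 'm) ring_scheme \<Rightarrow> 'a set \<Rightarrow> 'a set \<Rightarrow> 'a set" where
  "w_closure K R A = {x \<in> quot_field K R.
     \<exists>J \<in> fg_frac_ideals K R. J \<subseteq> R \<and> v_closure K R J = R \<and> (\<forall>j\<in>J. x \<otimes>\<^bsub>K\<^esub> j \<in> A)}"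

definition w_ideal :: "('a, 'm) ring_scheme \<Rightarrow> 'a set \<Rightarrow> 'a set \<Rightarrow> bool" where
  "w_ideal K R I \<longleftrightarrow> ideal I (K\<lparr>carrier := R\<rparr>) \<and> I \<noteq> {\<zero>\<^bsub>K\<^esub>} \<and> w_closure K R I = I"

definition w_prime :: "('a, 'm) ring_scheme \<Rightarrow> 'a set \<Rightarrow> 'a set \<Rightarrow> bool" where
  "w_prime K R P \<longleftrightarrow> primeideal P (K\<lparr>carrier := R\<rparr>) \<and> w_ideal K R P"


section \<open>Valuation overrings\<close>

definition valuation_overring :: "('a, 'm) ring_scheme \<Rightarrow> 'a set \<Rightarrow> 'a set \<Rightarrow> bool" where
  "valuation_overring K R V \<longleftrightarrow> overring K R V \<and>
     (\<forall>x \<in> quot_field K V. x \<noteq> \<zero>\<^bsub>K\<^esub> \<longrightarrow> x \<in> V \<or> inv\<^bsub>K\<^esub> x \<in> V)"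

text \<open>\<open>A \<cdot>\<^bsub>K\<^esub> V\<close> is the set of finite sums of products \<open>a v\<close> with \<open>a \<in> A\<close> and \<open>v \<in> V\<close>,
  i.e. the fractional ideal \<open>A V\<close> of \<open>V\<close>.\<close>

definition w_valuation_overring :: "('a, 'm) ring_scheme \<Rightarrow> 'a set \<Rightarrow> 'a set \<Rightarrow> bool" where
  "w_valuation_overring K R V \<longleftrightarrow> valuation_overring K R V \<and>
     (\<forall>A \<in> fg_frac_ideals K R. w_closure K R A \<subseteq> A \<cdot>\<^bsub>K\<^esub> V)"


section \<open>Dimensions\<close>

text \<open>The Krull dimension counts the strict inclusions in a chain \<open>P\<^sub>0 \<subset> \<dots> \<subset> P\<^sub>n\<close>, whereas the
  \<open>w\<close>-dimension counts the members of a chain \<open>P\<^sub>1 \<subset> \<dots> \<subset> P\<^sub>n\<close>, the zero ideal not being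
  \<open>w\<close>-prime. The empty chain gives \<open>w_dim K R = 0\<close> if there are no \<open>w\<close>-primes.\<close>

definition krull_dim :: "('a, 'm) ring_scheme \<Rightarrow> enat" where
  "krull_dim A = Sup {enat n | n Ps. length Ps = Suc n \<and>
     (\<forall>P \<in> set Ps. primeideal P A) \<and> sorted_wrt (\<subset>) Ps}"

definition w_dim :: "('a, 'm) ring_scheme \<Rightarrow> 'a set \<Rightarrow> enat" where
  "w_dim K R = Sup {enat n | n Ps. length Ps = n \<and>
     (\<forall>P \<in> set Ps. w_prime K R P) \<and> sorted_wrt (\<subset>) Ps}"

definition val_dim :: "('a, 'm) ring_scheme \<Rightarrow> 'a set \<Rightarrow> enat" where
  "val_dim K R = Sup {krull_dim (K\<lparr>carrier := V\<rparr>) | V. valuation_overring K R V}"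

definition w_val_dim :: "('a, 'm) ring_scheme \<Rightarrow> 'a set \<Rightarrow> enat" where
  "w_val_dim K R = Sup {krull_dim (K\<lparr>carrier := V\<rparr>) | V. w_valuation_overring K R V}"

definition jaffard :: "('a, 'm) ring_scheme \<Rightarrow> 'a set \<Rightarrow> bool" where
  "jaffard K R \<longleftrightarrow> krull_dim (K\<lparr>carrier := R\<rparr>) = val_dim K R \<and> val_dim K R < \<infinity>"

definition w_jaffard :: "('a, 'm) ring_scheme \<Rightarrow> 'a set \<Rightarrow> bool" where
  "w_jaffard K R \<longleftrightarrow> w_dim K R = w_val_dim K R \<and> w_val_dim K R < \<infinity>"


section \<open>Transcendence degree\<close>

text \<open>A monomial in the elements of \<open>S\<close> is a finite
  multiset over \<open>S\<close>. A polynomial is given by a finite set \<open>E\<close> of monomials with coefficients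
  \<open>c\<close> in \<open>F\<close>; algebraic independence says that no polynomial with a nonzero coefficient vanishes.\<close>

definition alg_independent :: "('a, 'm) ring_scheme \<Rightarrow> 'a set \<Rightarrow> 'a set \<Rightarrow> bool" where
  "alg_independent K F S \<longleftrightarrow> S \<subseteq> carrier K \<and>
     (\<forall>E c. finite E \<and> (\<forall>m\<in>E. set_mset m \<subseteq> S \<and> c m \<in> F) \<and>
        (\<Oplus>\<^bsub>K\<^esub>m\<in>E. c m \<otimes>\<^bsub>K\<^esub> (\<Otimes>\<^bsub>K\<^esub>x\<in>set_mset m. x [^]\<^bsub>K\<^esub> count m x)) = \<zero>\<^bsub>K\<^esub> \<longrightarrow>
        (\<forall>m\<in>E. c m = \<zero>\<^bsub>K\<^esub>))"

definition trans_degree :: "('a, 'm) ring_scheme \<Rightarrow> 'a set \<Rightarrow> enat" where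
  "trans_degree K F = Sup {enat (card S) | S. finite S \<and> alg_independent K F S}"

end

theory Submission
  imports Defs
begin

text \<open>
  Everything is reduced to statements that a dimension is at least \<open>n\<close>, each witnessed by a finite
  list. For a valuation ring \<open>V\<close> with maximal ideal \<open>m\<close>, a chain of \<open>n\<close> nonzero primes is the
  same as a list \<open>x\<^sub>1, \<dots>, x\<^sub>n\<close> of nonzero elements of \<open>m\<close> with \<open>x\<^sub>i / x\<^sub>j\<^sup>e \<in> m\<close> for all \<open>i < j\<close> and all
  \<open>e\<close>: the value of \<open>x\<^sub>i\<close> exceeds every multiple of the value of \<open>x\<^sub>j\<close> (\<open>krull_dim_valring_ge_iff\<close>). Such
  a list, a \<open>lexchain\<close>, refers to \<open>V\<close> only through membership in \<open>m\<close>. So it remains a lexchain for every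
  valuation ring with a larger maximal ideal, and it can be lifted and reduced along residue maps.

  Valuation rings are produced by one form of Chevalley's theorem, \<open>exists_valuation_ring\<close>. The
  consequence \<open>valring_with_center\<close> shrinks a valuation ring until its center on a given subring is a
  prescribed larger prime. It yields composites of valuations with valuations of a residue field and
  shows that a chain of primes of a domain is the trace of a chain of primes of one valuation overring;
  this gives \<open>krull_dim \<le> val_dim\<close> and \<open>w_dim \<le> w_val_dim\<close>.

  Two lemmas about a field \<open>L\<close> with a subfield \<open>F\<close> govern the transcendence degree. A valuation ring of
  \<open>F\<close> with a lexchain of length \<open>n\<close> extends to \<open>L\<close> with length \<open>n + d\<close> if \<open>L\<close> contains \<open>d\<close> elements that are
  algebraically independent over \<open>F\<close> (\<open>valuation_extension\<close>). Conversely every lexchain in \<open>L\<close> splits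
  into a part equivalent to a lexchain in \<open>F\<close> and a part that is algebraically independent over \<open>F\<close>
  (\<open>lexchain_split\<close>): monomials in elements whose magnitude does not occur in \<open>F\<close> have distinct
  values, and so no linear combination of them vanishes.

  The \<open>w\<close>-operation enters only through the finite sets that generate an ideal \<open>J\<close> with \<open>J\<^sup>v = R\<close>: a
  valuation overring is a \<open>w\<close>-valuation overring exactly if its maximal ideal contains no such set, and
  a nonzero prime is a \<open>w\<close>-prime under the same condition. In the pullback \<open>R\<close> of \<open>D\<close> along \<open>T \<rightarrow> k\<close>, no
  such set lies in \<open>M\<close>, because \<open>T M \<subseteq> R\<close> but \<open>T \<noteq> R\<close>; and such sets of \<open>R\<close> are those whose image is
  such a set of \<open>D\<close> (\<open>gv_set_pullback\<close>).

  For the lower bound in part (a), a valuation ring \<open>U\<close> of \<open>T\<close> is first moved to have center \<open>M\<close>, a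
  \<open>w\<close>-valuation overring of \<open>D\<close> is extended from \<open>F\<close> to \<open>k\<close>, and the composite of the two is taken. For
  the upper bound, let \<open>V\<close> be a \<open>w\<close>-valuation overring of \<open>R\<close> with \<open>M\<close> in its maximal ideal; otherwise \<open>V\<close>
  is a valuation overring of \<open>T\<close>. The overring \<open>U = V T\<close> has center \<open>M\<close> on \<open>T\<close>, and \<open>V\<close> induces a
  valuation of its residue field \<open>\<kappa> \<supseteq> k\<close>. Splitting a lexchain over \<open>k \<subseteq> \<kappa>\<close> gives a lexchain of units of
  \<open>T\<close> and elements that are independent over \<open>k\<close>. The latter are used to refine \<open>U\<close>; together
  with those members of the lexchain that are nonunits of \<open>U\<close>, they are accounted for by \<open>val_dim T\<close>.
  The former split once more over \<open>F \<subseteq> k\<close>.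

  Part (b) combines (a) with \<open>w_dim R = w_dim D + krull_dim T\<close>, which holds because the \<open>w\<close>-primes of \<open>R\<close>
  inside \<open>M\<close> are the nonzero primes of \<open>T\<close> and the other ones correspond to the \<open>w\<close>-primes of \<open>D\<close>.
\<close>

section \<open>Valuation rings of a subfield\<close>

context field
begin

lemma field_inv_closed [simp]: "x \<in> carrier R \<Longrightarrow> x \<noteq> \<zero> \<Longrightarrow> inv x \<in> carrier R"
  by (simp add: field_Units)

lemma field_r_inv [simp]: "x \<in> carrier R \<Longrightarrow> x \<noteq> \<zero> \<Longrightarrow> x \<otimes> inv x = \<one>"
  by (simp add: field_Units)

lemma field_l_inv [simp]: "x \<in> carrier R \<Longrightarrow> x \<noteq> \<zero> \<Longrightarrow> inv x \<otimes> x = \<one>"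
  by (simp add: field_Units)

lemma field_inv_nonzero [simp]: "x \<in> carrier R \<Longrightarrow> x \<noteq> \<zero> \<Longrightarrow> inv x \<noteq> \<zero>"
  using field_r_inv[of x] one_not_zero by (metis r_null)

lemma field_inv_inv [simp]: "x \<in> carrier R \<Longrightarrow> x \<noteq> \<zero> \<Longrightarrow> inv (inv x) = x"
  by (simp add: field_Units)

lemma field_pow_nonzero [simp]: "x \<in> carrier R \<Longrightarrow> x \<noteq> \<zero> \<Longrightarrow> x [^] (n::nat) \<noteq> \<zero>"
  by (induct n) (auto simp: integral_iff)

lemma field_cancel_l [simp]:
  "x \<in> carrier R \<Longrightarrow> x \<noteq> \<zero> \<Longrightarrow> y \<in> carrier R \<Longrightarrow> x \<otimes> (inv x \<otimes> y) = y"
  "x \<in> carrier R \<Longrightarrow> x \<noteq> \<zero> \<Longrightarrow> y \<in> carrier R \<Longrightarrow> inv x \<otimes> (x \<otimes> y) = y"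
  by (simp_all flip: m_assoc)

lemma field_inv_unique: "x \<in> carrier R \<Longrightarrow> y \<in> carrier R \<Longrightarrow> x \<otimes> y = \<one> \<Longrightarrow> inv x = y"
  by (simp add: comm_inv_char)

lemma field_inv_mult [simp]:
  assumes "x \<in> carrier R" "x \<noteq> \<zero>" "y \<in> carrier R" "y \<noteq> \<zero>"
  shows "inv (x \<otimes> y) = inv x \<otimes> inv y"
  by (rule field_inv_unique) (use assms in \<open>simp_all add: m_ac\<close>)

lemma field_inv_one [simp]: "inv \<one> = \<one>"
  by (rule field_inv_unique) simp_all

lemma field_inv_pow [simp]:
  "x \<in> carrier R \<Longrightarrow> x \<noteq> \<zero> \<Longrightarrow> inv (x [^] (n::nat)) = inv x [^] n"
  by (induct n) simp_all

lemma subring_pow: "subring A R \<Longrightarrow> x \<in> A \<Longrightarrow> x [^] (n::nat) \<in> A"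
  by (induct n) (auto dest: subringE)

lemma subfield_inv: "subfield Q R \<Longrightarrow> x \<in> Q \<Longrightarrow> x \<noteq> \<zero> \<Longrightarrow> inv x \<in> Q"
  using subfield_m_inv(1) by blast

text \<open>Valuation rings of a field \<open>Q\<close> that may be smaller than the ambient field: the relevant field for a
  domain \<open>A\<close> is \<open>quot_field R A\<close>.\<close>

definition valring :: "'a set \<Rightarrow> 'a set \<Rightarrow> bool" where
  "valring Q V \<longleftrightarrow> subfield Q R \<and> subring V R \<and> V \<subseteq> Q \<and>
     (\<forall>x\<in>Q. x \<noteq> \<zero> \<longrightarrow> x \<in> V \<or> inv x \<in> V)"

text \<open>The maximal ideal of a valuation ring. Zero is listed separately because \<open>inv \<zero>\<close> is an unspecified
  element.\<close>

definition nonunits :: "'a set \<Rightarrow> 'a set" where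
  "nonunits V = {x \<in> V. x = \<zero> \<or> inv x \<notin> V}"

lemma nonunits_subset: "nonunits V \<subseteq> V"
  by (auto simp: nonunits_def)

lemma valringD:
  assumes "valring Q V"
  shows "subfield Q R" "subring V R" "V \<subseteq> Q" "Q \<subseteq> carrier R" "V \<subseteq> carrier R"
    "\<And>x. x \<in> Q \<Longrightarrow> x \<noteq> \<zero> \<Longrightarrow> x \<notin> V \<Longrightarrow> inv x \<in> V"
  using assms subfieldE(3)[of Q R] subringE(1)[of V R] unfolding valring_def by blast+

lemma one_notin_nonunits: "subring V R \<Longrightarrow> \<one> \<notin> nonunits V"
  by (auto simp: nonunits_def dest: subringE(3))

lemma zero_in_nonunits: "subring V R \<Longrightarrow> \<zero> \<in> nonunits V"
  by (auto simp: nonunits_def dest: subringE(2))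

lemma nonunits_mult:
  assumes V: "subring V R" and x: "x \<in> nonunits V" and v: "v \<in> V"
  shows "x \<otimes> v \<in> nonunits V" "v \<otimes> x \<in> nonunits V"
proof -
  have c: "x \<in> carrier R" "v \<in> carrier R" "x \<in> V"
    using V x v subringE(1) by (auto simp: nonunits_def)
  show "x \<otimes> v \<in> nonunits V"
  proof (rule ccontr)
    assume "x \<otimes> v \<notin> nonunits V"
    then have nz: "x \<otimes> v \<noteq> \<zero>" and i: "inv (x \<otimes> v) \<in> V"
      using subringE(6)[OF V c(3) v] by (auto simp: nonunits_def)
    then have "x \<noteq> \<zero>" "v \<noteq> \<zero>" using c by auto
    then have "inv x = inv (x \<otimes> v) \<otimes> v" using c by (simp add: m_assoc)
    then have "inv x \<in> V" using subringE(6)[OF V i v] by simp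
    then show False using x \<open>x \<noteq> \<zero>\<close> by (auto simp: nonunits_def)
  qed
  then show "v \<otimes> x \<in> nonunits V" using c by (simp add: m_comm)
qed

lemma not_nonunit:
  assumes "subring V R" "x \<in> V" "x \<notin> nonunits V"
  shows "x \<noteq> \<zero>" "inv x \<in> V" "inv x \<notin> nonunits V"
proof -
  show 1: "x \<noteq> \<zero>" "inv x \<in> V" using assms(2,3) by (auto simp: nonunits_def)
  have "x \<in> carrier R" using assms(2) subringE(1)[OF assms(1)] by blast
  with 1 assms(2) show "inv x \<notin> nonunits V" by (simp add: nonunits_def)
qed

lemma valring_notin:
  assumes "valring Q V" "x \<in> Q" "x \<notin> V"
  shows "x \<noteq> \<zero>" "inv x \<in> nonunits V"
proof -
  show nz: "x \<noteq> \<zero>" using assms(3) subringE(2)[OF valringD(2)[OF assms(1)]] by blast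
  have "x \<in> carrier R" using assms valringD(4) by blast
  with nz assms valringD(6)[OF assms(1)] show "inv x \<in> nonunits V" by (simp add: nonunits_def)
qed

text \<open>Of two nonzero elements one divides the other, so the sum is a multiple of one of them.\<close>

lemma nonunits_add:
  assumes V: "valring Q V" and x: "x \<in> nonunits V" and y: "y \<in> nonunits V"
  shows "x \<oplus> y \<in> nonunits V"
proof -
  have sV: "subring V R" using V valringD by blast
  have *: "a \<oplus> b \<in> nonunits V"
    if a: "a \<in> nonunits V" and b: "b \<in> nonunits V" and nz: "b \<noteq> \<zero>"
      and q: "a \<otimes> inv b \<in> V" for a b
  proof -
    have c: "a \<in> carrier R" "b \<in> carrier R"
      using a b valringD(5)[OF V] nonunits_subset by auto
    have "a \<oplus> b = b \<otimes> (a \<otimes> inv b \<oplus> \<one>)"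
      using c nz by (simp add: r_distr m_lcomm)
    moreover have "a \<otimes> inv b \<oplus> \<one> \<in> V" using q subringE(3,7)[OF sV] by blast
    ultimately show ?thesis using nonunits_mult[OF sV b] by simp
  qed
  have c: "x \<in> carrier R" "y \<in> carrier R" "x \<in> Q" "y \<in> Q"
    using x y valringD(3,5)[OF V] nonunits_subset by blast+
  show ?thesis
  proof (cases "x = \<zero> \<or> y = \<zero>")
    case True then show ?thesis using x y c by auto
  next
    case False
    have sQ: "subfield Q R" using V valringD by blast
    have "x \<otimes> inv y \<in> Q"
      using subringE(6)[OF subfieldE(1)[OF sQ]] c subfield_inv[OF sQ] False by blast
    moreover have "x \<otimes> inv y \<noteq> \<zero>" using False c by (simp add: integral_iff)
    ultimately consider "x \<otimes> inv y \<in> V" | "inv (x \<otimes> inv y) \<in> V" using V by (auto simp: valring_def)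
    then show ?thesis
    proof cases
      case 1 then show ?thesis using * x y False by blast
    next
      case 2
      then have "y \<otimes> inv x \<in> V" using False c by (simp add: m_comm)
      then have "y \<oplus> x \<in> nonunits V" using * x y False by blast
      then show ?thesis using c by (simp add: a_comm)
    qed
  qed
qed

lemma nonunits_minus:
  assumes V: "subring V R" and x: "x \<in> nonunits V"
  shows "\<ominus> x \<in> nonunits V"
proof -
  have "x \<in> carrier R" using x subringE(1)[OF V] by (auto simp: nonunits_def)
  moreover have "\<ominus> \<one> \<in> V" using subringE(5)[OF V subringE(3)[OF V]] .
  ultimately show ?thesis using nonunits_mult(2)[OF V x, of "\<ominus> \<one>"] by (simp add: l_minus)
qed

text \<open>Overrings of a valuation ring have smaller maximal ideals; \<open>valring_subsetI\<close> is the converse.\<close>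

lemma valring_overring:
  assumes V: "valring Q V" and U: "subring U R" "V \<subseteq> U" "U \<subseteq> Q"
  shows "valring Q U" "nonunits U \<subseteq> nonunits V"
proof -
  show "valring Q U" using assms unfolding valring_def by blast
  show "nonunits U \<subseteq> nonunits V"
  proof
    fix x assume x: "x \<in> nonunits U"
    show "x \<in> nonunits V"
    proof (cases "x = \<zero>")
      case True then show ?thesis using V zero_in_nonunits valringD(2) by blast
    next
      case False
      then have "inv x \<notin> V" "x \<in> Q" using x U by (auto simp: nonunits_def)
      then show ?thesis using False valringD(6)[OF V] by (auto simp: nonunits_def)
    qed
  qed
qed

lemma valring_subsetI:
  assumes "valring Q V" "valring Q U" "nonunits U \<subseteq> nonunits V"
  shows "V \<subseteq> U"
proof
  fix x assume x: "x \<in> V"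
  show "x \<in> U"
  proof (rule ccontr)
    assume n: "x \<notin> U"
    have "x \<in> Q" using x valringD(3)[OF assms(1)] by blast
    then have "inv x \<in> nonunits U" "x \<noteq> \<zero>" using valring_notin[OF assms(2)] n by auto
    moreover have "x \<in> carrier R" using x valringD(5)[OF assms(1)] by blast
    ultimately show False using x assms(3) by (auto simp: nonunits_def)
  qed
qed

section \<open>Existence of valuation rings\<close>

text \<open>The values at \<open>x\<close> of the polynomials of degree at most \<open>n\<close> with coefficients in \<open>J\<close>. Since
  \<open>J\<close> will be a ring without one, \<open>x\<close> itself need not be among them.\<close>

fun poly_span :: "'a set \<Rightarrow> 'a \<Rightarrow> nat \<Rightarrow> 'a set" where
  "poly_span J x 0 = J"
| "poly_span J x (Suc n) = {p \<oplus> a \<otimes> x [^] Suc n | p a. p \<in> poly_span J x n \<and> a \<in> J}"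

text \<open>A subring of \<open>Q\<close> that need not contain one, like the maximal ideal of a valuation ring.\<close>

definition nonunital :: "'a set \<Rightarrow> 'a set \<Rightarrow> bool" where
  "nonunital Q J \<longleftrightarrow> J \<subseteq> Q \<and> \<zero> \<in> J \<and> (\<forall>a\<in>J. \<forall>b\<in>J. a \<oplus> b \<in> J \<and> a \<otimes> b \<in> J) \<and> (\<forall>a\<in>J. \<ominus> a \<in> J)"

lemma nonunitalD:
  assumes "nonunital Q J"
  shows "J \<subseteq> Q" "\<zero> \<in> J" "\<And>a b. a \<in> J \<Longrightarrow> b \<in> J \<Longrightarrow> a \<oplus> b \<in> J"
    "\<And>a b. a \<in> J \<Longrightarrow> b \<in> J \<Longrightarrow> a \<otimes> b \<in> J" "\<And>a. a \<in> J \<Longrightarrow> \<ominus> a \<in> J"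
  using assms unfolding nonunital_def by auto

lemma poly_span_carrier:
  "J \<subseteq> carrier R \<Longrightarrow> x \<in> carrier R \<Longrightarrow> p \<in> poly_span J x n \<Longrightarrow> p \<in> carrier R"
  by (induct n arbitrary: p) auto

lemma poly_span_Suc:
  assumes "\<zero> \<in> J" "J \<subseteq> carrier R" "x \<in> carrier R" "p \<in> poly_span J x n"
  shows "p \<in> poly_span J x (Suc n)"
proof -
  have "p = p \<oplus> \<zero> \<otimes> x [^] Suc n" using poly_span_carrier[OF assms(2,3,4)] assms(3) by simp
  then show ?thesis using assms unfolding poly_span.simps(2) by blast
qed

lemma poly_span_mono:
  assumes "\<zero> \<in> J" "J \<subseteq> carrier R" "x \<in> carrier R" "p \<in> poly_span J x n" "n \<le> m"
  shows "p \<in> poly_span J x m"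
  using assms(5) by (induct rule: dec_induct) (use assms poly_span_Suc in blast)+

lemma poly_span_add:
  assumes J: "\<And>a b. a \<in> J \<Longrightarrow> b \<in> J \<Longrightarrow> a \<oplus> b \<in> J" "J \<subseteq> carrier R" and x: "x \<in> carrier R"
  shows "p \<in> poly_span J x n \<Longrightarrow> q \<in> poly_span J x n \<Longrightarrow> p \<oplus> q \<in> poly_span J x n"
proof (induct n arbitrary: p q)
  case 0 then show ?case using J by simp
next
  case (Suc n)
  obtain p' a where p: "p = p' \<oplus> a \<otimes> x [^] Suc n" "p' \<in> poly_span J x n" "a \<in> J"
    using Suc(2) by auto
  obtain q' b where q: "q = q' \<oplus> b \<otimes> x [^] Suc n" "q' \<in> poly_span J x n" "b \<in> J"
    using Suc(3) by auto
  have c: "p' \<in> carrier R" "q' \<in> carrier R" "a \<in> carrier R" "b \<in> carrier R" "x [^] Suc n \<in> carrier R"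
    using poly_span_carrier[OF J(2) x] p q J(2) x by auto
  have "p \<oplus> q = (p' \<oplus> q') \<oplus> (a \<oplus> b) \<otimes> x [^] Suc n"
    unfolding p q using c by algebra
  moreover have "p' \<oplus> q' \<in> poly_span J x n" "a \<oplus> b \<in> J" using Suc(1) p q J by auto
  ultimately show ?case by auto
qed

lemma poly_span_smult:
  assumes J: "\<And>a. a \<in> J \<Longrightarrow> c \<otimes> a \<in> J" "J \<subseteq> carrier R" and x: "x \<in> carrier R" "c \<in> carrier R"
  shows "p \<in> poly_span J x n \<Longrightarrow> c \<otimes> p \<in> poly_span J x n"
proof (induct n arbitrary: p)
  case 0 then show ?case using J by simp
next
  case (Suc n)
  obtain p' a where p: "p = p' \<oplus> a \<otimes> x [^] Suc n" "p' \<in> poly_span J x n" "a \<in> J"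
    using Suc(2) by auto
  have cc: "p' \<in> carrier R" "a \<in> carrier R" "x [^] Suc n \<in> carrier R"
    using poly_span_carrier[OF J(2) x(1)] p J(2) x by auto
  have "c \<otimes> p = c \<otimes> p' \<oplus> (c \<otimes> a) \<otimes> x [^] Suc n"
    unfolding p using cc x by algebra
  moreover have "c \<otimes> p' \<in> poly_span J x n" "c \<otimes> a \<in> J" using Suc(1) p J by auto
  ultimately show ?case by auto
qed

lemma poly_span_shift:
  assumes J: "\<zero> \<in> J" "J \<subseteq> carrier R" and x: "x \<in> carrier R"
  shows "p \<in> poly_span J x n \<Longrightarrow> x \<otimes> p \<in> poly_span J x (Suc n)"
proof (induct n arbitrary: p)
  case 0
  then have "x \<otimes> p = \<zero> \<oplus> p \<otimes> x [^] Suc 0" using J x by (auto simp: m_comm)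
  then show ?case using J 0 by auto
next
  case (Suc n)
  obtain p' a where p: "p = p' \<oplus> a \<otimes> x [^] Suc n" "p' \<in> poly_span J x n" "a \<in> J"
    using Suc(2) by auto
  have cc: "p' \<in> carrier R" "a \<in> carrier R" "x [^] Suc n \<in> carrier R"
    using poly_span_carrier[OF J(2) x(1)] p J(2) x by auto
  have "x \<otimes> p = x \<otimes> p' \<oplus> a \<otimes> (x [^] Suc n \<otimes> x)"
    unfolding p using cc x by algebra
  then have "x \<otimes> p = x \<otimes> p' \<oplus> a \<otimes> x [^] Suc (Suc n)" by simp
  moreover have "x \<otimes> p' \<in> poly_span J x (Suc n)" using Suc(1) p by auto
  ultimately show ?case using p(3) unfolding poly_span.simps(2)[of J x "Suc n"] by blast
qed

lemma poly_span_pow_mult: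
  assumes J: "\<zero> \<in> J" "J \<subseteq> carrier R" and x: "x \<in> carrier R" and a: "a \<in> J"
  shows "a \<otimes> x [^] n \<in> poly_span J x n"
proof (induct n)
  case 0 then show ?case using J a by auto
next
  case (Suc n)
  have "x \<otimes> (a \<otimes> x [^] n) = a \<otimes> x [^] Suc n" using J a x by (auto simp: m_ac)
  then show ?case using poly_span_shift[OF J x Suc] by simp
qed

text \<open>Multiplication by \<open>x\<^sup>n\<^sup>+\<^sup>1\<close> turns a polynomial in \<open>1/x\<close> into a polynomial in \<open>x\<close>. Its constant
  coefficient \<open>b\<close> is kept apart as the only one that contributes to degree \<open>n + 1\<close>.\<close>

lemma poly_span_reverse:
  assumes J: "nonunital Q J" "J \<subseteq> carrier R" and x: "x \<in> carrier R" "x \<noteq> \<zero>"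
  shows "q \<in> poly_span J (inv x) m \<Longrightarrow> m \<le> Suc n \<Longrightarrow>
    \<exists>b\<in>J. \<exists>r\<in>poly_span J x n. x [^] Suc n \<otimes> q = x [^] Suc n \<otimes> b \<oplus> r"
proof (induct m arbitrary: q)
  case 0
  have "\<zero> \<in> poly_span J x n"
    using poly_span_mono[OF nonunitalD(2)[OF J(1)] J(2) x(1), of \<zero> 0 n] nonunitalD(2)[OF J(1)] by simp
  moreover have "q \<in> J" "q \<in> carrier R" using 0 J by auto
  ultimately show ?case using x by (intro bexI[of _ q] bexI[of _ \<zero>]) auto
next
  case (Suc m)
  obtain q' a where q: "q = q' \<oplus> a \<otimes> inv x [^] Suc m" "q' \<in> poly_span J (inv x) m" "a \<in> J"
    using Suc(2) by auto
  obtain b r where br: "b \<in> J" "r \<in> poly_span J x n" "x [^] Suc n \<otimes> q' = x [^] Suc n \<otimes> b \<oplus> r"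
    using Suc(1)[OF q(2)] Suc(3) by auto
  have ix: "inv x \<in> carrier R" using x by simp
  have c: "q' \<in> carrier R" "a \<in> carrier R" "b \<in> carrier R" "r \<in> carrier R" "x [^] Suc n \<in> carrier R"
    "inv x [^] Suc m \<in> carrier R"
    using poly_span_carrier[OF J(2) ix] poly_span_carrier[OF J(2) x(1)] q br J(2) x ix by auto
  have z: "\<zero> \<in> J" using J nonunitalD(2) by blast
  have nm: "Suc n = (n - m) + Suc m" using Suc(3) by simp
  have "x [^] Suc n = x [^] (n - m) \<otimes> x [^] Suc m"
    using x nm by (metis nat_pow_mult)
  moreover have "x [^] Suc m \<otimes> inv x [^] Suc m = \<one>"
    using field_r_inv[OF nat_pow_closed[OF x(1)] field_pow_nonzero[OF x], of "Suc m"] unfolding field_inv_pow[OF x] .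
  ultimately have e: "x [^] Suc n \<otimes> inv x [^] Suc m = x [^] (n - m)"
    using x ix by (simp del: nat_pow_Suc add: m_assoc)
  have "x [^] Suc n \<otimes> q = x [^] Suc n \<otimes> q' \<oplus> a \<otimes> (x [^] Suc n \<otimes> inv x [^] Suc m)"
    unfolding q using c by algebra
  also have "\<dots> = x [^] Suc n \<otimes> b \<oplus> (r \<oplus> a \<otimes> x [^] (n - m))"
    unfolding e br(3) using c x by (simp del: nat_pow_Suc add: a_assoc)
  finally have 1: "x [^] Suc n \<otimes> q = x [^] Suc n \<otimes> b \<oplus> (r \<oplus> a \<otimes> x [^] (n - m))" .
  have "a \<otimes> x [^] (n - m) \<in> poly_span J x n"
    by (rule poly_span_mono[OF z J(2) x(1) poly_span_pow_mult[OF z J(2) x(1) q(3)]]) simp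
  then have "r \<oplus> a \<otimes> x [^] (n - m) \<in> poly_span J x n"
    using poly_span_add[OF nonunitalD(3)[OF J(1)] J(2) x(1)] br(2) by blast
  then show ?case using 1 br(1) by blast
qed

text \<open>Let \<open>1 = p + a x\<^sup>n\<^sup>+\<^sup>1\<close> and \<open>1 = b + \<dots>\<close> be the two representations, the second one in powers of
  \<open>1/x\<close>. Then \<open>x\<^sup>n\<^sup>+\<^sup>1 (1 - b)\<close> is a polynomial of degree at most \<open>n\<close> in \<open>x\<close>, so multiplying the first
  representation by \<open>1 - b\<close> lowers its degree.\<close>

lemma one_in_poly_span_descent:
  assumes J: "nonunital Q J" "J \<subseteq> carrier R" and x: "x \<in> carrier R" "x \<noteq> \<zero>"
    and n: "\<one> \<in> poly_span J x (Suc n)" and m: "\<one> \<in> poly_span J (inv x) m" "m \<le> Suc n"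
  shows "\<one> \<in> poly_span J x n"
proof -
  note z = nonunitalD(2)[OF J(1)]
  obtain b r where br: "b \<in> J" "r \<in> poly_span J x n" "x [^] Suc n \<otimes> \<one> = x [^] Suc n \<otimes> b \<oplus> r"
    using poly_span_reverse[OF J x m] by blast
  obtain p a where p: "\<one> = p \<oplus> a \<otimes> x [^] Suc n" "p \<in> poly_span J x n" "a \<in> J"
    using n by auto
  have c: "b \<in> carrier R" "r \<in> carrier R" "p \<in> carrier R" "a \<in> carrier R" "x [^] Suc n \<in> carrier R"
    using poly_span_carrier[OF J(2) x(1)] p br J(2) x by auto
  have br': "x [^] Suc n \<otimes> (\<one> \<ominus> b) = r"
  proof -
    have "x [^] Suc n \<otimes> (\<one> \<ominus> b) = x [^] Suc n \<otimes> \<one> \<ominus> x [^] Suc n \<otimes> b" using c by algebra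
    also have "\<dots> = r" unfolding br(3) using c by algebra
    finally show ?thesis .
  qed
  have "\<one> \<ominus> b = (\<one> \<ominus> b) \<otimes> \<one>" using c by algebra
  also have "\<dots> = (\<one> \<ominus> b) \<otimes> (p \<oplus> a \<otimes> x [^] Suc n)" by (rule arg_cong[OF p(1)])
  also have "\<dots> = p \<oplus> \<ominus> (b \<otimes> p) \<oplus> a \<otimes> (x [^] Suc n \<otimes> (\<one> \<ominus> b))" using c by algebra
  finally have "\<one> \<ominus> b = p \<oplus> \<ominus> (b \<otimes> p) \<oplus> a \<otimes> r" unfolding br' .
  then have "b \<oplus> (\<one> \<ominus> b) = b \<oplus> (p \<oplus> (\<ominus> b) \<otimes> p \<oplus> a \<otimes> r)" using c by (simp add: l_minus)
  moreover have "b \<oplus> (\<one> \<ominus> b) = \<one>" using c by algebra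
  ultimately have e: "\<one> = b \<oplus> (p \<oplus> (\<ominus> b) \<otimes> p \<oplus> a \<otimes> r)" by simp
  have s: "d \<otimes> q \<in> poly_span J x n" if "d \<in> J" "q \<in> poly_span J x n" for d q
    using poly_span_smult[OF _ J(2) x(1) _ that(2)] that(1) J nonunitalD(4) by blast
  note add = poly_span_add[OF nonunitalD(3)[OF J(1)] J(2) x(1)]
  have "b \<in> poly_span J x n"
    using poly_span_mono[OF z J(2) x(1), of b 0 n] br(1) by simp
  then show ?thesis
    unfolding e using s[OF nonunitalD(5)[OF J(1) br(1)] p(2)] s[OF p(3) br(2)] p(2) add by blast
qed

text \<open>Repeated descent reaches a representation of degree \<open>0\<close>, that is \<open>1 \<in> J\<close>.\<close>

lemma one_in_poly_span_both:
  assumes J: "nonunital Q J" "J \<subseteq> carrier R" "\<one> \<notin> J" and x: "x \<in> carrier R" "x \<noteq> \<zero>"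
  shows "\<not> (\<one> \<in> poly_span J x n \<and> \<one> \<in> poly_span J (inv x) m)"
proof (induct "n + m" arbitrary: n m rule: less_induct)
  case less
  show ?case
  proof (rule notI, elim conjE)
    assume a: "\<one> \<in> poly_span J x n" "\<one> \<in> poly_span J (inv x) m"
    have "n \<noteq> 0" "m \<noteq> 0" using a J(3) by (metis poly_span.simps(1))+
    then obtain n' m' where nm: "n = Suc n'" "m = Suc m'" using not0_implies_Suc by blast
    show False
    proof (cases "m \<le> n")
      case True
      then have "\<one> \<in> poly_span J x n'"
        using one_in_poly_span_descent[OF J(1,2) x a(1)[unfolded nm] a(2)] nm by blast
      then show False using less[of n' m] a(2) nm(1) by simp
    next
      case False
      have "inv (inv x) = x" "inv x \<in> carrier R" "inv x \<noteq> \<zero>" using x by auto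
      then have "\<one> \<in> poly_span J (inv x) m'"
        using one_in_poly_span_descent[OF J(1,2), of "inv x" m' n] a[unfolded nm(2)] nm False by (simp del: poly_span.simps)
      then show False using less[of n m'] a(1) nm(2) by (simp del: poly_span.simps)
    qed
  qed
qed

lemma poly_span_Union_nonunital:
  assumes J: "nonunital Q J" "J \<subseteq> carrier R" and Q: "subring Q R" and x: "x \<in> Q"
  shows "nonunital Q (\<Union>n. poly_span J x n)"
proof -
  have xc: "x \<in> carrier R" using x subringE(1)[OF Q] by blast
  note z = nonunitalD(2)[OF J(1)]
  note add = poly_span_add[OF nonunitalD(3)[OF J(1)] J(2) xc]
  note pc = poly_span_carrier[OF J(2) xc]
  have s: "d \<otimes> q \<in> poly_span J x n" if "d \<in> J" "q \<in> poly_span J x n" for d q n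
    using poly_span_smult[OF _ J(2) xc _ that(2)] that(1) J nonunitalD(4) by blast
  have max2: "p \<oplus> q \<in> poly_span J x (max n m)"
    if "p \<in> poly_span J x n" "q \<in> poly_span J x m" for p q n m
    using add poly_span_mono[OF z J(2) xc that(1), of "max n m"]
      poly_span_mono[OF z J(2) xc that(2), of "max n m"] by simp
  have inQ: "poly_span J x n \<subseteq> Q" for n
  proof (induct n)
    case 0 then show ?case using J nonunitalD by simp
  next
    case (Suc n)
    have "x [^] Suc n \<in> Q" using subring_pow Q x by blast
    with Suc show ?case using subringE(6,7)[OF Q] nonunitalD(1)[OF J(1)] by auto blast
  qed
  have xs: "x [^] k \<otimes> q \<in> poly_span J x (k + n)" if "q \<in> poly_span J x n" for q n k
  proof (induct k)
    case 0 show ?case using that pc by simp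
  next
    case (Suc k)
    have "x \<otimes> (x [^] k \<otimes> q) = x [^] Suc k \<otimes> q" using xc pc[OF that] by (simp add: m_ac)
    then show ?case using poly_span_shift[OF z J(2) xc Suc] by simp
  qed
  have mul: "\<exists>l. p \<otimes> q \<in> poly_span J x l" if q: "q \<in> poly_span J x m" and p: "p \<in> poly_span J x n" for p q n m
    using p
  proof (induct n arbitrary: p)
    case 0 then show ?case using s q by auto
  next
    case (Suc n)
    obtain p' a where p: "p = p' \<oplus> a \<otimes> x [^] Suc n" "p' \<in> poly_span J x n" "a \<in> J"
      using Suc(2) by auto
    have c: "p' \<in> carrier R" "a \<in> carrier R" "q \<in> carrier R" "x [^] Suc n \<in> carrier R"
      using p q pc J(2) xc by auto
    have "p \<otimes> q = p' \<otimes> q \<oplus> a \<otimes> (x [^] Suc n \<otimes> q)"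
      unfolding p using c by algebra
    then show ?case using Suc(1)[OF p(2)] s[OF p(3) xs[OF q]] max2 by metis
  qed
  have min: "\<ominus> p \<in> poly_span J x n" if p: "p \<in> poly_span J x n" for p n
  proof -
    have "(\<ominus> \<one>) \<otimes> p \<in> poly_span J x n"
    proof (rule poly_span_smult[OF _ J(2) xc _ p])
      fix a assume "a \<in> J" then show "\<ominus> \<one> \<otimes> a \<in> J"
        using nonunitalD(5)[OF J(1), of a] J(2) by (auto simp: l_minus)
    qed simp
    then show ?thesis using pc[OF p] by (simp add: l_minus)
  qed
  have "\<zero> \<in> poly_span J x 0" using z by simp
  then have 1: "\<zero> \<in> (\<Union>n. poly_span J x n)" by blast
  have 2: "(\<Union>n. poly_span J x n) \<subseteq> Q" using inQ by blast
  have 3: "a \<oplus> b \<in> (\<Union>n. poly_span J x n) \<and> a \<otimes> b \<in> (\<Union>n. poly_span J x n)"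
    if ab: "a \<in> (\<Union>n. poly_span J x n)" "b \<in> (\<Union>n. poly_span J x n)" for a b
  proof -
    obtain n m where nm: "a \<in> poly_span J x n" "b \<in> poly_span J x m" using ab by blast
    show ?thesis using max2[OF nm] mul[OF nm(2,1)] by blast
  qed
  have 4: "\<ominus> a \<in> (\<Union>n. poly_span J x n)" if a: "a \<in> (\<Union>n. poly_span J x n)" for a
  proof -
    obtain n where "a \<in> poly_span J x n" using a by blast
    then have "\<ominus> a \<in> poly_span J x n" by (rule min)
    then show ?thesis by blast
  qed
  show ?thesis unfolding nonunital_def
    by (intro conjI ballI 1 2 4 conjunct1[OF 3] conjunct2[OF 3])
qed

text \<open>A form of Chevalley's theorem. Zorn's lemma gives a maximal nonunital subring \<open>I \<supseteq> J\<close> that is stable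
  under \<open>A\<close> and does not contain one; the valuation ring is \<open>{x. x I \<subseteq> I}\<close>. If \<open>x\<close> is not in it, then
  \<open>I[x]\<close> is strictly larger than \<open>I\<close> and therefore contains one; this cannot happen for both \<open>x\<close> and
  \<open>1/x\<close>.
  The set \<open>A\<close> is arbitrary, which allows inverses to be adjoined to a ring without forming the
  localization.\<close>

theorem exists_valuation_ring:
  assumes Q: "subfield Q R" and J: "nonunital Q J" "\<one> \<notin> J"
    and A: "A \<subseteq> Q" "\<And>a j. a \<in> A \<Longrightarrow> j \<in> J \<Longrightarrow> a \<otimes> j \<in> J"
  obtains V where "valring Q V" "A \<subseteq> V" "J \<subseteq> nonunits V"
proof -
  have Qc: "Q \<subseteq> carrier R" and Qr: "subring Q R" using Q subfieldE by auto
  define S where "S = {I. nonunital Q I \<and> J \<subseteq> I \<and> \<one> \<notin> I \<and> (\<forall>a\<in>A. \<forall>j\<in>I. a \<otimes> j \<in> I)}"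
  have JS: "J \<in> S" using J A unfolding S_def by auto
  have "\<exists>I\<in>S. \<forall>Z\<in>S. I \<subseteq> Z \<longrightarrow> Z = I"
  proof (rule subset_Zorn_nonempty)
    show "S \<noteq> {}" using JS by blast
    fix C assume C: "C \<noteq> {}" "subset.chain S C"
    have CS: "C \<subseteq> S" using C by (auto simp: subset.chain_def)
    have tot: "Z \<subseteq> Y \<or> Y \<subseteq> Z" if "Z \<in> C" "Y \<in> C" for Z Y
      using C that by (auto simp: subset.chain_def)
    have "nonunital Q (\<Union>C)" unfolding nonunital_def
    proof (intro conjI ballI)
      show "\<Union>C \<subseteq> Q" using CS nonunitalD(1) by (fastforce simp: S_def)
      show "\<zero> \<in> \<Union>C" using CS C nonunitalD(2) by (fastforce simp: S_def)
    next
      fix a assume "a \<in> \<Union>C" then show "\<ominus> a \<in> \<Union>C"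
        using CS nonunitalD(5) by (fastforce simp: S_def)
    next
      fix a b assume "a \<in> \<Union>C" "b \<in> \<Union>C"
      then obtain Y Y' where "Y \<in> C" "Y' \<in> C" "a \<in> Y" "b \<in> Y'" by auto
      then obtain Z where "Z \<in> C" "a \<in> Z" "b \<in> Z" using tot by blast
      moreover have "nonunital Q Z" using CS \<open>Z \<in> C\<close> by (auto simp: S_def)
      ultimately show "a \<oplus> b \<in> \<Union>C" "a \<otimes> b \<in> \<Union>C" using nonunitalD(3,4) by blast+
    qed
    moreover have "J \<subseteq> \<Union>C" using CS C by (fastforce simp: S_def)
    moreover have "\<one> \<notin> \<Union>C" "\<forall>a\<in>A. \<forall>j\<in>\<Union>C. a \<otimes> j \<in> \<Union>C" using CS by (auto simp: S_def)
    ultimately show "\<Union>C \<in> S" by (simp add: S_def)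
  qed
  then obtain I where I: "I \<in> S" and max: "\<And>Z. Z \<in> S \<Longrightarrow> I \<subseteq> Z \<Longrightarrow> Z = I" by blast
  have In: "nonunital Q I" "J \<subseteq> I" "\<one> \<notin> I" "\<And>a j. a \<in> A \<Longrightarrow> j \<in> I \<Longrightarrow> a \<otimes> j \<in> I"
    using I by (auto simp: S_def)
  have Ic: "I \<subseteq> carrier R" using nonunitalD(1)[OF In(1)] Qc by blast
  note z = nonunitalD(2)[OF In(1)]
  define V where "V = {x \<in> Q. \<forall>j\<in>I. x \<otimes> j \<in> I}"
  have Vc: "V \<subseteq> carrier R" using Qc by (auto simp: V_def)
  have "subring V R"
  proof (rule subringI[OF Vc])
    show "\<one> \<in> V" using subringE(3)[OF Qr] Ic by (auto simp: V_def)
    fix h assume "h \<in> V"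
    then have h: "h \<in> Q" "h \<in> carrier R" "\<And>j. j \<in> I \<Longrightarrow> h \<otimes> j \<in> I"
      using Vc by (auto simp: V_def)
    have "\<ominus> h \<otimes> j \<in> I" if j: "j \<in> I" for j
    proof -
      have "j \<in> carrier R" using j Ic by blast
      then show ?thesis using nonunitalD(5)[OF In(1) h(3)[OF j]] h(2) by (simp add: l_minus)
    qed
    then show "\<ominus> h \<in> V" using subringE(5)[OF Qr h(1)] by (simp add: V_def)
    fix g assume "g \<in> V"
    then have g: "g \<in> Q" "g \<in> carrier R" "\<And>j. j \<in> I \<Longrightarrow> g \<otimes> j \<in> I"
      using Vc by (auto simp: V_def)
    have "(h \<otimes> g) \<otimes> j \<in> I \<and> (h \<oplus> g) \<otimes> j \<in> I" if j: "j \<in> I" for j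
    proof -
      have "j \<in> carrier R" using j Ic by blast
      then show ?thesis using nonunitalD(3)[OF In(1) h(3)[OF j] g(3)[OF j]] h(3)[OF g(3)[OF j]] h(2) g(2)
        by (simp add: m_assoc l_distr)
    qed
    then show "h \<otimes> g \<in> V" "h \<oplus> g \<in> V"
      using subringE(6,7)[OF Qr h(1) g(1)] by (simp_all add: V_def)
  qed
  have step: "x \<in> V" if x: "x \<in> Q" and no: "\<And>n. \<one> \<notin> poly_span I x n" for x
  proof -
    have xc: "x \<in> carrier R" using x Qc by blast
    let ?U = "\<Union>n. poly_span I x n"
    have s: "a \<otimes> q \<in> poly_span I x n" if "a \<in> A" "q \<in> poly_span I x n" for a q n
      using poly_span_smult[OF _ Ic xc _ that(2)] that(1) In(4) A Qc by blast
    have I0: "I \<subseteq> ?U" using UN_upper[of 0 UNIV "poly_span I x"] by simp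
    have "?U \<in> S" unfolding S_def
    proof (intro CollectI conjI ballI)
      show "nonunital Q ?U" by (rule poly_span_Union_nonunital[OF In(1) Ic Qr x])
      show "J \<subseteq> ?U" using I0 In(2) by (rule subset_trans[rotated])
      show "\<one> \<notin> ?U" using no by simp
      fix a q assume a: "a \<in> A" and "q \<in> ?U"
      then obtain n where "q \<in> poly_span I x n" by (elim UN_E)
      then have "a \<otimes> q \<in> poly_span I x n" by (rule s[OF a])
      then show "a \<otimes> q \<in> ?U" by (rule UN_I[OF UNIV_I])
    qed
    then have UI: "?U = I" using max I0 by simp
    have "x \<otimes> j \<in> I" if j: "j \<in> I" for j
    proof -
      have "x \<otimes> j \<in> poly_span I x (Suc 0)"
        using poly_span_shift[OF z Ic xc, of j 0] j by simp
      then have "x \<otimes> j \<in> ?U" by (rule UN_I[OF UNIV_I])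
      then show ?thesis unfolding UI .
    qed
    then show ?thesis using x unfolding V_def by simp
  qed
  have "valring Q V" unfolding valring_def
  proof (intro conjI ballI impI)
    show "subfield Q R" "subring V R" by fact+
    show "V \<subseteq> Q" by (auto simp: V_def)
    fix x assume x: "x \<in> Q" "x \<noteq> \<zero>"
    have "x \<in> carrier R" using x Qc by blast
    then show "x \<in> V \<or> inv x \<in> V"
      using step[OF x(1)] step[OF subfield_inv[OF Q x]] one_in_poly_span_both[OF In(1) Ic In(3) _ x(2)]
      by blast
  qed
  moreover have "A \<subseteq> V" using A(1) In(4) by (auto simp: V_def)
  moreover have "J \<subseteq> nonunits V"
  proof
    fix j assume j: "j \<in> J"
    then have jI: "j \<in> I" "j \<in> V" "j \<in> carrier R"
      using In(1,2) Ic nonunitalD(1,4)[OF In(1)] unfolding V_def by blast+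
    show "j \<in> nonunits V"
    proof (rule ccontr)
      assume "j \<notin> nonunits V"
      then have "j \<noteq> \<zero>" "inv j \<in> V" using jI(2) by (auto simp: nonunits_def)
      then have "inv j \<otimes> j \<in> I" "inv j \<otimes> j = \<one>" using jI by (auto simp: V_def)
      then show False using In(3) by simp
    qed
  qed
  ultimately show thesis using that by blast
qed

end

section \<open>Prime ideals and Krull dimension\<close>

text \<open>All suprema of dimensions are compared through the natural numbers below them.\<close>

lemma enat_le_Sup_iff:
  assumes "S \<noteq> {}"
  shows "enat n \<le> Sup S \<longleftrightarrow> (\<exists>s\<in>S. enat n \<le> s)"
proof
  assume le: "enat n \<le> Sup S"
  show "\<exists>s\<in>S. enat n \<le> s"
  proof (cases n)
    case 0 then show ?thesis using assms by (auto simp: zero_enat_def[symmetric])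
  next
    case (Suc m)
    show ?thesis
    proof (rule ccontr)
      assume "\<not> ?thesis"
      then have "s \<le> enat m" if "s \<in> S" for s
        using that Suc by (metis Suc_ile_eq linorder_not_le)
      then have "Sup S \<le> enat m" by (rule Sup_least)
      then show False using le Suc by (metis enat_ord_simps(1) not_less_eq_eq order_refl order_trans)
    qed
  qed
next
  assume "\<exists>s\<in>S. enat n \<le> s"
  then show "enat n \<le> Sup S" by (meson Sup_upper order_trans)
qed

lemma enat_le_Sup_length_iff:
  assumes "P []" and take: "\<And>xs n. P xs \<Longrightarrow> P (take n xs)"
  shows "enat n \<le> Sup {enat n | n xs. length xs = n \<and> P xs} \<longleftrightarrow> (\<exists>xs. length xs = n \<and> P xs)"
proof -
  have ne: "{enat n | n xs. length xs = n \<and> P xs} \<noteq> {}" using assms(1) by blast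
  show ?thesis
  proof
    assume "enat n \<le> Sup {enat n | n xs. length xs = n \<and> P xs}"
    then obtain xs where "n \<le> length xs" "P xs" unfolding enat_le_Sup_iff[OF ne] by auto
    then show "\<exists>xs. length xs = n \<and> P xs" using take[of xs n] by (intro exI[of _ "take n xs"]) auto
  next
    assume "\<exists>xs. length xs = n \<and> P xs"
    then show "enat n \<le> Sup {enat n | n xs. length xs = n \<and> P xs}"
      unfolding enat_le_Sup_iff[OF ne] by auto
  qed
qed

context field
begin

text \<open>Membership conditions for primality, relative to the operations of the ambient field.\<close>

lemma primeideal_subring_iff:
  assumes A: "subring A R"
  shows "primeideal P (R\<lparr>carrier := A\<rparr>) \<longleftrightarrow>
    P \<subseteq> A \<and> \<zero> \<in> P \<and> (\<forall>a\<in>P. \<forall>b\<in>P. a \<oplus> b \<in> P) \<and> (\<forall>a\<in>A. \<forall>b\<in>P. a \<otimes> b \<in> P) \<and> \<one> \<notin> P \<and>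
    (\<forall>a\<in>A. \<forall>b\<in>A. a \<otimes> b \<in> P \<longrightarrow> a \<in> P \<or> b \<in> P)" (is "?L \<longleftrightarrow> ?R")
proof
  note Ac = subringE(1)[OF A]
  assume ?L
  then interpret P: primeideal P "R\<lparr>carrier := A\<rparr>" .
  have "\<one> \<notin> P"
  proof
    assume "\<one> \<in> P"
    then have "x \<in> P" if "x \<in> A" for x
      using P.I_r_closed[of \<one> x] that Ac by (auto simp: subset_iff)
    then show False using P.I_notcarr P.a_subset by auto
  qed
  then show ?R using P.a_subset P.I_prime P.I_l_closed P.additive_subgroup_axioms
    additive_subgroup.zero_closed[OF P.additive_subgroup_axioms]
    additive_subgroup.a_closed[OF P.additive_subgroup_axioms] by auto
next
  note Ac = subringE(1)[OF A]
  assume r: ?R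
  have mA: "\<ominus> \<one> \<in> A" using subringE(5)[OF A subringE(3)[OF A]] .
  have min: "\<ominus> b \<in> P" if b: "b \<in> P" for b
  proof -
    have "b \<in> carrier R" using b r Ac by blast
    moreover have "\<ominus> \<one> \<otimes> b \<in> P" using r b mA by blast
    ultimately show ?thesis by (simp add: l_minus)
  qed
  have ring: "ring (R\<lparr>carrier := A\<rparr>)" "cring (R\<lparr>carrier := A\<rparr>)"
    using subring_is_ring[OF A] subcringI'[OF A] subcring_iff[OF Ac] by auto
  have "ideal P (R\<lparr>carrier := A\<rparr>)"
  proof (rule idealI[OF ring(1)])
    show "subgroup P (add_monoid (R\<lparr>carrier := A\<rparr>))"
    proof (rule subgroup.intro)
      show "P \<subseteq> carrier (add_monoid (R\<lparr>carrier := A\<rparr>))" using r by simp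
      show "\<one>\<^bsub>add_monoid (R\<lparr>carrier := A\<rparr>)\<^esub> \<in> P" using r by simp
      fix x assume x: "x \<in> P"
      show "inv\<^bsub>add_monoid (R\<lparr>carrier := A\<rparr>)\<^esub> x \<in> P"
      proof -
        interpret RA: ring "R\<lparr>carrier := A\<rparr>" by (rule ring)
        have xA: "x \<in> A" "x \<in> carrier R" using x r Ac by auto
        have "\<ominus> x \<in> A" using subringE(5)[OF A xA(1)] .
        moreover have "\<ominus> x \<oplus> x = \<zero>" using xA by (simp add: l_neg)
        ultimately have "\<ominus>\<^bsub>R\<lparr>carrier := A\<rparr>\<^esub> x = \<ominus> x"
          using RA.minus_equality[of "\<ominus> x" x] xA by simp
        then show ?thesis using min[OF x] by (simp add: a_inv_def)
      qed
      fix y assume "y \<in> P"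
      then show "x \<otimes>\<^bsub>add_monoid (R\<lparr>carrier := A\<rparr>)\<^esub> y \<in> P" using r x by simp
    qed
    fix a x assume "a \<in> P" "x \<in> carrier (R\<lparr>carrier := A\<rparr>)"
    then have ax: "a \<in> P" "x \<in> A" "a \<in> carrier R" "x \<in> carrier R" using r Ac by auto
    show "x \<otimes>\<^bsub>R\<lparr>carrier := A\<rparr>\<^esub> a \<in> P" using ax r by simp
    then show "a \<otimes>\<^bsub>R\<lparr>carrier := A\<rparr>\<^esub> x \<in> P" using ax by (simp add: m_comm)
  qed
  then show ?L
  proof (rule primeidealI[OF _ ring(2)])
    show "carrier (R\<lparr>carrier := A\<rparr>) \<noteq> P" using r subringE(3)[OF A] by auto
  qed (use r in auto)
qed

lemma primeidealD:
  assumes A: "subring A R" and P: "primeideal P (R\<lparr>carrier := A\<rparr>)"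
  shows "P \<subseteq> A" "\<zero> \<in> P" "\<And>a b. a \<in> P \<Longrightarrow> b \<in> P \<Longrightarrow> a \<oplus> b \<in> P"
    "\<And>a b. a \<in> A \<Longrightarrow> b \<in> P \<Longrightarrow> a \<otimes> b \<in> P" "\<one> \<notin> P"
    "\<And>a b. a \<in> A \<Longrightarrow> b \<in> A \<Longrightarrow> a \<otimes> b \<in> P \<Longrightarrow> a \<in> P \<or> b \<in> P"
    "\<And>a n. a \<in> A \<Longrightarrow> a [^] (n::nat) \<in> P \<Longrightarrow> a \<in> P"
    "\<And>a. a \<in> P \<Longrightarrow> \<ominus> a \<in> P"
proof -
  note r = P[unfolded primeideal_subring_iff[OF A]]
  show 1: "P \<subseteq> A" "\<zero> \<in> P" "\<And>a b. a \<in> P \<Longrightarrow> b \<in> P \<Longrightarrow> a \<oplus> b \<in> P"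
    "\<And>a b. a \<in> A \<Longrightarrow> b \<in> P \<Longrightarrow> a \<otimes> b \<in> P" "\<one> \<notin> P"
    "\<And>a b. a \<in> A \<Longrightarrow> b \<in> A \<Longrightarrow> a \<otimes> b \<in> P \<Longrightarrow> a \<in> P \<or> b \<in> P" using r by auto
  fix a
  show "a \<in> P" if a: "a \<in> A" and p: "a [^] n \<in> P" for n :: nat
    using p
  proof (induct n)
    case 0 then show ?case using 1 by simp
  next
    case (Suc n) then show ?case using 1(6)[of "a [^] n" a] subring_pow[OF A a] a by auto
  qed
  assume a: "a \<in> P"
  have "a \<in> carrier R" using a 1(1) subringE(1)[OF A] by blast
  then show "\<ominus> a \<in> P" using 1(4)[OF subringE(5)[OF A subringE(3)[OF A]] a] by (simp add: l_minus)
qed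

lemma zero_primeideal:
  assumes A: "subring A R"
  shows "primeideal {\<zero>} (R\<lparr>carrier := A\<rparr>)"
  unfolding primeideal_subring_iff[OF A]
  using subringE(1,2)[OF A] integral by auto

lemma nonunits_primeideal:
  assumes V: "valring Q V"
  shows "primeideal (nonunits V) (R\<lparr>carrier := V\<rparr>)"
proof -
  have sV: "subring V R" using V by (rule valringD)
  note Vc = subringE(1)[OF sV]
  show ?thesis unfolding primeideal_subring_iff[OF sV]
  proof (intro conjI ballI impI)
    fix a b assume ab: "a \<in> V" "b \<in> V" "a \<otimes> b \<in> nonunits V"
    show "a \<in> nonunits V \<or> b \<in> nonunits V"
    proof (rule ccontr)
      assume "\<not> ?thesis"
      then have n: "a \<noteq> \<zero>" "inv a \<in> V" "b \<notin> nonunits V" using not_nonunit[OF sV ab(1)] by auto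
      have "inv a \<otimes> (a \<otimes> b) \<in> nonunits V" using nonunits_mult(2)[OF sV ab(3) n(2)] .
      moreover have "a \<in> carrier R" "b \<in> carrier R" using ab Vc by blast+
      ultimately show False using n by simp
    qed
  qed (use nonunits_subset zero_in_nonunits[OF sV] nonunits_add[OF V] nonunits_mult(2)[OF sV] one_notin_nonunits[OF sV] in auto)
qed

text \<open>Since \<open>{\<zero>}\<close> is prime, chains with \<open>n\<close> inclusions amount to chains of \<open>n\<close> nonzero primes.\<close>

lemma krull_dim_ge_iff:
  assumes A: "subring A R"
  shows "enat n \<le> krull_dim (R\<lparr>carrier := A\<rparr>) \<longleftrightarrow> (\<exists>Ps. length Ps = n \<and>
    (\<forall>P\<in>set Ps. primeideal P (R\<lparr>carrier := A\<rparr>) \<and> P \<noteq> {\<zero>}) \<and> sorted_wrt (\<subset>) Ps)"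
    (is "_ \<longleftrightarrow> (\<exists>Ps. length Ps = n \<and> ?nz Ps \<and> ?s Ps)")
proof -
  let ?c = "\<lambda>Ps. (\<forall>P\<in>set Ps. primeideal P (R\<lparr>carrier := A\<rparr>))"
  have "{enat n | n Ps. length Ps = Suc n \<and> ?c Ps \<and> sorted_wrt (\<subset>) Ps} =
    {enat n | n Ps. length Ps = n \<and> (?nz Ps \<and> sorted_wrt (\<subset>) Ps)}" (is "?L = ?R")
  proof (intro equalityI subsetI)
    fix e assume "e \<in> ?L"
    then obtain n Ps where e: "e = enat n" "length Ps = Suc n" "?c Ps" "?s Ps" by auto
    then obtain P Qs where P: "Ps = P # Qs" by (cases Ps) auto
    have "Q \<noteq> {\<zero>}" if Q: "Q \<in> set Qs" for Q
    proof -
      have "P \<subset> Q" using e P Q by auto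
      moreover have "\<zero> \<in> P" using primeidealD(2)[OF A] e P by auto
      ultimately show ?thesis by blast
    qed
    then have "length Qs = n" "?nz Qs" "?s Qs" using e P by auto
    then show "e \<in> ?R" using e by blast
  next
    fix e assume "e \<in> ?R"
    then obtain n Ps where e: "e = enat n" "length Ps = n" "?nz Ps" "?s Ps" by auto
    have "{\<zero>} \<subset> P" if P: "P \<in> set Ps" for P
      using primeidealD(2)[OF A, of P] e P by auto
    then have "length ({\<zero>} # Ps) = Suc n \<and> ?c ({\<zero>} # Ps) \<and> ?s ({\<zero>} # Ps)"
      using zero_primeideal[OF A] e by auto
    then show "e \<in> ?L" using e by blast
  qed
  then show ?thesis unfolding krull_dim_def
    by (simp only:) (rule enat_le_Sup_length_iff, auto simp: sorted_wrt_take dest: in_set_takeD)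
qed

text \<open>In terms of the valuation \<open>v\<close> of \<open>V\<close>: the value \<open>v(x)\<close> is positive and exceeds all multiples of
  \<open>v(y)\<close>.\<close>

definition dominates :: "'a set \<Rightarrow> 'a \<Rightarrow> 'a \<Rightarrow> bool" where
  "dominates V x y \<longleftrightarrow> (\<forall>n::nat. x \<otimes> inv (y [^] n) \<in> nonunits V)"

text \<open>Elements of the maximal ideal whose values generate strictly decreasing convex subgroups of the value
  group; the values are ordered lexicographically.\<close>

definition lexchain :: "'a set \<Rightarrow> 'a list \<Rightarrow> bool" where
  "lexchain V xs \<longleftrightarrow> set xs \<subseteq> nonunits V - {\<zero>} \<and> sorted_wrt (dominates V) xs"

lemma lexchain_Nil [simp]: "lexchain V []"
  by (simp add: lexchain_def)

lemma lexchain_Cons: "lexchain V (x # xs) \<longleftrightarrow>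
    x \<in> nonunits V \<and> x \<noteq> \<zero> \<and> (\<forall>y\<in>set xs. dominates V x y) \<and> lexchain V xs"
  by (auto simp: lexchain_def)

lemma lexchain_append: "lexchain V (xs @ ys) \<longleftrightarrow>
    lexchain V xs \<and> lexchain V ys \<and> (\<forall>x\<in>set xs. \<forall>y\<in>set ys. dominates V x y)"
  by (auto simp: lexchain_def sorted_wrt_append)

text \<open>The definition refers to \<open>V\<close> only through membership in \<open>nonunits V\<close>, hence this monotonicity.\<close>

lemma lexchain_mono:
  "lexchain V xs \<Longrightarrow> nonunits V \<subseteq> nonunits U \<Longrightarrow> lexchain U xs"
  unfolding lexchain_def dominates_def
  by (elim conjE, intro conjI) (auto elim!: sorted_wrt_mono_rel[rotated])

lemma lexchain_filter: "lexchain V xs \<Longrightarrow> lexchain V (filter p xs)"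
  by (auto simp: lexchain_def sorted_wrt_filter)

lemma valring_pow_in:
  assumes V: "valring Q V" and x: "x \<in> Q" "y \<in> Q" "y \<noteq> \<zero>"
  shows "x \<otimes> inv (y [^] (n::nat)) \<in> Q" "y [^] n \<in> Q" "inv (y [^] n) \<in> Q"
proof -
  have sQ: "subfield Q R" using V by (rule valringD)
  have yc: "y \<in> carrier R" using x valringD(4)[OF V] by blast
  show 1: "y [^] n \<in> Q" using subring_pow[OF subfieldE(1)[OF sQ]] x by blast
  show 2: "inv (y [^] n) \<in> Q" using subfield_inv[OF sQ 1] yc x by simp
  show "x \<otimes> inv (y [^] n) \<in> Q" using subringE(6)[OF subfieldE(1)[OF sQ]] x 2 by blast
qed

lemma not_dominates_iff:
  assumes V: "valring Q V" and x: "x \<in> Q" "y \<in> Q" "y \<noteq> \<zero>" "x \<noteq> \<zero>"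
  shows "\<not> dominates V x y \<longleftrightarrow> (\<exists>n::nat. y [^] n \<otimes> inv x \<in> V)"
proof -
  have c: "x \<in> carrier R" "y \<in> carrier R" using x valringD(4)[OF V] by auto
  have sQ: "subfield Q R" using V by (rule valringD)
  have "x \<otimes> inv (y [^] n) \<notin> nonunits V \<longleftrightarrow> y [^] n \<otimes> inv x \<in> V" for n :: nat
  proof -
    have q: "x \<otimes> inv (y [^] n) \<in> Q" using valring_pow_in[OF V x(1,2,3)] by blast
    have nz: "x \<otimes> inv (y [^] n) \<noteq> \<zero>" using c x by (simp add: integral_iff)
    have i: "inv (x \<otimes> inv (y [^] n)) = y [^] n \<otimes> inv x"
      using c x by (subst field_inv_mult) (auto simp: m_comm simp del: field_inv_pow)
    show ?thesis
      using valring_notin[OF V q] valringD(6)[OF V q nz] nz unfolding i[symmetric]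
      by (auto simp: nonunits_def)
  qed
  then show ?thesis unfolding dominates_def by blast
qed

lemma valring_divides:
  assumes V: "valring Q V" and ab: "a \<in> V" "b \<in> V"
  shows "(\<exists>c\<in>V. b = a \<otimes> c) \<or> (\<exists>c\<in>V. a = b \<otimes> c)"
proof (cases "a = \<zero> \<or> b = \<zero>")
  case True
  have "a \<in> carrier R" "b \<in> carrier R" using ab valringD(5)[OF V] by auto
  with True show ?thesis using subringE(2)[OF valringD(2)[OF V]] by (auto intro!: bexI[of _ \<zero>])
next
  case False
  have sQ: "subfield Q R" using V by (rule valringD)
  have c: "a \<in> carrier R" "b \<in> carrier R" "a \<in> Q" "b \<in> Q" using ab valringD(3,5)[OF V] by auto
  have q: "b \<otimes> inv a \<in> Q"
    using subringE(6)[OF subfieldE(1)[OF sQ] c(4) subfield_inv[OF sQ c(3)]] False by blast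
  have "b \<otimes> inv a \<noteq> \<zero>" using False c by (simp add: integral_iff)
  then have "b \<otimes> inv a \<in> V \<or> inv (b \<otimes> inv a) \<in> V" using valringD(6)[OF V q] by blast
  moreover have "inv (b \<otimes> inv a) = a \<otimes> inv b" using c False by (simp add: m_comm)
  moreover have "b = a \<otimes> (b \<otimes> inv a)" "a = b \<otimes> (a \<otimes> inv b)"
    using c False m_lcomm[of a b "inv a"] m_lcomm[of b a "inv b"] by simp_all
  ultimately show ?thesis by metis
qed

text \<open>For \<open>x \<in> V\<close> nonzero this is the radical of the principal ideal \<open>x V\<close>.\<close>

definition radical_of :: "'a set \<Rightarrow> 'a \<Rightarrow> 'a set" where
  "radical_of V x = {y \<in> V. \<exists>n::nat. y [^] n \<otimes> inv x \<in> V}"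

text \<open>Divisibility is total in \<open>V\<close>. If \<open>b = a c\<close>, then \<open>a + b\<close> is a multiple of \<open>a\<close> and \<open>b\<^sup>2\<close> is a multiple
  of \<open>a b\<close>, which gives closure under addition and primality.\<close>

lemma radical_of_prime:
  assumes V: "valring Q V" and x: "x \<in> nonunits V" "x \<noteq> \<zero>"
  shows "primeideal (radical_of V x) (R\<lparr>carrier := V\<rparr>)"
proof -
  have sV: "subring V R" and sQ: "subfield Q R" using V by (rule valringD)+
  note Vc = valringD(5)[OF V]
  have xc: "x \<in> carrier R" using x Vc nonunits_subset by blast
  then have ix: "inv x \<in> carrier R" using x by simp
  have pc: "a [^] n \<in> carrier R" if "a \<in> V" for a and n :: nat using that Vc by blast
  have mul: "a \<otimes> b \<in> radical_of V x" if a: "a \<in> V" and b: "b \<in> radical_of V x" for a b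
  proof -
    obtain n where n: "b \<in> V" "b [^] (n::nat) \<otimes> inv x \<in> V" using b by (auto simp: radical_of_def)
    have c: "a \<in> carrier R" "b \<in> carrier R" using a n Vc by auto
    have "(a \<otimes> b) [^] n \<otimes> inv x = a [^] n \<otimes> (b [^] n \<otimes> inv x)"
      using c ix by (simp add: nat_pow_distrib m_assoc)
    moreover have "a [^] n \<otimes> (b [^] n \<otimes> inv x) \<in> V"
      by (rule subringE(6)[OF sV subring_pow[OF sV a] n(2)])
    ultimately have "(a \<otimes> b) [^] n \<otimes> inv x \<in> V" by (simp only:)
    then show ?thesis using subringE(6)[OF sV a n(1)] unfolding radical_of_def by blast
  qed
  have sq: "b \<in> radical_of V x" if b: "b \<in> V" and bb: "b \<otimes> b \<in> radical_of V x" for b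
  proof -
    obtain n where n: "(b \<otimes> b) [^] (n::nat) \<otimes> inv x \<in> V" using bb by (auto simp: radical_of_def)
    have "(b \<otimes> b) [^] n = b [^] (n + n)" using b Vc by (auto simp: nat_pow_distrib nat_pow_mult)
    then show ?thesis using n b by (auto simp: radical_of_def)
  qed
  show ?thesis unfolding primeideal_subring_iff[OF sV]
  proof (intro conjI ballI impI)
    show "radical_of V x \<subseteq> V" by (auto simp: radical_of_def)
    have "\<zero> [^] (1::nat) \<otimes> inv x \<in> V" using ix subringE(2)[OF sV] by simp
    then show "\<zero> \<in> radical_of V x" using subringE(2)[OF sV] unfolding radical_of_def by blast
    show "\<one> \<notin> radical_of V x"
      using x ix by (auto simp: radical_of_def nonunits_def)
    show "a \<otimes> b \<in> radical_of V x" if "a \<in> V" "b \<in> radical_of V x" for a b using mul that by blast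
  next
    fix a b assume ab: "a \<in> radical_of V x" "b \<in> radical_of V x"
    then have V': "a \<in> V" "b \<in> V" by (auto simp: radical_of_def)
    have *: "a \<oplus> b \<in> radical_of V x" if "a \<in> radical_of V x" "c \<in> V" "b = a \<otimes> c" for a b c
    proof -
      have c: "a \<in> carrier R" "c \<in> carrier R" using that Vc by (auto simp: radical_of_def)
      have "a \<oplus> b = (\<one> \<oplus> c) \<otimes> a" unfolding that(3) using c by algebra
      moreover have "\<one> \<oplus> c \<in> V" using subringE(7)[OF sV subringE(3)[OF sV] that(2)] .
      ultimately show ?thesis using mul that(1) by simp
    qed
    from valring_divides[OF V V'] show "a \<oplus> b \<in> radical_of V x"
      using *[OF ab(1)] *[OF ab(2)] V' Vc by (auto simp: a_comm subset_iff)
  next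
    fix a b assume V': "a \<in> V" "b \<in> V" and ab: "a \<otimes> b \<in> radical_of V x"
    have *: "b \<in> radical_of V x"
      if ab: "a \<otimes> b \<in> radical_of V x" "a \<in> V" "c \<in> V" "b = a \<otimes> c" for a b c
    proof -
      have c: "a \<in> carrier R" "c \<in> carrier R" using that Vc by auto
      have "b \<otimes> b = c \<otimes> (a \<otimes> b)" unfolding that(4) using c by algebra
      then have "b \<otimes> b \<in> radical_of V x" using mul[OF that(3,1)] by simp
      then show ?thesis using sq subringE(6)[OF sV that(2,3)] that(4) by simp
    qed
    have ba: "b \<otimes> a \<in> radical_of V x" using ab V' Vc by (auto simp: m_comm subset_iff)
    from valring_divides[OF V V'] show "a \<in> radical_of V x \<or> b \<in> radical_of V x"
      using *[OF ab V'(1)] *[OF ba V'(2)] by blast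
  qed
qed

lemma dominatesD:
  assumes "valring Q V" "dominates V x y" "x \<in> carrier R"
  shows "x \<in> nonunits V" "y \<noteq> \<zero> \<Longrightarrow> y \<in> carrier R \<Longrightarrow> x \<otimes> inv y \<in> nonunits V"
  using assms(2)[unfolded dominates_def, rule_format, of 0]
    assms(2)[unfolded dominates_def, rule_format, of 1] assms(3) by auto

lemma radical_of_psubset:
  assumes V: "valring Q V" and x: "x \<in> nonunits V" "x \<noteq> \<zero>" and y: "y \<in> nonunits V" "y \<noteq> \<zero>"
    and d: "dominates V x y"
  shows "radical_of V x \<subset> radical_of V y"
proof
  have sV: "subring V R" using V by (rule valringD)
  have VQ: "x \<in> V" "y \<in> V" "x \<in> Q" "y \<in> Q" using x y valringD(3)[OF V] nonunits_subset by auto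
  then have c: "x \<in> carrier R" "y \<in> carrier R" using valringD(5)[OF V] by auto
  show "radical_of V x \<subseteq> radical_of V y"
  proof
    fix a assume "a \<in> radical_of V x"
    then obtain n where a: "a \<in> V" "a [^] (n::nat) \<otimes> inv x \<in> V" by (auto simp: radical_of_def)
    have ac: "a [^] n \<in> carrier R" using a valringD(5)[OF V] by blast
    have "x \<otimes> inv y \<in> V" using dominatesD(2)[OF V d] c y nonunits_subset by blast
    then have "(a [^] n \<otimes> inv x) \<otimes> (x \<otimes> inv y) \<in> V" using subringE(6)[OF sV a(2)] by blast
    moreover have "(a [^] n \<otimes> inv x) \<otimes> (x \<otimes> inv y) = a [^] n \<otimes> inv y"
      using ac c x y by (simp add: m_assoc)
    ultimately show "a \<in> radical_of V y" using a by (auto simp: radical_of_def)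
  qed
  have "y [^] (1::nat) \<otimes> inv y \<in> V" using c y subringE(3)[OF sV] by simp
  then have "y \<in> radical_of V y" using VQ unfolding radical_of_def by blast
  moreover have "y \<notin> radical_of V x"
    using d not_dominates_iff[OF V VQ(3,4) y(2) x(2)] by (auto simp: radical_of_def)
  ultimately show "radical_of V x \<noteq> radical_of V y" by blast
qed

text \<open>If \<open>x\<close> did not dominate \<open>y\<close>, some power of \<open>y\<close> would be a multiple of \<open>x\<close> and lie in \<open>P\<close>.\<close>

lemma prime_separates_dominates:
  assumes V: "valring Q V" and P: "primeideal P (R\<lparr>carrier := V\<rparr>)"
    and x: "x \<in> P" "x \<noteq> \<zero>" and y: "y \<in> V" "y \<notin> P"
  shows "dominates V x y"
proof (rule ccontr)
  have sV: "subring V R" using V by (rule valringD)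
  note PD = primeidealD[OF sV P]
  have VQ: "x \<in> V" "x \<in> Q" "y \<in> Q" using x y PD(1) valringD(3)[OF V] by auto
  then have c: "x \<in> carrier R" "y \<in> carrier R" using valringD(4)[OF V] by auto
  have ynz: "y \<noteq> \<zero>" using y PD(2) by blast
  assume "\<not> dominates V x y"
  then obtain n where n: "y [^] (n::nat) \<otimes> inv x \<in> V"
    using not_dominates_iff[OF V VQ(2,3) ynz x(2)] by blast
  have "(y [^] n \<otimes> inv x) \<otimes> x = y [^] n" using c x by (simp add: m_assoc)
  then have "y [^] n \<in> P" using PD(4)[OF n x(1)] by simp
  then show False using PD(7) y by blast
qed

text \<open>One element is chosen from each difference of consecutive primes.\<close>

lemma prime_chain_lexchain:
  assumes V: "valring Q V"
  shows "sorted_wrt (\<subset>) (P # Ps) \<Longrightarrow> (\<forall>P\<in>set (P # Ps). primeideal P (R\<lparr>carrier := V\<rparr>)) \<Longrightarrow>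
    \<exists>xs. length xs = length Ps \<and> lexchain V xs \<and> set xs \<inter> P = {}"
proof (induct Ps arbitrary: P)
  case Nil then show ?case by simp
next
  case (Cons P' Ps)
  have sV: "subring V R" using V by (rule valringD)
  have P: "primeideal P (R\<lparr>carrier := V\<rparr>)" "primeideal P' (R\<lparr>carrier := V\<rparr>)" "P \<subset> P'"
    using Cons by auto
  obtain xs where xs: "length xs = length Ps" "lexchain V xs" "set xs \<inter> P' = {}"
    using Cons(1)[of P'] Cons(2,3) by auto
  obtain x where x: "x \<in> P'" "x \<notin> P" using P by blast
  have xnz: "x \<noteq> \<zero>" using x primeidealD(2)[OF sV P(1)] by blast
  have xV: "x \<in> V" using x primeidealD(1)[OF sV P(2)] by blast
  have "x \<in> nonunits V"
  proof (rule ccontr)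
    assume "x \<notin> nonunits V"
    then have "inv x \<otimes> x \<in> P'" using not_nonunit(2)[OF sV xV] primeidealD(4)[OF sV P(2)] x by blast
    moreover have "x \<in> carrier R" using xV valringD(5)[OF V] by blast
    ultimately show False using xnz primeidealD(5)[OF sV P(2)] by simp
  qed
  moreover have "dominates V x y" if y: "y \<in> set xs" for y
    using prime_separates_dominates[OF V P(2) x(1) xnz, of y] y xs(2,3) nonunits_subset
    by (auto simp: lexchain_def)
  ultimately have "lexchain V (x # xs)" using xnz xs(2) by (auto simp: lexchain_Cons)
  then show ?case using xs(1,3) x P(3) by (intro exI[of _ "x # xs"]) auto
qed

text \<open>The primes \<open>radical_of V x\<close> turn a lexchain back into a chain of primes.\<close>

theorem krull_dim_valring_ge_iff:
  assumes V: "valring Q V"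
  shows "enat n \<le> krull_dim (R\<lparr>carrier := V\<rparr>) \<longleftrightarrow> (\<exists>xs. length xs = n \<and> lexchain V xs)"
proof -
  have sV: "subring V R" using V by (rule valringD)
  show ?thesis unfolding krull_dim_ge_iff[OF sV]
  proof (intro iffI; elim exE conjE)
    fix Ps assume Ps: "length Ps = n" "\<forall>P\<in>set Ps. primeideal P (R\<lparr>carrier := V\<rparr>) \<and> P \<noteq> {\<zero>}"
      "sorted_wrt (\<subset>) Ps"
    have "{\<zero>} \<subset> P" if P: "P \<in> set Ps" for P
      using primeidealD(2)[OF sV, of P] Ps P by auto
    then show "\<exists>xs. length xs = n \<and> lexchain V xs"
      using prime_chain_lexchain[OF V, of "{\<zero>}" Ps] Ps zero_primeideal[OF sV] by auto
  next
    fix xs assume xs: "length xs = n" "lexchain V xs"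
    have nz: "radical_of V x \<noteq> {\<zero>}" if x: "x \<in> nonunits V" "x \<noteq> \<zero>" for x
    proof -
      have "x \<in> V" "x \<in> carrier R" using x valringD(5)[OF V] by (auto simp: nonunits_def)
      then have "x [^] (1::nat) \<otimes> inv x \<in> V" using x subringE(3)[OF sV] by simp
      then have "x \<in> radical_of V x" using \<open>x \<in> V\<close> unfolding radical_of_def by blast
      then show ?thesis using x by blast
    qed
    have "sorted_wrt (\<lambda>x y. radical_of V x \<subset> radical_of V y) xs"
    proof (rule sorted_wrt_mono_rel[of xs "dominates V"])
      show "sorted_wrt (dominates V) xs" using xs(2) by (simp add: lexchain_def)
      fix x y assume "x \<in> set xs" "y \<in> set xs" "dominates V x y"
      then show "radical_of V x \<subset> radical_of V y"
        using radical_of_psubset[OF V, of x y] xs(2) by (auto simp: lexchain_def subset_iff)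
    qed
    then have "sorted_wrt (\<subset>) (map (radical_of V) xs)" by (simp add: sorted_wrt_map)
    moreover have "\<forall>P\<in>set (map (radical_of V) xs). primeideal P (R\<lparr>carrier := V\<rparr>) \<and> P \<noteq> {\<zero>}"
      using xs(2) nz radical_of_prime[OF V] by (auto simp: lexchain_def)
    ultimately show "\<exists>Ps. length Ps = n \<and> (\<forall>P\<in>set Ps. primeideal P (R\<lparr>carrier := V\<rparr>) \<and> P \<noteq> {\<zero>})
      \<and> sorted_wrt (\<subset>) Ps" using xs(1) by (intro exI[of _ "map (radical_of V) xs"]) auto
  qed
qed

end

section \<open>Quotient fields and the \<open>w\<close>-operation\<close>

text \<open>Inequalities between dimensions are proved one natural number at a time, which avoids any case
  distinction for infinite dimensions.\<close>

lemma enat_le_if_all: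
  assumes "\<And>n. enat n \<le> a \<Longrightarrow> enat n \<le> b"
  shows "a \<le> b"
proof (cases b)
  case (enat m)
  show ?thesis
  proof (rule ccontr)
    assume "\<not> a \<le> b"
    then have "enat (Suc m) \<le> a" using enat by (simp add: Suc_ile_eq)
    then show False using assms[of "Suc m"] enat by simp
  qed
qed simp

context field
begin

lemma quot_field_memI: "a \<in> A \<Longrightarrow> b \<in> A \<Longrightarrow> b \<noteq> \<zero> \<Longrightarrow> a \<otimes> inv b \<in> quot_field R A"
  unfolding quot_field_def by blast

lemma quot_field_memE:
  assumes "x \<in> quot_field R A"
  obtains a b where "a \<in> A" "b \<in> A" "b \<noteq> \<zero>" "x = a \<otimes> inv b"
  using assms unfolding quot_field_def by blast

lemma quot_field_incl: "subring A R \<Longrightarrow> A \<subseteq> quot_field R A"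
proof
  fix a assume A: "subring A R" and a: "a \<in> A"
  have "a \<otimes> inv \<one> \<in> quot_field R A" using quot_field_memI[OF a subringE(3)[OF A]] by simp
  then show "a \<in> quot_field R A" using a subringE(1)[OF A] by auto
qed

lemma quot_field_least:
  assumes B: "subfield B R" and AB: "A \<subseteq> B"
  shows "quot_field R A \<subseteq> B"
proof
  fix x assume "x \<in> quot_field R A"
  then obtain a b where x: "a \<in> A" "b \<in> A" "b \<noteq> \<zero>" "x = a \<otimes> inv b" by (rule quot_field_memE)
  then show "x \<in> B" using subringE(6)[OF subfieldE(1)[OF B]] subfield_inv[OF B] AB by blast
qed

lemma quot_field_carrier: "subring A R \<Longrightarrow> quot_field R A \<subseteq> carrier R"
  using quot_field_least[OF carrier_is_subfield] subringE(1)[of A R] by blast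

lemma quot_field_subfield:
  assumes A: "subring A R"
  shows "subfield (quot_field R A) R"
proof (rule subfieldI')
  note Ac = subringE(1)[OF A]
  show "subring (quot_field R A) R"
  proof (rule subringI[OF quot_field_carrier[OF A]])
    show "\<one> \<in> quot_field R A" using quot_field_incl[OF A] subringE(3)[OF A] by blast
    fix x assume "x \<in> quot_field R A"
    then obtain a b where x: "a \<in> A" "b \<in> A" "b \<noteq> \<zero>" "x = a \<otimes> inv b" by (rule quot_field_memE)
    then have c: "a \<in> carrier R" "b \<in> carrier R" using Ac by auto
    have "\<ominus> x = (\<ominus> a) \<otimes> inv b" using x c by (simp add: l_minus)
    then show "\<ominus> x \<in> quot_field R A" using quot_field_memI[OF subringE(5)[OF A x(1)] x(2,3)] by simp
    fix y assume "y \<in> quot_field R A"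
    then obtain c d where y: "c \<in> A" "d \<in> A" "d \<noteq> \<zero>" "y = c \<otimes> inv d" by (rule quot_field_memE)
    then have c': "c \<in> carrier R" "d \<in> carrier R" using Ac by auto
    have nz: "b \<otimes> d \<noteq> \<zero>" using x y c c' by (simp add: integral_iff)
    have ic: "inv b \<in> carrier R" "inv d \<in> carrier R" using x y c c' by auto
    have "x \<otimes> y = (a \<otimes> c) \<otimes> inv (b \<otimes> d)"
      using x y c c' ic by (simp add: m_ac)
    then show "x \<otimes> y \<in> quot_field R A"
      using quot_field_memI[OF subringE(6)[OF A x(1) y(1)] subringE(6)[OF A x(2) y(2)] nz] by simp
    have "a \<otimes> inv b = (a \<otimes> d) \<otimes> (inv b \<otimes> inv d)" "c \<otimes> inv d = (c \<otimes> b) \<otimes> (inv b \<otimes> inv d)"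
      using x y c c' ic m_lcomm[of d "inv b" "inv d"] by (simp_all add: m_assoc)
    then have "x \<oplus> y = (a \<otimes> d \<oplus> c \<otimes> b) \<otimes> inv (b \<otimes> d)"
      using x y c c' ic by (simp add: l_distr)
    moreover have "a \<otimes> d \<oplus> c \<otimes> b \<in> A"
      using subringE(7)[OF A subringE(6)[OF A x(1) y(2)] subringE(6)[OF A y(1) x(2)]] .
    ultimately show "x \<oplus> y \<in> quot_field R A"
      using quot_field_memI[OF _ subringE(6)[OF A x(2) y(2)] nz] by simp
  qed
  fix x assume "x \<in> quot_field R A - {\<zero>}"
  then have xq: "x \<in> quot_field R A" "x \<noteq> \<zero>" by auto
  from xq(1) obtain a b where x: "a \<in> A" "b \<in> A" "b \<noteq> \<zero>" "x = a \<otimes> inv b" by (rule quot_field_memE)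
  then have c: "a \<in> carrier R" "b \<in> carrier R" using Ac by auto
  have "a \<noteq> \<zero>" using xq x c by auto
  then have "inv x = b \<otimes> inv a" using x c by (simp add: m_comm)
  then show "inv x \<in> quot_field R A" using quot_field_memI x \<open>a \<noteq> \<zero>\<close> by simp
qed

lemma quot_field_eqI:
  assumes "subring A R" "subring B R" "A \<subseteq> B" "B \<subseteq> quot_field R A"
  shows "quot_field R B = quot_field R A"
proof
  show "quot_field R B \<subseteq> quot_field R A"
    by (rule quot_field_least[OF quot_field_subfield[OF assms(1)] assms(4)])
  show "quot_field R A \<subseteq> quot_field R B"
    by (rule quot_field_least[OF quot_field_subfield[OF assms(2)]])
       (use assms(3) quot_field_incl[OF assms(2)] in blast)
qed

lemma valuation_overring_iff:
  assumes A: "subring A R"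
  shows "valuation_overring R A V \<longleftrightarrow> valring (quot_field R A) V \<and> A \<subseteq> V"
  unfolding valuation_overring_def overring_def valring_def
  using quot_field_subfield[OF A] quot_field_eqI[OF A, of V] by auto

lemma Span_mem_Cons:
  "Span A (u # us) = {k \<otimes> u \<oplus> v | k v. k \<in> A \<and> v \<in> Span A us}"
proof -
  have "Span A (u # us) = line_extension A u (Span A us)" by simp
  then show ?thesis using line_extension_mem_iff[of _ A u "Span A us"] by blast
qed

lemma Span_subgroup:
  assumes A: "subring A R" and us: "set us \<subseteq> carrier R"
  shows "additive_subgroup (Span A us) R" "\<And>r a. r \<in> A \<Longrightarrow> a \<in> Span A us \<Longrightarrow> r \<otimes> a \<in> Span A us"
    "set us \<subseteq> Span A us"
proof -
  note Ac = subringE(1)[OF A]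
  have "Span A us \<subseteq> carrier R \<and> \<zero> \<in> Span A us \<and> (\<forall>a\<in>Span A us. \<forall>b\<in>Span A us. a \<oplus> b \<in> Span A us)
     \<and> (\<forall>r\<in>A. \<forall>a\<in>Span A us. r \<otimes> a \<in> Span A us) \<and> set us \<subseteq> Span A us"
    using us
  proof (induct us)
    case Nil then show ?case using Ac by auto
  next
    case (Cons u us)
    then have u: "u \<in> carrier R" and
      IH: "Span A us \<subseteq> carrier R" "\<zero> \<in> Span A us" "\<And>a b. a \<in> Span A us \<Longrightarrow> b \<in> Span A us \<Longrightarrow> a \<oplus> b \<in> Span A us"
        "\<And>r a. r \<in> A \<Longrightarrow> a \<in> Span A us \<Longrightarrow> r \<otimes> a \<in> Span A us" "set us \<subseteq> Span A us" by auto
    have I: "k \<otimes> u \<oplus> v \<in> Span A (u # us)" if "k \<in> A" "v \<in> Span A us" for k v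
      using that unfolding Span_mem_Cons by blast
    have E: "\<exists>k v. a = k \<otimes> u \<oplus> v \<and> k \<in> A \<and> v \<in> Span A us \<and> k \<in> carrier R \<and> v \<in> carrier R"
      if "a \<in> Span A (u # us)" for a
      using that Ac IH(1) unfolding Span_mem_Cons by blast
    have "Span A (u # us) \<subseteq> carrier R" using E u by fastforce
    moreover have "\<zero> \<in> Span A (u # us)" using I[OF subringE(2)[OF A] IH(2)] u by simp
    moreover have "a \<oplus> b \<in> Span A (u # us)" if a: "a \<in> Span A (u # us)" and b: "b \<in> Span A (u # us)" for a b
    proof -
      obtain k v k' v' where kv: "a = k \<otimes> u \<oplus> v" "k \<in> A" "v \<in> Span A us" "k \<in> carrier R" "v \<in> carrier R"
         "b = k' \<otimes> u \<oplus> v'" "k' \<in> A" "v' \<in> Span A us" "k' \<in> carrier R" "v' \<in> carrier R"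
        using E[OF a] E[OF b] by auto
      have "a \<oplus> b = (k \<oplus> k') \<otimes> u \<oplus> (v \<oplus> v')" using kv u by algebra
      then show ?thesis using I[OF subringE(7)[OF A kv(2,7)] IH(3)[OF kv(3,8)]] by simp
    qed
    moreover have "r \<otimes> a \<in> Span A (u # us)" if r: "r \<in> A" and a: "a \<in> Span A (u # us)" for r a
    proof -
      obtain k v where kv: "a = k \<otimes> u \<oplus> v" "k \<in> A" "v \<in> Span A us" "k \<in> carrier R" "v \<in> carrier R"
        using E[OF a] by auto
      have "r \<in> carrier R" using r Ac by blast
      then have "r \<otimes> a = (r \<otimes> k) \<otimes> u \<oplus> r \<otimes> v" using kv u by algebra
      then show ?thesis using I[OF subringE(6)[OF A r kv(2)] IH(4)[OF r kv(3)]] by simp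
    qed
    moreover have "set (u # us) \<subseteq> Span A (u # us)"
    proof -
      have "u \<in> Span A (u # us)" using I[OF subringE(3)[OF A] IH(2)] u by simp
      moreover have "v \<in> Span A (u # us)" if v: "v \<in> set us" for v
      proof -
        have "v \<in> Span A us" "v \<in> carrier R" using v IH(1,5) by auto
        then show ?thesis using I[OF subringE(2)[OF A], of v] u by simp
      qed
      ultimately show ?thesis by auto
    qed
    ultimately show ?case by blast
  qed
  then have S: "Span A us \<subseteq> carrier R" "\<zero> \<in> Span A us" "\<And>a b. a \<in> Span A us \<Longrightarrow> b \<in> Span A us \<Longrightarrow> a \<oplus> b \<in> Span A us"
     "\<And>r a. r \<in> A \<Longrightarrow> a \<in> Span A us \<Longrightarrow> r \<otimes> a \<in> Span A us" "set us \<subseteq> Span A us" by blast+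
  show "r \<otimes> a \<in> Span A us" if "r \<in> A" "a \<in> Span A us" for r a using that S by blast
  show "set us \<subseteq> Span A us" by (rule S)
  have "\<ominus> a \<in> Span A us" if a: "a \<in> Span A us" for a
  proof -
    have "a \<in> carrier R" using a S(1) by blast
    then show ?thesis using S(4)[OF subringE(5)[OF A subringE(3)[OF A]] a] by (simp add: l_minus)
  qed
  then show "additive_subgroup (Span A us) R"
    using S by (intro additive_subgroup.intro add.subgroupI) auto
qed

lemma Span_least:
  assumes "\<zero> \<in> B" "\<And>a b. a \<in> B \<Longrightarrow> b \<in> B \<Longrightarrow> a \<oplus> b \<in> B" "\<And>r a. r \<in> A \<Longrightarrow> a \<in> B \<Longrightarrow> r \<otimes> a \<in> B"
  shows "set us \<subseteq> B \<Longrightarrow> Span A us \<subseteq> B"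
proof (induct us)
  case Nil then show ?case using assms by simp
next
  case (Cons u us)
  then have "u \<in> B" "Span A us \<subseteq> B" by auto
  then show ?case unfolding Span_mem_Cons using assms(2,3) by blast
qed

text \<open>The finite generating sets of the ideals \<open>J\<close> with \<open>J\<^sup>v = A\<close>, also called Glaz--Vasconcelos ideals:
  for \<open>J \<subseteq> A\<close> the condition \<open>J\<^sup>v = A\<close> means \<open>J\<^sup>-\<^sup>1 = A\<close>, and this can be tested on generators. If \<open>A\<close> is a
  field, nonzeroness must be demanded explicitly.\<close>

definition gv_set :: "'a set \<Rightarrow> 'a set \<Rightarrow> bool" where
  "gv_set A us \<longleftrightarrow> finite us \<and> us \<subseteq> A \<and> \<not> us \<subseteq> {\<zero>} \<and>
     (\<forall>x\<in>quot_field R A. (\<forall>u\<in>us. x \<otimes> u \<in> A) \<longrightarrow> x \<in> A)"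

definition gv_ideal :: "'a set \<Rightarrow> 'a set \<Rightarrow> bool" where
  "gv_ideal A J \<longleftrightarrow> J \<in> fg_frac_ideals R A \<and> J \<subseteq> A \<and> v_closure R A J = A"

text \<open>As \<open>J\<^sup>v\<close> contains one, every element of \<open>J\<^sup>-\<^sup>1\<close> lies in \<open>A\<close>; whether an element lies in \<open>J\<^sup>-\<^sup>1\<close> can be
  tested on the generators of \<open>J\<close>.\<close>

lemma gv_idealD:
  assumes A: "subring A R" and J: "gv_ideal A J"
  shows "\<And>x. x \<in> quot_field R A \<Longrightarrow> (\<And>j. j \<in> J \<Longrightarrow> x \<otimes> j \<in> A) \<Longrightarrow> x \<in> A"
    "\<exists>us. set us \<subseteq> J \<and> J = Span A us \<and> gv_set A (set us)"
proof -
  have J': "J \<in> frac_ideals R A" "J \<subseteq> A" "v_closure R A J = A" "\<exists>us. set us \<subseteq> J \<and> J = Span A us"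
    using J by (auto simp: gv_ideal_def fg_frac_ideals_def simp del: Span.simps)
  show 1: "x \<in> A" if x: "x \<in> quot_field R A" "\<And>j. j \<in> J \<Longrightarrow> x \<otimes> j \<in> A" for x
  proof -
    have "x \<in> ideal_inverse R A J" using x by (simp add: ideal_inverse_def)
    moreover have "\<one> \<in> v_closure R A J" using J'(3) subringE(3)[OF A] by simp
    ultimately have "\<one> \<otimes> x \<in> A" unfolding v_closure_def by (subst (asm) ideal_inverse_def) auto
    then show ?thesis using x(1) quot_field_carrier[OF A] by auto
  qed
  obtain us where us: "set us \<subseteq> J" "J = Span A us" using J'(4) by blast
  have "\<not> set us \<subseteq> {\<zero>}"
  proof
    assume "set us \<subseteq> {\<zero>}"
    then have "J \<subseteq> {\<zero>}" unfolding us(2)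
      by (rule Span_least[rotated -1]) (use subringE(1)[OF A] in auto)
    then show False using J'(1) us Span_subgroup(1)[OF A, of us] J'(2) subringE(1)[OF A]
       additive_subgroup.zero_closed[of J R] by (auto simp: frac_ideals_def)
  qed
  moreover have "x \<in> A" if x: "x \<in> quot_field R A" "\<forall>u\<in>set us. x \<otimes> u \<in> A" for x
  proof (rule 1[OF x(1)])
    have xc: "x \<in> carrier R" using x quot_field_carrier[OF A] by blast
    have "Span A us \<subseteq> {j \<in> carrier R. x \<otimes> j \<in> A}"
    proof (rule Span_least)
      show "set us \<subseteq> {j \<in> carrier R. x \<otimes> j \<in> A}" using x us J'(2) subringE(1)[OF A] by auto
      show "\<zero> \<in> {j \<in> carrier R. x \<otimes> j \<in> A}" using xc subringE(2)[OF A] by simp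
      fix a b assume "a \<in> {j \<in> carrier R. x \<otimes> j \<in> A}" "b \<in> {j \<in> carrier R. x \<otimes> j \<in> A}"
      then show "a \<oplus> b \<in> {j \<in> carrier R. x \<otimes> j \<in> A}"
        using xc subringE(7)[OF A] by (simp add: r_distr)
    next
      fix r a assume r: "r \<in> A" and a: "a \<in> {j \<in> carrier R. x \<otimes> j \<in> A}"
      have "r \<in> carrier R" using r subringE(1)[OF A] by blast
      then show "r \<otimes> a \<in> {j \<in> carrier R. x \<otimes> j \<in> A}"
        using xc a subringE(6)[OF A r, of "x \<otimes> a"] m_lcomm[of x r a] by simp
    qed
    then show "x \<otimes> j \<in> A" if "j \<in> J" for j using that us(2) by blast
  qed
  ultimately have "gv_set A (set us)" unfolding gv_set_def using us J'(2) by blast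
  then show "\<exists>us. set us \<subseteq> J \<and> J = Span A us \<and> gv_set A (set us)" using us by blast
qed

lemma gv_ideal_Span:
  assumes A: "subring A R" and us: "gv_set A (set us)"
  shows "gv_ideal A (Span A us)"
proof -
  note Ac = subringE(1)[OF A]
  have us': "set us \<subseteq> A" "\<not> set us \<subseteq> {\<zero>}" "\<And>x. x \<in> quot_field R A \<Longrightarrow> \<forall>u\<in>set us. x \<otimes> u \<in> A \<Longrightarrow> x \<in> A"
    using us by (auto simp: gv_set_def)
  have usc: "set us \<subseteq> carrier R" using us'(1) Ac by blast
  note S = Span_subgroup[OF A usc]
  have SA: "Span A us \<subseteq> A"
    by (rule Span_least[OF _ _ _ us'(1)]) (use subringE(2,6,7)[OF A] in auto)
  have "\<one> \<otimes> a \<in> A" if "a \<in> Span A us" for a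
  proof -
    have "a \<in> A" using that SA by blast
    moreover have "a \<in> carrier R" using calculation Ac by blast
    ultimately show ?thesis by simp
  qed
  then have "\<exists>d\<in>A. d \<noteq> \<zero> \<and> (\<forall>a\<in>Span A us. d \<otimes> a \<in> A)" using subringE(3)[OF A] one_not_zero by blast
  moreover have "Span A us \<noteq> {\<zero>}" using us'(2) S(3) by blast
  ultimately have "Span A us \<in> frac_ideals R A"
    unfolding frac_ideals_def using S(1,2) SA quot_field_incl[OF A] by blast
  then have fg: "Span A us \<in> fg_frac_ideals R A" unfolding fg_frac_ideals_def using S(3) by blast
  have inv1: "ideal_inverse R A (Span A us) = A"
  proof
    show "ideal_inverse R A (Span A us) \<subseteq> A" unfolding ideal_inverse_def using us'(3) S(3) by blast
    show "A \<subseteq> ideal_inverse R A (Span A us)"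
      unfolding ideal_inverse_def using quot_field_incl[OF A] subringE(6)[OF A] SA by blast
  qed
  have "ideal_inverse R A A = A"
  proof
    show "ideal_inverse R A A \<subseteq> A"
    proof
      fix x assume "x \<in> ideal_inverse R A A"
      then have "x \<in> quot_field R A" "x \<otimes> \<one> \<in> A" using subringE(3)[OF A] by (auto simp: ideal_inverse_def)
      then show "x \<in> A" using quot_field_carrier[OF A] by auto
    qed
    show "A \<subseteq> ideal_inverse R A A"
      unfolding ideal_inverse_def using quot_field_incl[OF A] subringE(6)[OF A] by blast
  qed
  then have "v_closure R A (Span A us) = A" unfolding v_closure_def inv1 .
  then show ?thesis unfolding gv_ideal_def using fg SA by blast
qed

lemma w_closure_iff:
  "x \<in> w_closure R A I \<longleftrightarrow> x \<in> quot_field R A \<and> (\<exists>J. gv_ideal A J \<and> (\<forall>j\<in>J. x \<otimes> j \<in> I))"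
  unfolding w_closure_def gv_ideal_def by blast

text \<open>An element of \<open>J\<close> that is a unit of \<open>V\<close> turns \<open>x J \<subseteq> I\<close> into \<open>x \<in> I V\<close>. Conversely, for \<open>I = J\<close> the
  closure contains one, so \<open>J V = V\<close> and \<open>J\<close> is not contained in the maximal ideal of \<open>V\<close>.\<close>

theorem w_valuation_overring_iff:
  assumes A: "subring A R"
  shows "w_valuation_overring R A V \<longleftrightarrow> valring (quot_field R A) V \<and> A \<subseteq> V \<and>
    (\<forall>us. gv_set A us \<longrightarrow> \<not> us \<subseteq> nonunits V)"
proof (cases "valring (quot_field R A) V \<and> A \<subseteq> V")
  case False
  then show ?thesis unfolding w_valuation_overring_def valuation_overring_iff[OF A] by blast
next
  case True
  then have V: "valring (quot_field R A) V" and AV: "A \<subseteq> V" by auto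
  have sV: "subring V R" using V by (rule valringD)
  note Vc = valringD(5)[OF V]
  have "(\<forall>I\<in>fg_frac_ideals R A. w_closure R A I \<subseteq> I \<cdot> V) \<longleftrightarrow> (\<forall>us. gv_set A us \<longrightarrow> \<not> us \<subseteq> nonunits V)"
    (is "?L \<longleftrightarrow> ?R")
  proof
    assume L: ?L
    show ?R
    proof (intro allI impI notI)
      fix us assume us: "gv_set A us" and n: "us \<subseteq> nonunits V"
      obtain ul where ul: "set ul = us" using us finite_list unfolding gv_set_def by blast
      let ?J = "Span A ul"
      have J: "gv_ideal A ?J" using gv_ideal_Span[OF A] us ul by blast
      then have "?J \<subseteq> A" by (simp add: gv_ideal_def)
      then have "?J \<subseteq> {j \<in> carrier R. j \<in> ?J}" using subringE(1)[OF A] by blast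
      then have "\<forall>j\<in>?J. \<one> \<otimes> j \<in> ?J" by (auto simp del: Span.simps)
      then have "\<one> \<in> w_closure R A ?J" unfolding w_closure_iff
        using J quot_field_incl[OF A] subringE(3)[OF A] by blast
      then have "\<one> \<in> ?J \<cdot> V" using L J by (auto simp: gv_ideal_def simp del: Span.simps)
      moreover have JV: "?J \<subseteq> nonunits V"
        by (rule Span_least) (use n ul zero_in_nonunits[OF sV] nonunits_add[OF V] nonunits_mult(2)[OF sV] AV in auto)
      have "x \<in> nonunits V" if "x \<in> ?J \<cdot> V" for x
        using that
      proof (induct x rule: ideal_prod.induct)
        case (prod i j) then show ?case using nonunits_mult(1)[OF sV] JV by blast
      next
        case (sum s1 s2) then show ?case using nonunits_add[OF V] by blast
      qed
      ultimately show False using one_notin_nonunits[OF sV] by blast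
    qed
  next
    assume r: ?R
    show ?L
    proof (intro ballI subsetI)
      fix I x assume I: "I \<in> fg_frac_ideals R A" and "x \<in> w_closure R A I"
      then obtain J where x: "x \<in> quot_field R A" and J: "gv_ideal A J" "\<forall>j\<in>J. x \<otimes> j \<in> I"
        unfolding w_closure_iff by blast
      obtain us where us: "set us \<subseteq> J" "gv_set A (set us)" using gv_idealD(2)[OF A J(1)] by blast
      obtain u where u: "u \<in> set us" "u \<notin> nonunits V" using r us(2) by blast
      have uV: "u \<in> V" using u us AV by (auto simp: gv_set_def)
      have unz: "u \<noteq> \<zero>" "inv u \<in> V" using not_nonunit[OF sV uV u(2)] by auto
      have "x \<otimes> u \<otimes> inv u \<in> I \<cdot> V" by (rule ideal_prod.prod) (use J us u unz in auto)
      moreover have "x \<in> carrier R" "u \<in> carrier R" using x quot_field_carrier[OF A] uV Vc by auto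
      ultimately show "x \<in> I \<cdot> V" using unz by (simp add: m_assoc)
    qed
  qed
  then show ?thesis unfolding w_valuation_overring_def valuation_overring_iff[OF A] using V AV by blast
qed

text \<open>If \<open>J \<subseteq> P\<close>, then the closure of \<open>P\<close> contains one. Otherwise \<open>x J \<subseteq> P\<close> first gives \<open>x \<in> J\<^sup>-\<^sup>1 = A\<close>, and
  then \<open>x \<in> P\<close> because \<open>P\<close> is prime.\<close>

theorem w_prime_iff:
  assumes A: "subring A R"
  shows "w_prime R A P \<longleftrightarrow> primeideal P (R\<lparr>carrier := A\<rparr>) \<and> P \<noteq> {\<zero>} \<and>
    (\<forall>us. gv_set A us \<longrightarrow> \<not> us \<subseteq> P)"
proof (cases "primeideal P (R\<lparr>carrier := A\<rparr>)")
  case False then show ?thesis by (simp add: w_prime_def)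
next
  case True
  note PD = primeidealD[OF A True]
  have id: "ideal P (R\<lparr>carrier := A\<rparr>)" using True by (rule primeideal.axioms)
  have "w_closure R A P = P \<longleftrightarrow> (\<forall>us. gv_set A us \<longrightarrow> \<not> us \<subseteq> P)" (is "?L \<longleftrightarrow> ?R")
  proof
    assume L: ?L
    show ?R
    proof (intro allI impI notI)
      fix us assume us: "gv_set A us" and n: "us \<subseteq> P"
      obtain ul where ul: "set ul = us" using us finite_list unfolding gv_set_def by blast
      have J: "gv_ideal A (Span A ul)" using gv_ideal_Span[OF A] us ul by blast
      have "Span A ul \<subseteq> P" by (rule Span_least) (use PD n ul in auto)
      then have "Span A ul \<subseteq> {j \<in> carrier R. j \<in> P}" using PD(1) subringE(1)[OF A] by blast
      then have "\<forall>j\<in>Span A ul. \<one> \<otimes> j \<in> P" by (auto simp del: Span.simps)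
      then have "\<one> \<in> w_closure R A P" unfolding w_closure_iff
        using J quot_field_incl[OF A] subringE(3)[OF A] by blast
      then show False using L PD(5) by blast
    qed
  next
    assume r: ?R
    show ?L
    proof
      show "w_closure R A P \<subseteq> P"
      proof
        fix x assume "x \<in> w_closure R A P"
        then obtain J where x: "x \<in> quot_field R A" and J: "gv_ideal A J" "\<forall>j\<in>J. x \<otimes> j \<in> P"
          unfolding w_closure_iff by blast
        have xA: "x \<in> A" by (rule gv_idealD(1)[OF A J(1) x]) (use J PD(1) in blast)
        obtain us where us: "set us \<subseteq> J" "gv_set A (set us)" using gv_idealD(2)[OF A J(1)] by blast
        then obtain u where u: "u \<in> set us" "u \<notin> P" using r by blast
        have "u \<in> A" using u us by (auto simp: gv_set_def)
        moreover have "x \<otimes> u \<in> P" using J us u by blast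
        ultimately show "x \<in> P" using PD(6)[OF xA] u by blast
      qed
      have "x \<in> A" if "x \<in> quot_field R A" "\<forall>u\<in>set [\<one>]. x \<otimes> u \<in> A" for x
        using that quot_field_carrier[OF A] by auto
      then have "gv_set A (set [\<one>])" using subringE(3)[OF A] by (auto simp: gv_set_def)
      then have J: "gv_ideal A (Span A [\<one>])" by (rule gv_ideal_Span[OF A])
      show "P \<subseteq> w_closure R A P"
      proof
        fix x assume x: "x \<in> P"
        have "x \<otimes> j \<in> P" if j: "j \<in> Span A [\<one>]" for j
        proof -
          have "j \<in> A" using j J by (auto simp: gv_ideal_def simp del: Span.simps)
          then have "j \<otimes> x \<in> P" "j \<in> carrier R" "x \<in> carrier R" using PD(1,4) x subringE(1)[OF A] by auto
          then show ?thesis by (simp add: m_comm)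
        qed
        then show "x \<in> w_closure R A P" unfolding w_closure_iff
          using J x PD(1) quot_field_incl[OF A] by blast
      qed
    qed
  qed
  then show ?thesis unfolding w_prime_def w_ideal_def using True id by blast
qed

lemma w_dim_ge_iff:
  "enat n \<le> w_dim R A \<longleftrightarrow> (\<exists>Ps. length Ps = n \<and> (\<forall>P\<in>set Ps. w_prime R A P) \<and> sorted_wrt (\<subset>) Ps)"
  unfolding w_dim_def
  by (rule enat_le_Sup_length_iff) (auto simp: sorted_wrt_take dest: in_set_takeD)

lemma trivial_valring:
  assumes "subfield Q R"
  shows "valring Q Q" "nonunits Q = {\<zero>}"
  using assms subfieldE(1)[OF assms] subfield_inv[OF assms] subringE(2)[OF subfieldE(1)[OF assms]]
  by (auto simp: valring_def nonunits_def)

lemma val_dim_ge_iff: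
  assumes A: "subring A R"
  shows "enat n \<le> val_dim R A \<longleftrightarrow>
    (\<exists>V xs. valring (quot_field R A) V \<and> A \<subseteq> V \<and> lexchain V xs \<and> length xs = n)"
proof -
  let ?S = "{krull_dim (R\<lparr>carrier := V\<rparr>) | V. valuation_overring R A V}"
  have "valuation_overring R A (quot_field R A)"
    using trivial_valring(1)[OF quot_field_subfield[OF A]] quot_field_incl[OF A]
    by (simp add: valuation_overring_iff[OF A])
  then have ne: "?S \<noteq> {}" by blast
  have "(\<exists>s\<in>?S. enat n \<le> s) \<longleftrightarrow>
    (\<exists>V xs. valring (quot_field R A) V \<and> A \<subseteq> V \<and> lexchain V xs \<and> length xs = n)"
    using krull_dim_valring_ge_iff[of "quot_field R A" _ n] unfolding valuation_overring_iff[OF A] by blast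
  then show ?thesis unfolding val_dim_def enat_le_Sup_iff[OF ne] .
qed

lemma w_val_dim_ge_iff:
  assumes A: "subring A R"
  shows "enat n \<le> w_val_dim R A \<longleftrightarrow>
    (\<exists>V xs. w_valuation_overring R A V \<and> lexchain V xs \<and> length xs = n)"
proof -
  let ?S = "{krull_dim (R\<lparr>carrier := V\<rparr>) | V. w_valuation_overring R A V}"
  have "w_valuation_overring R A (quot_field R A)"
    using trivial_valring[OF quot_field_subfield[OF A]] quot_field_incl[OF A]
    by (simp add: w_valuation_overring_iff[OF A] gv_set_def)
  then have ne: "?S \<noteq> {}" by blast
  have "(\<exists>s\<in>?S. enat n \<le> s) \<longleftrightarrow> (\<exists>V xs. w_valuation_overring R A V \<and> lexchain V xs \<and> length xs = n)"
    using krull_dim_valring_ge_iff[of "quot_field R A" _ n] unfolding w_valuation_overring_iff[OF A] by blast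
  then show ?thesis unfolding w_val_dim_def enat_le_Sup_iff[OF ne] .
qed

section \<open>Valuation rings over a chain of primes\<close>

text \<open>The ideal generated by \<open>P\<close> in the localization of \<open>A\<close> at \<open>P\<close>, enlarged by \<open>nonunits V\<close>, is a nonunital
  subring: a relation \<open>s = p + m\<close> with \<open>s \<notin> P\<close> would put \<open>m\<close> in \<open>A \<inter> nonunits V \<subseteq> P\<close>. The inverses of the
  elements outside \<open>P\<close> become units of \<open>U\<close>, so the center is not larger than \<open>P\<close>. Geometrically, \<open>V\<close> is
  composed with a valuation of its residue field.\<close>

lemma valring_with_center:
  assumes V: "valring Q V" and A: "subring A R" and AV: "A \<subseteq> V"
    and P: "primeideal P (R\<lparr>carrier := A\<rparr>)" and cen: "A \<inter> nonunits V \<subseteq> P"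
  obtains U where "valring Q U" "A \<subseteq> U" "nonunits V \<subseteq> nonunits U" "A \<inter> nonunits U = P"
proof -
  note PD = primeidealD[OF A P]
  note Ac = subringE(1)[OF A]
  have sV: "subring V R" and sQ: "subfield Q R" using V by (rule valringD)+
  note rQ = subfieldE(1)[OF sQ]
  note Vc = valringD(5)[OF V] and VQ = valringD(3)[OF V] and Qc = valringD(4)[OF V]
  have AQ: "A \<subseteq> Q" using AV VQ by (rule subset_trans)
  \<comment> \<open>the elements \<open>(p + m) / s\<close>; as \<open>s\<close> is outside of \<open>P\<close>, it is a unit of \<open>V\<close>\<close>
  define J where "J = {x \<in> Q. \<exists>s\<in>A - P. \<exists>p\<in>P. \<exists>m\<in>nonunits V. s \<otimes> x = p \<oplus> m}"
  have JI: "x \<in> J" if "x \<in> Q" "s \<in> A" "s \<notin> P" "p \<in> P" "m \<in> nonunits V" "s \<otimes> x = p \<oplus> m" for x s p m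
    using that unfolding J_def by blast
  have JE: "\<exists>s p m. s \<in> A \<and> s \<notin> P \<and> p \<in> P \<and> m \<in> nonunits V \<and> s \<otimes> x = p \<oplus> m \<and> x \<in> Q \<and> x \<in> carrier R \<and> s \<in> carrier R
      \<and> p \<in> carrier R \<and> m \<in> carrier R \<and> p \<in> A \<and> p \<in> V \<and> s \<in> V" if "x \<in> J" for x
  proof -
    obtain s p m where "s \<in> A" "s \<notin> P" "p \<in> P" "m \<in> nonunits V" "s \<otimes> x = p \<oplus> m" "x \<in> Q"
      using \<open>x \<in> J\<close> unfolding J_def by blast
    moreover from this have "x \<in> carrier R" "s \<in> carrier R" "p \<in> carrier R" "m \<in> carrier R" "p \<in> A" "p \<in> V" "s \<in> V"
      using Ac Vc Qc PD(1) AV by (auto simp: nonunits_def)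
    ultimately show ?thesis by blast
  qed
  have nP: "s \<otimes> s' \<in> A" "s \<otimes> s' \<notin> P" if "s \<in> A" "s \<notin> P" "s' \<in> A" "s' \<notin> P" for s s'
    using that subringE(6)[OF A] PD(6) by blast+
  note mm = nonunits_mult(2)[OF sV] and ma = nonunits_add[OF V]
  have nu: "nonunital Q J" unfolding nonunital_def
  proof (intro conjI ballI)
    show "J \<subseteq> Q" by (auto simp: J_def)
    show "\<zero> \<in> J"
      by (rule JI[of \<zero> \<one> \<zero> \<zero>]) (use subringE(2)[OF rQ] subringE(3)[OF A] PD(2,5) zero_in_nonunits[OF sV] in auto)
    fix a assume "a \<in> J"
    then obtain s p m where a: "s \<in> A" "s \<notin> P" "p \<in> P" "m \<in> nonunits V" "s \<otimes> a = p \<oplus> m" "a \<in> Q" "a \<in> carrier R"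
      "s \<in> carrier R" "p \<in> carrier R" "m \<in> carrier R" "p \<in> A" "p \<in> V" "s \<in> V"
      using JE by blast
    have "s \<otimes> (\<ominus> a) = \<ominus> p \<oplus> \<ominus> m" using a by (simp add: r_minus minus_add)
    then show "\<ominus> a \<in> J"
      using JI[OF subringE(5)[OF rQ a(6)] a(1,2) PD(8)[OF a(3)] nonunits_minus[OF sV a(4)]] by blast
    fix b assume "b \<in> J"
    then obtain s' p' m' where b: "s' \<in> A" "s' \<notin> P" "p' \<in> P" "m' \<in> nonunits V" "s' \<otimes> b = p' \<oplus> m'" "b \<in> Q" "b \<in> carrier R"
      "s' \<in> carrier R" "p' \<in> carrier R" "m' \<in> carrier R" "p' \<in> A" "p' \<in> V" "s' \<in> V"
      using JE by blast
    have "(s \<otimes> s') \<otimes> (a \<oplus> b) = s' \<otimes> (s \<otimes> a) \<oplus> s \<otimes> (s' \<otimes> b)" using a(7-10) b(7-10) by algebra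
    also have "\<dots> = (s' \<otimes> p \<oplus> s \<otimes> p') \<oplus> (s' \<otimes> m \<oplus> s \<otimes> m')"
      unfolding a(5) b(5) using a(7-10) b(7-10) by algebra
    finally show "a \<oplus> b \<in> J"
      using JI[OF subringE(7)[OF rQ a(6) b(6)] nP[OF a(1,2) b(1,2)] PD(3)[OF PD(4)[OF b(1) a(3)] PD(4)[OF a(1) b(3)]]
         ma[OF mm[OF a(4) b(13)] mm[OF b(4) a(13)]]] by blast
    have "(s \<otimes> s') \<otimes> (a \<otimes> b) = (s \<otimes> a) \<otimes> (s' \<otimes> b)" using a(7-10) b(7-10) by algebra
    also have "\<dots> = p \<otimes> p' \<oplus> ((p' \<otimes> m \<oplus> p \<otimes> m') \<oplus> m \<otimes> m')"
      unfolding a(5) b(5) using a(7-10) b(7-10) by algebra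
    finally show "a \<otimes> b \<in> J"
      using JI[OF subringE(6)[OF rQ a(6) b(6)] nP[OF a(1,2) b(1,2)] PD(4)[OF a(11) b(3)]
         ma[OF ma[OF mm[OF a(4) b(12)] mm[OF b(4) a(12)]] mm[OF b(4)]]] nonunits_subset a(4) by blast
  qed
  have one: "\<one> \<notin> J"
  proof
    assume "\<one> \<in> J"
    then obtain s p m where a: "s \<in> A" "s \<notin> P" "p \<in> P" "m \<in> nonunits V" "s \<otimes> \<one> = p \<oplus> m"
      "s \<in> carrier R" "p \<in> carrier R" "m \<in> carrier R" "p \<in> A" using JE by blast
    have "m = s \<oplus> \<ominus> p" 
    proof -
      have "s = p \<oplus> m" using a by simp
      then show ?thesis using a(6-8) by algebra
    qed
    then have "m \<in> A" using subringE(7)[OF A a(1) subringE(5)[OF A a(9)]] by simp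
    then have "m \<in> P" using a(4) cen by blast
    then have "s \<in> P" using PD(3)[OF a(3)] a(5,6) by simp
    then show False using a by blast
  qed
  \<comment> \<open>stability of \<open>J\<close> under these inverses excludes a center larger than \<open>P\<close>\<close>
  let ?A = "A \<union> {inv s | s. s \<in> A - P}"
  have snz: "s \<noteq> \<zero>" if "s \<in> A - P" for s using that PD(2) by blast
  have AQ': "?A \<subseteq> Q" using AQ subfield_inv[OF sQ] snz by blast
  have AJ: "a \<otimes> j \<in> J" if a: "a \<in> ?A" and j: "j \<in> J" for a j
  proof -
    obtain s p m where x: "s \<in> A" "s \<notin> P" "p \<in> P" "m \<in> nonunits V" "s \<otimes> j = p \<oplus> m" "j \<in> Q" "j \<in> carrier R"
      "s \<in> carrier R" "p \<in> carrier R" "m \<in> carrier R" "p \<in> A" "p \<in> V" "s \<in> V"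
      using JE[OF j] by blast
    have aQ: "a \<otimes> j \<in> Q" using subringE(6)[OF rQ _ x(6)] a AQ' by blast
    show ?thesis
    proof (cases "a \<in> A")
      case True
      then have ac: "a \<in> carrier R" "a \<in> V" using Ac AV by auto
      have "s \<otimes> (a \<otimes> j) = a \<otimes> p \<oplus> a \<otimes> m" 
      proof -
        have "s \<otimes> (a \<otimes> j) = a \<otimes> (s \<otimes> j)" using ac x(7,8) by algebra
        then show ?thesis unfolding x(5) using ac x(9,10) by algebra
      qed
      then show ?thesis using JI[OF aQ x(1,2) PD(4)[OF True x(3)] mm[OF x(4) ac(2)]] by blast
    next
      case False
      then obtain t where t: "t \<in> A" "t \<notin> P" "a = inv t" using a by blast
      have tc: "t \<in> carrier R" "t \<noteq> \<zero>" using t Ac snz by auto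
      have "(s \<otimes> t) \<otimes> (a \<otimes> j) = s \<otimes> j" unfolding t(3) using tc x(7,8) by (simp add: m_assoc)
      then show ?thesis using JI[OF aQ nP[OF x(1,2) t(1,2)] x(3,4)] x(5) by simp
    qed
  qed
  obtain U where U: "valring Q U" "?A \<subseteq> U" "J \<subseteq> nonunits U"
    using exists_valuation_ring[OF sQ nu one AQ' AJ] by blast
  have sU: "subring U R" using U(1) by (rule valringD)
  have mJ: "nonunits V \<subseteq> J"
  proof
    fix m assume m: "m \<in> nonunits V"
    then have "m \<in> Q" "m \<in> carrier R" using VQ Vc by (auto simp: nonunits_def)
    then show "m \<in> J" using JI[of m \<one> \<zero> m] m subringE(3)[OF A] PD(2,5) by simp
  qed
  have PJ: "P \<subseteq> J"
  proof
    fix p assume p: "p \<in> P"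
    then have "p \<in> Q" "p \<in> carrier R" using PD(1) AQ Ac by auto
    then show "p \<in> J" using JI[of p \<one> p \<zero>] p subringE(3)[OF A] PD(5) zero_in_nonunits[OF sV] by simp
  qed
  have VU: "nonunits V \<subseteq> nonunits U" using mJ U(3) by blast
  have "A \<inter> nonunits U = P"
  proof
    show "P \<subseteq> A \<inter> nonunits U" using PJ U(3) PD(1) by blast
    show "A \<inter> nonunits U \<subseteq> P"
    proof
      fix s assume s: "s \<in> A \<inter> nonunits U"
      show "s \<in> P"
      proof (rule ccontr)
        assume "s \<notin> P"
        then have "inv s \<in> U" "s \<noteq> \<zero>" using s U(2) snz by auto
        then show False using s by (auto simp: nonunits_def)
      qed
    qed
  qed
  moreover have "A \<subseteq> U" using U(2) by blast
  ultimately show thesis using that U(1) VU by blast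
qed

text \<open>The valuation ring is shrunk once for every prime of the chain, so that its center moves up the
  chain. An element of the new prime outside of the old one is a unit before this step and a nonunit
  afterwards; hence it is dominated by the elements found earlier.\<close>

lemma prime_chain_valring:
  assumes A: "subring A R"
  shows "sorted_wrt (\<subset>) Ps \<Longrightarrow> (\<forall>P\<in>set Ps. primeideal P (R\<lparr>carrier := A\<rparr>) \<and> P \<noteq> {\<zero>}) \<Longrightarrow>
    \<exists>V xs. valring (quot_field R A) V \<and> A \<subseteq> V \<and> lexchain V xs \<and> length xs = length Ps \<and>
      A \<inter> nonunits V = last ({\<zero>} # Ps)"
proof (induct Ps rule: rev_induct)
  case Nil
  have "A \<inter> {\<zero>} = {\<zero>}" using subringE(2)[OF A] by blast
  then show ?case using trivial_valring[OF quot_field_subfield[OF A]] quot_field_incl[OF A]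
    by (intro exI[of _ "quot_field R A"] exI[of _ "[]"]) simp
next
  case (snoc P Ps)
  let ?Q = "quot_field R A"
  have P: "primeideal P (R\<lparr>carrier := A\<rparr>)" using snoc by simp
  note PD = primeidealD[OF A P]
  obtain V xs where V: "valring ?Q V" and AV: "A \<subseteq> V" and xs: "lexchain V xs" "length xs = length Ps"
    and cen: "A \<inter> nonunits V = last ({\<zero>} # Ps)"
    using snoc by (auto simp: sorted_wrt_append)
  have sV: "subring V R" using V by (rule valringD)
  note Vc = valringD(5)[OF V]
  let ?P0 = "A \<inter> nonunits V"
  have P0P: "?P0 \<subset> P"
  proof (cases Ps rule: rev_cases)
    case Nil then show ?thesis using cen snoc(3) PD(2) by auto
  next
    case (snoc Ps' P')
    then show ?thesis using cen \<open>sorted_wrt (\<subset>) (Ps @ [P])\<close> by (auto simp: sorted_wrt_append)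
  qed
  obtain U where U: "valring ?Q U" "A \<subseteq> U" "nonunits V \<subseteq> nonunits U" "A \<inter> nonunits U = P"
    by (rule valring_with_center[OF V A AV P psubset_imp_subset[OF P0P]])
  note VU = U(3)
  obtain x where x: "x \<in> P" "x \<notin> ?P0" using P0P by blast
  have xV: "x \<in> V" "x \<notin> nonunits V" using x PD(1) AV by auto
  have dom: "dominates U y x" if y: "y \<in> set xs" for y unfolding dominates_def
  proof
    fix n :: nat
    have "inv x \<in> V" "x \<noteq> \<zero>" "x \<in> carrier R" using not_nonunit[OF sV xV] xV Vc by auto
    then have "inv (x [^] n) \<in> V" using subring_pow[OF sV, of "inv x" n] by simp
    moreover have "y \<in> nonunits V" using y xs by (auto simp: lexchain_def)
    ultimately show "y \<otimes> inv (x [^] n) \<in> nonunits U" using nonunits_mult(1)[OF sV] VU by blast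
  qed
  have "x \<noteq> \<zero>" "x \<in> nonunits U" using not_nonunit(1)[OF sV xV] x(1) U(4) by auto
  then show ?case
    using dom U(1,2,4) lexchain_mono[OF xs(1) VU] xs(2)
    by (intro exI[of _ U] exI[of _ "xs @ [x]"]) (auto simp: lexchain_append lexchain_Cons)
qed

theorem krull_dim_le_val_dim:
  assumes A: "subring A R"
  shows "krull_dim (R\<lparr>carrier := A\<rparr>) \<le> val_dim R A"
proof (rule enat_le_if_all)
  fix n assume "enat n \<le> krull_dim (R\<lparr>carrier := A\<rparr>)"
  then show "enat n \<le> val_dim R A"
    unfolding krull_dim_ge_iff[OF A] val_dim_ge_iff[OF A] using prime_chain_valring[OF A] by metis
qed

text \<open>The valuation ring over a chain of \<open>w\<close>-primes is centered at the last one, or at zero if the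
  chain is empty, and neither contains a set \<open>us\<close> with \<open>gv_set A us\<close>.\<close>

theorem w_dim_le_w_val_dim:
  assumes A: "subring A R"
  shows "w_dim R A \<le> w_val_dim R A"
proof (rule enat_le_if_all)
  fix n assume "enat n \<le> w_dim R A"
  then obtain Ps where Ps: "length Ps = n" "\<forall>P\<in>set Ps. w_prime R A P" "sorted_wrt (\<subset>) Ps"
    unfolding w_dim_ge_iff by blast
  then obtain V xs where V: "valring (quot_field R A) V" "A \<subseteq> V" "lexchain V xs" "length xs = length Ps"
      "A \<inter> nonunits V = last ({\<zero>} # Ps)"
    using prime_chain_valring[OF A Ps(3)] Ps(2) unfolding w_prime_iff[OF A] by blast
  have "\<not> us \<subseteq> nonunits V" if us: "gv_set A us" for us
  proof -
    have "\<not> us \<subseteq> last ({\<zero>} # Ps)"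
    proof (cases "Ps = []")
      case True then show ?thesis using us by (auto simp: gv_set_def)
    next
      case False
      then have "last Ps \<in> set Ps" by simp
      then have "w_prime R A (last Ps)" using Ps(2) by blast
      then show ?thesis unfolding w_prime_iff[OF A] using us False by simp
    qed
    then show ?thesis using V(5) us by (auto simp: gv_set_def)
  qed
  then have "w_valuation_overring R A V" unfolding w_valuation_overring_iff[OF A] using V by blast
  then show "enat n \<le> w_val_dim R A" unfolding w_val_dim_ge_iff[OF A] using V Ps(1) by metis
qed

end

section \<open>Residue fields and composite valuations\<close>

text \<open>A local ring \<open>T\<close> in \<open>K\<close> with maximal ideal \<open>M\<close> and its residue field, given by the residue map instead
  of by cosets. The same facts are needed for two local rings: the ring \<open>T\<close> of the pullback, and a
  valuation ring containing it.\<close>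

locale residue_field = K: field K + k: field k
  for K :: "('a, 'm) ring_scheme" (structure) and k :: "('b, 'n) ring_scheme" +
  fixes T M :: "'a set" and \<phi> :: "'a \<Rightarrow> 'b"
  assumes T: "subring T K"
    and phi_add: "\<And>s t. s \<in> T \<Longrightarrow> t \<in> T \<Longrightarrow> \<phi> (s \<oplus> t) = \<phi> s \<oplus>\<^bsub>k\<^esub> \<phi> t"
    and phi_mult: "\<And>s t. s \<in> T \<Longrightarrow> t \<in> T \<Longrightarrow> \<phi> (s \<otimes> t) = \<phi> s \<otimes>\<^bsub>k\<^esub> \<phi> t"
    and phi_one: "\<phi> \<one> = \<one>\<^bsub>k\<^esub>"
    and phi_surj: "\<phi> ` T = carrier k"
    and phi_zero_iff: "\<And>t. t \<in> T \<Longrightarrow> \<phi> t = \<zero>\<^bsub>k\<^esub> \<longleftrightarrow> t \<in> M"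
    and M_subset: "M \<subseteq> T"
    and inv_in_T: "\<And>t. t \<in> T \<Longrightarrow> t \<notin> M \<Longrightarrow> inv t \<in> T"
begin

lemmas T_carrier = subringE(1)[OF T]

lemma phi_closed [simp]: "t \<in> T \<Longrightarrow> \<phi> t \<in> carrier k"
  using phi_surj by blast

lemma zero_in_M: "\<zero> \<in> M"
proof -
  have z: "\<zero> \<in> T" using subringE(2)[OF T] .
  have "\<phi> \<zero> \<oplus>\<^bsub>k\<^esub> \<phi> \<zero> = \<phi> \<zero>" using phi_add[OF z z] by simp
  then have "\<phi> \<zero> = \<zero>\<^bsub>k\<^esub>" using z by (simp add: k.add.r_cancel_one)
  then show ?thesis using phi_zero_iff z by blast
qed

lemma phi_zero: "\<phi> \<zero> = \<zero>\<^bsub>k\<^esub>"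
  using zero_in_M phi_zero_iff M_subset by blast

lemma phi_minus: "t \<in> T \<Longrightarrow> \<phi> (\<ominus> t) = \<ominus>\<^bsub>k\<^esub> \<phi> t"
proof -
  assume t: "t \<in> T"
  have m: "\<ominus> t \<in> T" using subringE(5)[OF T t] .
  have "t \<in> carrier K" using t T_carrier by blast
  then have "\<phi> (\<ominus> t) \<oplus>\<^bsub>k\<^esub> \<phi> t = \<zero>\<^bsub>k\<^esub>" using phi_add[OF m t] phi_zero by (simp add: K.l_neg)
  then show ?thesis using t m by (metis k.minus_equality phi_closed)
qed

lemma phi_pow: "t \<in> T \<Longrightarrow> \<phi> (t [^] (n::nat)) = \<phi> t [^]\<^bsub>k\<^esub> n"
  by (induct n) (simp_all add: phi_one phi_mult K.subring_pow[OF T])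

lemma unitD:
  assumes "t \<in> T" "t \<notin> M"
  shows "t \<noteq> \<zero>" "inv t \<in> T" "inv t \<notin> M" "\<phi> t \<noteq> \<zero>\<^bsub>k\<^esub>" "\<phi> (inv t) = inv\<^bsub>k\<^esub> \<phi> t" "t \<in> carrier K"
proof -
  show 1: "t \<noteq> \<zero>" "inv t \<in> T" "\<phi> t \<noteq> \<zero>\<^bsub>k\<^esub>" "t \<in> carrier K"
    using assms zero_in_M inv_in_T phi_zero_iff T_carrier by auto
  have p: "\<phi> t \<otimes>\<^bsub>k\<^esub> \<phi> (inv t) = \<one>\<^bsub>k\<^esub>"
    using phi_mult[OF assms(1) 1(2)] 1 phi_one by simp
  then show "\<phi> (inv t) = inv\<^bsub>k\<^esub> \<phi> t"
    using k.field_inv_unique[of "\<phi> t" "\<phi> (inv t)"] assms 1 by simp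
  have "\<phi> (inv t) \<noteq> \<zero>\<^bsub>k\<^esub>" using p assms 1 k.one_not_zero by (metis k.r_null phi_closed)
  then show "inv t \<notin> M" using phi_zero_iff 1 by blast
qed

lemma M_closed:
  "s \<in> T \<Longrightarrow> t \<in> M \<Longrightarrow> s \<otimes> t \<in> M"
  "s \<in> M \<Longrightarrow> t \<in> M \<Longrightarrow> s \<oplus> t \<in> M"
proof -
  show "s \<otimes> t \<in> M" if "s \<in> T" "t \<in> M"
  proof -
    have t: "t \<in> T" "\<phi> t = \<zero>\<^bsub>k\<^esub>" using that M_subset phi_zero_iff by auto
    then show ?thesis using phi_zero_iff[OF subringE(6)[OF T that(1) t(1)]] phi_mult that(1) by simp
  qed
  show "s \<oplus> t \<in> M" if "s \<in> M" "t \<in> M"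
  proof -
    have t: "t \<in> T" "\<phi> t = \<zero>\<^bsub>k\<^esub>" "s \<in> T" "\<phi> s = \<zero>\<^bsub>k\<^esub>" using that M_subset phi_zero_iff by auto
    then show ?thesis using phi_zero_iff[OF subringE(7)[OF T t(3,1)]] phi_add by simp
  qed
qed

lemma one_notin_M: "\<one> \<notin> M"
  using phi_zero_iff[OF subringE(3)[OF T]] phi_one by simp

lemma phi_eq_iff:
  assumes "s \<in> T" "t \<in> T"
  shows "\<phi> s = \<phi> t \<longleftrightarrow> s \<oplus> \<ominus> t \<in> M"
proof -
  have m: "\<ominus> t \<in> T" using subringE(5)[OF T assms(2)] .
  have "s \<oplus> \<ominus> t \<in> M \<longleftrightarrow> \<phi> s \<oplus>\<^bsub>k\<^esub> \<ominus>\<^bsub>k\<^esub> \<phi> t = \<zero>\<^bsub>k\<^esub>"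
    using phi_zero_iff[OF subringE(7)[OF T assms(1) m]] phi_add[OF assms(1) m] phi_minus[OF assms(2)] by simp
  also have "\<dots> \<longleftrightarrow> \<phi> s = \<phi> t" using assms by (simp flip: k.minus_eq)
  finally show ?thesis by simp
qed

lemma pullback_subring:
  assumes B: "subring B k"
  shows "subring {t \<in> T. \<phi> t \<in> B} K"
proof (rule K.subringI)
  show "{t \<in> T. \<phi> t \<in> B} \<subseteq> carrier K" using T_carrier by blast
qed (use subringE[OF T] subringE[OF B] in \<open>auto simp: phi_one phi_add phi_mult phi_minus\<close>)

lemma image_subring:
  assumes "subring A K"
  shows "subring (\<phi> ` (A \<inter> T)) k"
proof (rule k.subringI)
  show "\<phi> ` (A \<inter> T) \<subseteq> carrier k" by auto
  show "\<one>\<^bsub>k\<^esub> \<in> \<phi> ` (A \<inter> T)"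
    using subringE(3)[OF T] subringE(3)[OF assms] phi_one by (metis IntI image_eqI)
  fix h assume "h \<in> \<phi> ` (A \<inter> T)"
  then obtain s where s: "h = \<phi> s" "s \<in> A" "s \<in> T" by blast
  show "\<ominus>\<^bsub>k\<^esub> h \<in> \<phi> ` (A \<inter> T)"
    using s phi_minus subringE(5)[OF T] subringE(5)[OF assms] by (metis IntI image_eqI)
  fix g assume "g \<in> \<phi> ` (A \<inter> T)"
  then obtain t where t: "g = \<phi> t" "t \<in> A" "t \<in> T" by blast
  show "h \<otimes>\<^bsub>k\<^esub> g \<in> \<phi> ` (A \<inter> T)"
    using s t phi_mult subringE(6)[OF T] subringE(6)[OF assms] by (metis IntI image_eqI)
  show "h \<oplus>\<^bsub>k\<^esub> g \<in> \<phi> ` (A \<inter> T)"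
    using s t phi_add subringE(7)[OF T] subringE(7)[OF assms] by (metis IntI image_eqI)
qed

text \<open>On \<open>T\<close>, the maximal ideal of \<open>V\<close> is the preimage of that of \<open>W\<close>; this is the relation between a
  valuation of \<open>K\<close> and the valuation that it induces on the residue field.\<close>

definition compatible :: "'a set \<Rightarrow> 'b set \<Rightarrow> bool" where
  "compatible V W \<longleftrightarrow> (\<forall>t\<in>T. t \<in> K.nonunits V \<longleftrightarrow> \<phi> t \<in> k.nonunits W)"

lemma compatible_dominates:
  assumes "compatible V W" "s \<in> T" "t \<in> T" "t \<notin> M"
  shows "K.dominates V s t \<longleftrightarrow> k.dominates W (\<phi> s) (\<phi> t)"
proof -
  have "s \<otimes> inv (t [^] n) \<in> K.nonunits V \<longleftrightarrow> \<phi> s \<otimes>\<^bsub>k\<^esub> inv\<^bsub>k\<^esub> (\<phi> t [^]\<^bsub>k\<^esub> n) \<in> k.nonunits W" for n :: nat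
  proof -
    note u = unitD[OF assms(3,4)]
    have i: "inv t [^] n \<in> T" using K.subring_pow[OF T u(2)] .
    have "\<phi> (s \<otimes> inv t [^] n) = \<phi> s \<otimes>\<^bsub>k\<^esub> inv\<^bsub>k\<^esub> (\<phi> t) [^]\<^bsub>k\<^esub> n"
      using phi_mult[OF assms(2) i] phi_pow[OF u(2)] u(5) by simp
    moreover have "s \<otimes> inv t [^] n \<in> T" using subringE(6)[OF T assms(2) i] .
    ultimately show ?thesis
      using assms(1,3) u unfolding compatible_def by (metis K.field_inv_pow k.field_inv_pow phi_closed)
  qed
  then show ?thesis unfolding K.dominates_def k.dominates_def by blast
qed

lemma compatible_lexchain:
  assumes "compatible V W"
  shows "set ts \<subseteq> T - M \<Longrightarrow> K.lexchain V ts \<longleftrightarrow> k.lexchain W (map \<phi> ts)"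
proof (induct ts)
  case Nil then show ?case by simp
next
  case (Cons t ts)
  have t: "t \<in> T" "t \<notin> M" using Cons by auto
  have "(\<forall>s\<in>set ts. K.dominates V t s) \<longleftrightarrow> (\<forall>s\<in>set ts. k.dominates W (\<phi> t) (\<phi> s))"
    using compatible_dominates[OF assms t(1)] Cons(2) by auto
  moreover have "t \<in> K.nonunits V \<longleftrightarrow> \<phi> t \<in> k.nonunits W" using assms t by (simp add: compatible_def)
  ultimately show ?case using Cons unitD(1,4)[OF t] by (simp add: K.lexchain_Cons k.lexchain_Cons)
qed

lemma lift_list:
  assumes "set ws \<subseteq> carrier k - {\<zero>\<^bsub>k\<^esub>}"
  obtains ts where "set ts \<subseteq> T - M" "map \<phi> ts = ws"
proof -
  have "\<exists>ts. set ts \<subseteq> T - M \<and> map \<phi> ts = ws" using assms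
  proof (induct ws)
    case Nil then show ?case by simp
  next
    case (Cons w ws)
    then obtain ts where "set ts \<subseteq> T - M" "map \<phi> ts = ws" by auto
    moreover have "w \<in> \<phi> ` T" using Cons(2) phi_surj by auto
    then obtain t where "t \<in> T" "\<phi> t = w" by blast
    moreover from this have "t \<notin> M" using Cons(2) phi_zero_iff by auto
    ultimately show ?case by (intro exI[of _ "t # ts"]) auto
  qed
  then show ?thesis using that by blast
qed

lemma lexchain_nonzero: "k.valring Q W \<Longrightarrow> k.lexchain W ws \<Longrightarrow> set ws \<subseteq> carrier k - {\<zero>\<^bsub>k\<^esub>}"
  using k.nonunits_subset k.valringD(5)[of Q W] unfolding k.lexchain_def by blast

lemma M_primeideal: "primeideal M (K\<lparr>carrier := T\<rparr>)"
  unfolding K.primeideal_subring_iff[OF T]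
proof (intro conjI ballI impI)
  fix s t assume st: "s \<in> T" "t \<in> T" "s \<otimes> t \<in> M"
  then have "\<phi> s \<otimes>\<^bsub>k\<^esub> \<phi> t = \<zero>\<^bsub>k\<^esub>" using phi_mult phi_zero_iff subringE(6)[OF T] by metis
  then show "s \<in> M \<or> t \<in> M" using k.integral[of "\<phi> s" "\<phi> t"] phi_zero_iff st(1,2) by auto
qed (use M_subset zero_in_M one_notin_M M_closed in auto)

lemma center_subset_M:
  assumes "T \<subseteq> U"
  shows "T \<inter> K.nonunits U \<subseteq> M"
proof
  fix t assume t: "t \<in> T \<inter> K.nonunits U"
  show "t \<in> M"
  proof (rule ccontr)
    assume "t \<notin> M"
    then have "t \<noteq> \<zero>" "inv t \<in> U" using unitD[of t] t assms by auto
    then show False using t by (auto simp: K.nonunits_def)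
  qed
qed

text \<open>Since the center of \<open>U\<close> on \<open>T\<close> lies in \<open>M\<close>, it can be moved up to \<open>M\<close>.\<close>

lemma dominating_valring:
  assumes U: "K.valring Q U" "T \<subseteq> U"
  obtains V where "K.valring Q V" "T \<subseteq> V" "M \<subseteq> K.nonunits V" "K.nonunits U \<subseteq> K.nonunits V"
proof (rule K.valring_with_center[OF U(1) T U(2) M_primeideal center_subset_M[OF U(2)]])
  fix V assume "K.valring Q V" "T \<subseteq> V" "K.nonunits U \<subseteq> K.nonunits V" "T \<inter> K.nonunits V = M"
  then show thesis using that by blast
qed

text \<open>The ring \<open>V\<close> is found as a refinement of \<open>U\<close> that is centered, on the preimage of \<open>W\<close>, at the preimage
  of the maximal ideal of \<open>W\<close>.\<close>

theorem composite_valring: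
  assumes U: "K.valring Q U" "T \<subseteq> U" and W: "k.valring (carrier k) W"
  obtains V where "K.valring Q V" "V \<subseteq> U" "K.nonunits U \<subseteq> K.nonunits V" "{t \<in> T. \<phi> t \<in> W} \<subseteq> V" "compatible V W"
proof -
  have sW: "subring W k" using W by (rule k.valringD)
  let ?A = "{t \<in> T. \<phi> t \<in> W}" and ?P = "{t \<in> T. \<phi> t \<in> k.nonunits W}"
  have A: "subring ?A K" by (rule pullback_subring[OF sW])
  note N = k.primeidealD[OF sW k.nonunits_primeideal[OF W]]
  have P: "primeideal ?P (K\<lparr>carrier := ?A\<rparr>)"
    unfolding K.primeideal_subring_iff[OF A]
    using N(1-6) subringE(2,6,7)[OF T] by (auto simp: phi_zero phi_one phi_add phi_mult)
  have AU: "?A \<subseteq> U" using U(2) by blast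
  have "?A \<inter> K.nonunits U \<subseteq> ?P"
  proof
    fix t assume "t \<in> ?A \<inter> K.nonunits U"
    then have t: "t \<in> T" "t \<in> M" using center_subset_M[OF U(2)] by auto
    then have "\<phi> t = \<zero>\<^bsub>k\<^esub>" using phi_zero_iff by blast
    then show "t \<in> ?P" using t(1) N(2) by simp
  qed
  then obtain V where V: "K.valring Q V" "?A \<subseteq> V" "K.nonunits U \<subseteq> K.nonunits V" "?A \<inter> K.nonunits V = ?P"
    by (rule K.valring_with_center[OF U(1) A AU P])
  have PV: "?P \<subseteq> K.nonunits V" using V(4) by blast
  have "compatible V W" unfolding compatible_def
  proof (intro ballI iffI)
    fix t assume t: "t \<in> T" "\<phi> t \<in> k.nonunits W"
    then show "t \<in> K.nonunits V" using PV by blast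
  next
    fix t assume t: "t \<in> T" "t \<in> K.nonunits V"
    have "\<phi> t \<in> W"
    proof (rule ccontr)
      assume n: "\<phi> t \<notin> W"
      then have "t \<notin> M" using phi_zero_iff[OF t(1)] subringE(2)[OF sW] by auto
      note u = unitD[OF t(1) this]
      have "\<phi> (inv t) \<in> k.nonunits W" using k.valring_notin[OF W _ n] t u by simp
      then have "inv t \<in> K.nonunits V" using PV u by blast
      then show False using t u by (auto simp: K.nonunits_def)
    qed
    then show "\<phi> t \<in> k.nonunits W" using V(4) t by blast
  qed
  then show thesis using that V K.valring_subsetI[OF V(1) U(1) V(3)] by blast
qed

text \<open>Nonunits of \<open>U\<close> dominate the elements of \<open>T\<close> outside \<open>M\<close>, because the latter are units of \<open>U\<close>. So the
  two lexchains can be concatenated.\<close>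

lemma composite_lexchain:
  assumes U: "K.valring Q U" "T \<subseteq> U" and V: "K.nonunits U \<subseteq> K.nonunits V" "compatible V W"
    and W: "k.valring Q' W" and us: "K.lexchain U us" and ws: "k.lexchain W ws"
  shows "\<exists>xs. K.lexchain V xs \<and> length xs = length us + length ws"
proof -
  have sU: "subring U K" using U(1) by (rule K.valringD)
  obtain ts where ts: "set ts \<subseteq> T - M" "map \<phi> ts = ws"
    using lift_list[OF lexchain_nonzero[OF W ws]] by blast
  have 1: "K.lexchain V ts" using compatible_lexchain[OF V(2) ts(1)] ts(2) ws by simp
  have 2: "K.dominates V u t" if u: "u \<in> set us" and t: "t \<in> set ts" for u t
    unfolding K.dominates_def
  proof
    fix n :: nat
    have "t \<in> T" "t \<notin> M" using t ts by auto
    note d = unitD[OF this]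
    have "inv t [^] n \<in> U" using K.subring_pow[OF T d(2)] U(2) by blast
    then have "inv (t [^] n) \<in> U" using d by simp
    moreover have "u \<in> K.nonunits U" using u us by (auto simp: K.lexchain_def)
    ultimately show "u \<otimes> inv (t [^] n) \<in> K.nonunits V" using K.nonunits_mult(1)[OF sU] V(1) by blast
  qed
  have "K.lexchain V (us @ ts)"
    using 1 2 K.lexchain_mono[OF us V(1)] by (simp add: K.lexchain_append)
  moreover have "length ts = length ws" using ts(2) by auto
  ultimately show ?thesis by (intro exI[of _ "us @ ts"]) auto
qed

text \<open>As \<open>V\<close> contains \<open>M\<close>, membership of an element of \<open>T\<close> in \<open>V\<close> depends only on its residue class.\<close>

lemma residue_valring:
  assumes V: "K.valring Q V" "T \<subseteq> Q" "M \<subseteq> K.nonunits V"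
  shows "k.valring (carrier k) (\<phi> ` (V \<inter> T))" "compatible V (\<phi> ` (V \<inter> T))"
proof -
  have sV: "subring V K" using V(1) by (rule K.valringD)
  let ?W = "\<phi> ` (V \<inter> T)"
  have sW: "subring ?W k" by (rule image_subring[OF sV])
  have inW: "t \<in> V" if t: "t \<in> T" "\<phi> t \<in> ?W" for t
  proof -
    obtain s where s: "s \<in> V" "s \<in> T" "\<phi> t = \<phi> s" using t(2) by blast
    have "t \<oplus> \<ominus> s \<in> V" using phi_eq_iff[OF t(1) s(2)] s V(3) by (auto simp: K.nonunits_def)
    then have "s \<oplus> (t \<oplus> \<ominus> s) \<in> V" using subringE(7)[OF sV s(1)] by blast
    moreover have c: "s \<in> carrier K" "t \<in> carrier K" using s t T_carrier by auto
    have "s \<oplus> (t \<oplus> \<ominus> s) = t" using c by algebra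
    ultimately show ?thesis by simp
  qed
  show "k.valring (carrier k) ?W" unfolding k.valring_def
  proof (intro conjI ballI impI)
    show "subfield (carrier k) k" by (rule k.carrier_is_subfield)
    show "subring ?W k" by fact
    show "?W \<subseteq> carrier k" by auto
    fix x assume x: "x \<in> carrier k" "x \<noteq> \<zero>\<^bsub>k\<^esub>"
    then obtain t where t: "t \<in> T" "x = \<phi> t" using phi_surj by blast
    then have "t \<notin> M" using x phi_zero_iff by blast
    note u = unitD[OF t(1) this]
    have "t \<in> V \<or> inv t \<in> V" using K.valringD(6)[OF V(1), of t] t V(2) u by blast
    then show "x \<in> ?W \<or> inv\<^bsub>k\<^esub> x \<in> ?W" using t u(2) u(5)[symmetric] by auto
  qed
  show "compatible V ?W" unfolding compatible_def
  proof
    fix t assume t: "t \<in> T"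
    show "t \<in> K.nonunits V \<longleftrightarrow> \<phi> t \<in> k.nonunits ?W"
    proof (cases "t \<in> M")
      case True
      then show ?thesis using V(3) phi_zero_iff[OF t] k.zero_in_nonunits[OF sW] by auto
    next
      case False
      note u = unitD[OF t False]
      have "t \<in> V \<longleftrightarrow> \<phi> t \<in> ?W" using inW[OF t] t by blast
      moreover have "inv t \<in> V \<longleftrightarrow> inv\<^bsub>k\<^esub> (\<phi> t) \<in> ?W" using inW[OF u(2)] u(2) unfolding u(5)[symmetric] by blast
      ultimately show ?thesis using u by (simp add: K.nonunits_def k.nonunits_def)
    qed
  qed
qed

end

lemma (in field) local_ring_residue_field:
  assumes T: "subring T R" and M: "maximalideal M (R\<lparr>carrier := T\<rparr>)"
    and u: "\<And>t. t \<in> T \<Longrightarrow> t \<notin> M \<Longrightarrow> inv t \<in> T"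
  shows "residue_field R ((R\<lparr>carrier := T\<rparr>) Quot M) T M (\<lambda>x. M +>\<^bsub>R\<lparr>carrier := T\<rparr>\<^esub> x)"
proof -
  interpret M: maximalideal M "R\<lparr>carrier := T\<rparr>" by (rule M)
  have cr: "cring (R\<lparr>carrier := T\<rparr>)"
    using subcringI'[OF T] subcring_iff[OF subringE(1)[OF T]] by blast
  interpret q: field "(R\<lparr>carrier := T\<rparr>) Quot M" by (rule M.quotient_is_field[OF cr])
  have h: "(\<lambda>x. M +>\<^bsub>R\<lparr>carrier := T\<rparr>\<^esub> x) \<in> ring_hom (R\<lparr>carrier := T\<rparr>) ((R\<lparr>carrier := T\<rparr>) Quot M)"
    by (rule M.rcos_ring_hom)
  show ?thesis
  proof (intro residue_field.intro residue_field_axioms.intro)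
    show "field R" "field ((R\<lparr>carrier := T\<rparr>) Quot M)" by unfold_locales
    show "subring T R" by fact
    show "M \<subseteq> T" using M.a_subset by simp
    show "inv t \<in> T" if "t \<in> T" "t \<notin> M" for t using u that by blast
    show "M +>\<^bsub>R\<lparr>carrier := T\<rparr>\<^esub> (s \<oplus> t) =
       (M +>\<^bsub>R\<lparr>carrier := T\<rparr>\<^esub> s) \<oplus>\<^bsub>R\<lparr>carrier := T\<rparr> Quot M\<^esub> (M +>\<^bsub>R\<lparr>carrier := T\<rparr>\<^esub> t)"
      if "s \<in> T" "t \<in> T" for s t using ring_hom_add[OF h, of s t] that by simp
    show "M +>\<^bsub>R\<lparr>carrier := T\<rparr>\<^esub> (s \<otimes> t) =
       (M +>\<^bsub>R\<lparr>carrier := T\<rparr>\<^esub> s) \<otimes>\<^bsub>R\<lparr>carrier := T\<rparr> Quot M\<^esub> (M +>\<^bsub>R\<lparr>carrier := T\<rparr>\<^esub> t)"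
      if "s \<in> T" "t \<in> T" for s t using ring_hom_mult[OF h, of s t] that by simp
    show "M +>\<^bsub>R\<lparr>carrier := T\<rparr>\<^esub> \<one> = \<one>\<^bsub>R\<lparr>carrier := T\<rparr> Quot M\<^esub>" using ring_hom_one[OF h] by simp
    show "(\<lambda>x. M +>\<^bsub>R\<lparr>carrier := T\<rparr>\<^esub> x) ` T = carrier (R\<lparr>carrier := T\<rparr> Quot M)"
      by (auto simp: FactRing_def A_RCOSETS_def' a_r_coset_def')
    show "(M +>\<^bsub>R\<lparr>carrier := T\<rparr>\<^esub> t = \<zero>\<^bsub>R\<lparr>carrier := T\<rparr> Quot M\<^esub>) = (t \<in> M)" if "t \<in> T" for t
    proof -
      have "t \<in> M +>\<^bsub>R\<lparr>carrier := T\<rparr>\<^esub> t" using M.a_rcos_self[of t] that by simp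
      then show ?thesis using M.a_rcos_const[of t] by (auto simp: FactRing_def)
    qed
  qed
qed

text \<open>This makes a valuation ring with its maximal ideal an instance of \<open>residue_field\<close>.\<close>

lemma (in field) nonunits_maximalideal:
  assumes V: "valring Q V"
  shows "maximalideal (nonunits V) (R\<lparr>carrier := V\<rparr>)"
proof -
  have sV: "subring V R" using V by (rule valringD)
  note Vc = subringE(1)[OF sV]
  interpret P: primeideal "nonunits V" "R\<lparr>carrier := V\<rparr>" by (rule nonunits_primeideal[OF V])
  show ?thesis
  proof (rule maximalidealI)
    show "ideal (nonunits V) (R\<lparr>carrier := V\<rparr>)" by (rule P.ideal_axioms)
    show "carrier (R\<lparr>carrier := V\<rparr>) \<noteq> nonunits V" using one_notin_nonunits[OF sV] subringE(3)[OF sV] by auto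
    fix J assume J: "ideal J (R\<lparr>carrier := V\<rparr>)" "nonunits V \<subseteq> J" "J \<subseteq> carrier (R\<lparr>carrier := V\<rparr>)"
    show "J = nonunits V \<or> J = carrier (R\<lparr>carrier := V\<rparr>)"
    proof (rule disjCI)
      assume "J \<noteq> carrier (R\<lparr>carrier := V\<rparr>)"
      interpret J: ideal J "R\<lparr>carrier := V\<rparr>" by (rule J)
      have "J \<subseteq> nonunits V"
      proof
        fix x assume x: "x \<in> J"
        show "x \<in> nonunits V"
        proof (rule ccontr)
          assume n: "x \<notin> nonunits V"
          have xV: "x \<in> V" using x J by auto
          note nn = not_nonunit[OF sV xV n]
          have "inv x \<otimes> x \<in> J" using J.I_l_closed[OF x, of "inv x"] nn by simp
          moreover have "x \<in> carrier R" using xV Vc by blast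
          ultimately have "\<one> \<in> J" using nn by simp
          then show False using J.one_imp_carrier \<open>J \<noteq> _\<close> by simp
        qed
      qed
      then show "J = nonunits V" using J by blast
    qed
  qed
qed

section \<open>Algebraic independence\<close>

context field
begin

definition monomial_value :: "'a multiset \<Rightarrow> 'a" where
  "monomial_value m = (\<Otimes>x\<in>set_mset m. x [^] count m x)"

lemma alg_independent_iff:
  "alg_independent R F S \<longleftrightarrow> S \<subseteq> carrier R \<and>
     (\<forall>E c. finite E \<longrightarrow> (\<forall>m\<in>E. set_mset m \<subseteq> S \<and> c m \<in> F) \<longrightarrow>
        (\<Oplus>m\<in>E. c m \<otimes> monomial_value m) = \<zero> \<longrightarrow> (\<forall>m\<in>E. c m = \<zero>))"
  unfolding alg_independent_def monomial_value_def by blast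

lemma monomial_value_superset:
  assumes "finite S" "set_mset m \<subseteq> S" "S \<subseteq> carrier R"
  shows "monomial_value m = (\<Otimes>x\<in>S. x [^] count m x)"
  unfolding monomial_value_def
  by (rule finprod_mono_neutral_cong_left) (use assms in \<open>auto simp: not_in_iff\<close>)

lemma monomial_value_closed: "set_mset m \<subseteq> carrier R \<Longrightarrow> monomial_value m \<in> carrier R"
  unfolding monomial_value_def by (rule finprod_closed) auto

lemma monomial_value_add:
  assumes "set_mset m \<subseteq> carrier R" "set_mset n \<subseteq> carrier R"
  shows "monomial_value (m + n) = monomial_value m \<otimes> monomial_value n"
proof -
  let ?S = "set_mset m \<union> set_mset n"
  have S: "finite ?S" "?S \<subseteq> carrier R" using assms by auto
  have "(\<Otimes>x\<in>?S. x [^] count (m + n) x) = (\<Otimes>x\<in>?S. x [^] count m x \<otimes> x [^] count n x)"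
    by (rule finprod_cong') (use S in \<open>auto simp: nat_pow_mult\<close>)
  also have "\<dots> = (\<Otimes>x\<in>?S. x [^] count m x) \<otimes> (\<Otimes>x\<in>?S. x [^] count n x)"
    by (rule finprod_multf) (use S in auto)
  finally show ?thesis
    using monomial_value_superset[OF S(1) _ S(2)] by auto
qed

lemma monomial_value_replicate:
  assumes "x \<in> carrier R"
  shows "monomial_value (replicate_mset n x) = x [^] n"
proof -
  have "monomial_value (replicate_mset n x) = (\<Otimes>y\<in>{x}. y [^] count (replicate_mset n x) y)"
    by (rule monomial_value_superset) (use assms in auto)
  then show ?thesis using assms by simp
qed

lemma alg_independent_carrier: "alg_independent R F S \<Longrightarrow> S \<subseteq> carrier R"
  by (simp add: alg_independent_iff)

lemma alg_independentD:
  assumes "alg_independent R F S" "finite E" "\<And>m. m \<in> E \<Longrightarrow> set_mset m \<subseteq> S" "\<And>m. m \<in> E \<Longrightarrow> c m \<in> F"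
    "(\<Oplus>m\<in>E. c m \<otimes> monomial_value m) = \<zero>" "m \<in> E"
  shows "c m = \<zero>"
  using assms(1)[unfolded alg_independent_iff, THEN conjunct2, rule_format, of E c m] assms(2-) by simp

lemma alg_independent_subset:
  "alg_independent R F S \<Longrightarrow> S' \<subseteq> S \<Longrightarrow> alg_independent R F S'"
  unfolding alg_independent_iff by (meson subset_trans)

lemma alg_independent_empty:
  assumes "F \<subseteq> carrier R"
  shows "alg_independent R F {}"
  unfolding alg_independent_iff
proof (intro conjI allI impI ballI)
  fix E c m
  assume E: "finite E" "\<forall>m\<in>E. set_mset m \<subseteq> {} \<and> c m \<in> F"
    "(\<Oplus>m\<in>E. c m \<otimes> monomial_value m) = \<zero>" "m \<in> E"
  have "E = {{#}}" using E(2,4) by auto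
  moreover have "c {#} \<in> carrier R" using calculation E(2) assms by auto
  moreover have "m = {#}" using calculation E(4) by blast
  ultimately show "c m = \<zero>" using E(3) by (simp add: monomial_value_def)
qed simp

lemma trans_degree_ge_iff:
  assumes F: "F \<subseteq> carrier R"
  shows "enat n \<le> trans_degree R F \<longleftrightarrow> (\<exists>S. finite S \<and> alg_independent R F S \<and> card S = n)"
proof -
  let ?D = "{enat (card S) | S. finite S \<and> alg_independent R F S}"
  have ne: "?D \<noteq> {}" using alg_independent_empty[OF F] by blast
  have "(\<exists>s\<in>?D. enat n \<le> s) \<longleftrightarrow> (\<exists>S. finite S \<and> alg_independent R F S \<and> card S = n)"
  proof
    assume "\<exists>s\<in>?D. enat n \<le> s"
    then obtain S where S: "finite S" "alg_independent R F S" "n \<le> card S" by auto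
    then obtain S' where "S' \<subseteq> S" "card S' = n" "finite S'" by (metis obtain_subset_with_card_n)
    then show "\<exists>S. finite S \<and> alg_independent R F S \<and> card S = n"
      using alg_independent_subset[OF S(2)] by blast
  qed auto
  then show ?thesis unfolding trans_degree_def enat_le_Sup_iff[OF ne] .
qed

lemma alg_independent_powers:
  assumes S: "alg_independent R F S" "t \<in> S" and F: "F \<subseteq> carrier R" and b: "\<And>i. b i \<in> F"
    and z: "(\<Oplus>i\<in>{..N}. b i \<otimes> t [^] i) = \<zero>" and i: "i \<le> (N::nat)"
  shows "b i = \<zero>"
proof -
  have t: "t \<in> carrier R" using S by (auto simp: alg_independent_iff)
  have bc: "b i \<in> carrier R" for i using b F by blast
  let ?E = "(\<lambda>i. replicate_mset i t) ` {..N}" and ?c = "\<lambda>m. b (size m)"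
  have inj: "inj_on (\<lambda>i. replicate_mset i t) {..N}"
    by (rule inj_onI) (metis size_replicate_mset)
  have "(\<Oplus>m\<in>?E. ?c m \<otimes> monomial_value m) =
      (\<Oplus>i\<in>{..N}. ?c (replicate_mset i t) \<otimes> monomial_value (replicate_mset i t))"
    by (rule finsum_reindex[OF _ inj]) (use t bc in \<open>auto simp: monomial_value_replicate\<close>)
  also have "\<dots> = (\<Oplus>i\<in>{..N}. b i \<otimes> t [^] i)"
    by (rule add.finprod_cong') (use t bc in \<open>auto simp: monomial_value_replicate\<close>)
  finally have "(\<Oplus>m\<in>?E. ?c m \<otimes> monomial_value m) = \<zero>" using z by simp
  then have "?c (replicate_mset i t) = \<zero>"
    by (rule alg_independentD[OF S(1), rotated 3]) (use S(2) b i in \<open>auto split: if_splits\<close>)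
  then show ?thesis by simp
qed

text \<open>Monomials in one element \<open>t\<close> are the multisets with \<open>n\<close> copies of \<open>t\<close>; the coefficient family \<open>b\<close> is
  obtained from \<open>c\<close> by filling in zeros.\<close>

lemma alg_independent_singleton:
  assumes t: "t \<in> carrier R" and F: "F \<subseteq> carrier R" "\<zero> \<in> F"
    and ind: "\<And>b N i. (\<And>i. b i \<in> F) \<Longrightarrow> (\<Oplus>i\<in>{..N}. b i \<otimes> t [^] i) = \<zero> \<Longrightarrow> i \<le> (N::nat) \<Longrightarrow> b i = \<zero>"
  shows "alg_independent R F {t}"
  unfolding alg_independent_iff
proof (intro conjI allI impI ballI)
  show "{t} \<subseteq> carrier R" using t by simp
  fix E c m
  assume E: "finite E" "\<forall>m\<in>E. set_mset m \<subseteq> {t} \<and> c m \<in> F"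
    "(\<Oplus>m\<in>E. c m \<otimes> monomial_value m) = \<zero>" and m: "m \<in> E"
  have rep: "n = replicate_mset (size n) t" if "n \<in> E" for n
  proof (rule multiset_eqI)
    fix x
    have n: "set_mset n \<subseteq> {t}" using E that by blast
    have "size n = (\<Sum>y\<in>set_mset n. count n y)" by (simp add: size_multiset_overloaded_eq)
    also have "\<dots> = (\<Sum>y\<in>{t}. count n y)"
      by (rule sum.mono_neutral_left) (use n in \<open>auto simp: not_in_iff\<close>)
    finally show "count n x = count (replicate_mset (size n) t) x"
      using n by (auto simp: not_in_iff[symmetric])
  qed
  define b where "b i = (if replicate_mset i t \<in> E then c (replicate_mset i t) else \<zero>)" for i
  define N where "N = Max (size ` E)"
  have bF: "b i \<in> F" for i using E(2) F(2) by (auto simp: b_def)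
  have bc: "b i \<in> carrier R" for i using bF F by blast
  have le: "size n \<le> N" if "n \<in> E" for n using that E(1) by (simp add: N_def)
  have inj: "inj_on size E" using rep by (metis inj_onI)
  have "(\<Oplus>i\<in>{..N}. b i \<otimes> t [^] i) = (\<Oplus>i\<in>size ` E. b i \<otimes> t [^] i)"
  proof (rule add.finprod_mono_neutral_cong_right)
    show "size ` E \<subseteq> {..N}" using le by auto
    fix i assume "i \<in> {..N} - size ` E"
    then have "replicate_mset i t \<notin> E" by force
    then show "b i \<otimes> t [^] i = \<zero>" using t by (simp add: b_def)
  qed (use bc t in auto)
  also have "\<dots> = (\<Oplus>n\<in>E. b (size n) \<otimes> t [^] size n)"
    by (rule finsum_reindex[OF _ inj]) (use bc t in auto)
  also have "\<dots> = (\<Oplus>n\<in>E. c n \<otimes> monomial_value n)"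
  proof (rule add.finprod_cong')
    fix n assume n: "n \<in> E"
    show "b (size n) \<otimes> t [^] size n = c n \<otimes> monomial_value n"
      using rep[OF n] n monomial_value_replicate[OF t, of "size n"] by (simp add: b_def)
  qed (use E(2) F t in \<open>auto intro!: m_closed monomial_value_closed\<close>)
  finally have "(\<Oplus>i\<in>{..N}. b i \<otimes> t [^] i) = \<zero>" using E(3) by simp
  then have "b (size m) = \<zero>" using ind[of b N "size m", OF bF _ le[OF m]] by blast
  then show "c m = \<zero>" using rep[OF m] m by (simp add: b_def)
qed

lemma eval_map_rev:
  assumes "\<And>i. b i \<in> carrier R" "x \<in> carrier R"
  shows "eval (map b (rev [0..<Suc N])) x = (\<Oplus>i\<in>{..N}. b i \<otimes> x [^] i)"
proof (induct N)
  case 0 then show ?case using assms by simp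
next
  case (Suc N)
  have "eval (map b (rev [0..<Suc (Suc N)])) x = b (Suc N) \<otimes> x [^] Suc N \<oplus> eval (map b (rev [0..<Suc N])) x"
    by (simp del: nat_pow_Suc)
  also have "\<dots> = (\<Oplus>i\<in>{..Suc N}. b i \<otimes> x [^] i)"
    unfolding Suc using assms by (simp del: nat_pow_Suc)
  finally show ?case .
qed

lemma normalize_Nil_imp: "normalize p = [] \<Longrightarrow> set p \<subseteq> {\<zero>}"
  by (induct p) (auto split: if_splits)

lemma alg_independent_singleton_iff:
  assumes F: "subfield F R" and x: "x \<in> carrier R"
  shows "alg_independent R F {x} \<longleftrightarrow> \<not> algebraic F x"
proof
  note Fr = subfieldE(1)[OF F] and Fc = subfieldE(3)[OF F]
  assume ind: "alg_independent R F {x}"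
  show "\<not> algebraic F x"
  proof
    assume "algebraic F x"
    then obtain p where p: "p \<in> carrier (F[X])" "p \<noteq> []" "eval p x = \<zero>"
      using algebraicE[OF Fr x] unfolding over_def by blast
    then have pol: "set p \<subseteq> F" "hd p \<noteq> \<zero>"
      by (auto simp: univ_poly_carrier[symmetric] polynomial_def)
    obtain N where N: "length p = Suc N" using p(2) by (cases p) auto
    \<comment> \<open>polynomials are lists that start with the leading coefficient\<close>
    define b where "b i = (if i \<le> N then p ! (N - i) else \<zero>)" for i
    have bF: "b i \<in> F" for i
      using pol(1) N subringE(2)[OF Fr] by (auto simp: b_def intro!: subsetD[OF pol(1)] nth_mem)
    have "map b (rev [0..<Suc N]) = p"
      by (rule nth_equalityI) (use N in \<open>auto simp: b_def rev_nth nth_append simp del: upt_Suc\<close>)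
    then have "(\<Oplus>i\<in>{..N}. b i \<otimes> x [^] i) = \<zero>"
      using eval_map_rev[of b x N] bF Fc x p(3) by (metis subsetD)
    then have "b N = \<zero>" using alg_independent_powers[OF ind _ Fc, where b = b and t = x and N = N and i = N] bF by simp
    then show False using pol(2) p(2) by (simp add: b_def hd_conv_nth)
  qed
next
  note Fr = subfieldE(1)[OF F] and Fc = subfieldE(3)[OF F]
  assume tr: "\<not> algebraic F x"
  show "alg_independent R F {x}"
  proof (rule alg_independent_singleton[OF x Fc subringE(2)[OF Fr]])
    fix b N i assume b: "\<And>i. b i \<in> F" and z: "(\<Oplus>i\<in>{..N}. b i \<otimes> x [^] i) = \<zero>" and i: "i \<le> (N::nat)"
    let ?p = "map b (rev [0..<Suc N])"
    have pF: "set ?p \<subseteq> F" using b by auto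
    then have "eval (normalize ?p) x = \<zero>"
      using eval_normalize[of ?p x] eval_map_rev[of b x N] b Fc x z by (metis subset_trans subsetD)
    moreover have "normalize ?p \<in> carrier (F[X])"
      using normalize_gives_polynomial[OF pF] univ_poly_carrier by blast
    ultimately have "normalize ?p = []" using eval_transcendental[of F x "normalize ?p"] tr unfolding over_def by blast
    then have "set ?p \<subseteq> {\<zero>}" by (rule normalize_Nil_imp)
    moreover have "b i \<in> set ?p" using i by (auto simp del: upt_Suc)
    ultimately show "b i = \<zero>" by blast
  qed
qed

theorem trans_degree_eq_0_iff:
  assumes F: "subfield F R"
  shows "trans_degree R F = 0 \<longleftrightarrow> (\<forall>x\<in>carrier R. algebraic F x)"
proof -
  note Fc = subfieldE(3)[OF F]
  have "trans_degree R F \<noteq> 0 \<longleftrightarrow> enat 1 \<le> trans_degree R F"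
    by (cases "trans_degree R F") (auto simp: zero_enat_def)
  also have "\<dots> \<longleftrightarrow> (\<exists>x. alg_independent R F {x})"
    unfolding trans_degree_ge_iff[OF Fc] by (auto simp: card_1_singleton_iff)
  also have "\<dots> \<longleftrightarrow> (\<exists>x\<in>carrier R. \<not> algebraic F x)"
    using alg_independent_singleton_iff[OF F] alg_independent_carrier[of F] by blast
  finally show ?thesis by blast
qed

text \<open>Coefficients beyond the degree vanish, so the representation is valid for all large bounds \<open>N\<close>. This
  allows a common bound for finitely many elements.\<close>

lemma simple_extension_rep:
  assumes F: "subfield F R" and t: "t \<in> carrier R" and p: "p \<in> simple_extension F t"
  shows "\<exists>b N0. (\<forall>i. b i \<in> F) \<and> (\<forall>N\<ge>N0. p = (\<Oplus>i\<in>{..N::nat}. b i \<otimes> t [^] i))"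
  using p
proof (induct p rule: simple_extension.induct)
  case zero
  have "\<zero> = (\<Oplus>i\<in>{..N}. \<zero> \<otimes> t [^] i)" for N :: nat using t by simp
  then show ?case using subringE(2)[OF subfieldE(1)[OF F]] by (intro exI[of _ "\<lambda>_. \<zero>"] exI[of _ 0]) simp
next
  case (lin k1 k2)
  then obtain b N0 where b: "\<And>i. b i \<in> F" "\<And>N. N \<ge> N0 \<Longrightarrow> k1 = (\<Oplus>i\<in>{..N::nat}. b i \<otimes> t [^] i)" by blast
  have bc: "b i \<in> carrier R" for i using b subfieldE(3)[OF F] by blast
  have k2: "k2 \<in> carrier R" using lin subfieldE(3)[OF F] by blast
  let ?b = "case_nat k2 b"
  have "k1 \<otimes> t \<oplus> k2 = (\<Oplus>i\<in>{..N}. ?b i \<otimes> t [^] i)" if N: "N \<ge> Suc N0" for N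
  proof -
    obtain N' where N': "N = Suc N'" "N' \<ge> N0" using N by (cases N) auto
    have "(\<Oplus>i\<in>{..N}. ?b i \<otimes> t [^] i) = (\<Oplus>i\<in>{..N'}. ?b (Suc i) \<otimes> t [^] Suc i) \<oplus> ?b 0 \<otimes> t [^] (0::nat)"
      unfolding N'(1) by (rule finsum_Suc2) (use bc k2 t in \<open>auto simp: Pi_iff split: nat.splits\<close>)
    also have "(\<Oplus>i\<in>{..N'}. ?b (Suc i) \<otimes> t [^] Suc i) = (\<Oplus>i\<in>{..N'}. (b i \<otimes> t [^] i) \<otimes> t)"
      by (rule add.finprod_cong') (use bc t in \<open>auto simp: m_assoc\<close>)
    also have "\<dots> = (\<Oplus>i\<in>{..N'}. b i \<otimes> t [^] i) \<otimes> t"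
      by (rule finsum_ldistr[symmetric]) (use bc t in auto)
    finally show ?thesis using b(2)[OF N'(2)] k2 by simp
  qed
  moreover have "\<forall>i. ?b i \<in> F" using b(1) lin by (auto split: nat.split)
  ultimately show ?case by blast
qed

lemma alg_independent_no_relation:
  assumes F: "subfield F R" and S: "alg_independent R F S" "t \<in> S"
    and p: "p \<in> simple_extension F t" and a: "a \<in> F" and z: "p \<otimes> t \<oplus> a = \<zero>"
  shows "a = \<zero>"
proof -
  have t: "t \<in> carrier R" using S by (auto simp: alg_independent_iff)
  note Fc = subfieldE(3)[OF F]
  obtain b N where b: "\<And>i. b i \<in> F" "p = (\<Oplus>i\<in>{..N::nat}. b i \<otimes> t [^] i)"
    using simple_extension_rep[OF F t p] by blast
  have bc: "b i \<in> carrier R" for i using b Fc by blast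
  have ac: "a \<in> carrier R" using a Fc by blast
  let ?b = "case_nat a b"
  have "(\<Oplus>i\<in>{..Suc N}. ?b i \<otimes> t [^] i) = (\<Oplus>i\<in>{..N}. ?b (Suc i) \<otimes> t [^] Suc i) \<oplus> ?b 0 \<otimes> t [^] (0::nat)"
    by (rule finsum_Suc2) (use bc ac t in \<open>auto simp: Pi_iff split: nat.splits\<close>)
  also have "(\<Oplus>i\<in>{..N}. ?b (Suc i) \<otimes> t [^] Suc i) = (\<Oplus>i\<in>{..N}. (b i \<otimes> t [^] i) \<otimes> t)"
    by (rule add.finprod_cong') (use bc t in \<open>auto simp: m_assoc\<close>)
  also have "\<dots> = p \<otimes> t" unfolding b(2)
    by (rule finsum_ldistr[symmetric]) (use bc t in auto)
  finally have "(\<Oplus>i\<in>{..Suc N}. ?b i \<otimes> t [^] i) = \<zero>" using z ac by simp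
  moreover have "?b i \<in> F" for i using b(1) a by (auto split: nat.split)
  ultimately have "?b 0 = \<zero>" using alg_independent_powers[OF S Fc, of ?b "Suc N" 0] by blast
  then show ?thesis by simp
qed

lemma common_denominator:
  assumes A: "subring A R" and E: "finite E"
  shows "(\<forall>m\<in>E. c m \<in> quot_field R A) \<Longrightarrow> \<exists>d\<in>A. d \<noteq> \<zero> \<and> (\<forall>m\<in>E. d \<otimes> c m \<in> A)"
  using E
proof (induct E rule: finite_induct)
  case empty then show ?case using subringE(3)[OF A] one_not_zero by blast
next
  case (insert e E)
  then obtain d where d: "d \<in> A" "d \<noteq> \<zero>" "\<And>m. m \<in> E \<Longrightarrow> d \<otimes> c m \<in> A" by auto
  obtain a b where ab: "a \<in> A" "b \<in> A" "b \<noteq> \<zero>" "c e = a \<otimes> inv b"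
    using insert quot_field_memE[of "c e" A] by blast
  note Ac = subringE(1)[OF A]
  have cc: "a \<in> carrier R" "b \<in> carrier R" "d \<in> carrier R" using ab d Ac by auto
  have "(d \<otimes> b) \<otimes> c e = d \<otimes> a"
    unfolding ab(4) using cc ab(3) m_lcomm[of b a "inv b"] by (simp add: m_assoc)
  then have "(d \<otimes> b) \<otimes> c e \<in> A" using subringE(6)[OF A d(1) ab(1)] by simp
  moreover have "(d \<otimes> b) \<otimes> c m \<in> A" if m: "m \<in> E" for m
  proof -
    have "c m \<in> carrier R" using insert m quot_field_carrier[OF A] by blast
    then have "(d \<otimes> b) \<otimes> c m = b \<otimes> (d \<otimes> c m)" using cc by algebra
    then show ?thesis using subringE(6)[OF A ab(2) d(3)[OF m]] by simp
  qed
  moreover have "d \<otimes> b \<noteq> \<zero>" using d ab cc by (simp add: integral_iff)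
  ultimately show ?case using subringE(6)[OF A d(1) ab(2)] by blast
qed

text \<open>After multiplication by a common denominator, all coefficients are polynomials in \<open>t\<close>. Expanding them
  gives a relation over \<open>F\<close> between monomials in \<open>t\<close> and \<open>S\<close>; a monomial \<open>n\<close> determines its part in \<open>S\<close> and
  its exponent of \<open>t\<close>, hence no terms are merged.\<close>

lemma alg_independent_insert:
  assumes F: "subfield F R" and S: "alg_independent R F (insert t S)" "t \<notin> S"
  shows "alg_independent R (quot_field R (simple_extension F t)) S"
  unfolding alg_independent_iff
proof (intro conjI allI impI)
  note Fc = subfieldE(3)[OF F]
  have t: "t \<in> carrier R" and Sc: "S \<subseteq> carrier R" using S by (auto simp: alg_independent_iff)
  show "S \<subseteq> carrier R" by fact
  let ?A = "simple_extension F t"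
  have A: "subring ?A R" using simple_extension_is_subring[OF subfieldE(1)[OF F] t] .
  note Ac = subringE(1)[OF A]
  fix E c
  assume E: "finite E" "\<forall>m\<in>E. set_mset m \<subseteq> S \<and> c m \<in> quot_field R ?A"
    and z: "(\<Oplus>m\<in>E. c m \<otimes> monomial_value m) = \<zero>"
  obtain d where d: "d \<in> ?A" "d \<noteq> \<zero>" "\<And>m. m \<in> E \<Longrightarrow> d \<otimes> c m \<in> ?A"
    using common_denominator[OF A E(1), of c] E(2) by blast
  have dc: "d \<in> carrier R" using d Ac by blast
  have cc: "c m \<in> carrier R" if "m \<in> E" for m using that E quot_field_carrier[OF A] by blast
  have mc: "monomial_value m \<in> carrier R" if "m \<in> E" for m
    by (rule monomial_value_closed) (use that E Sc in blast)
  have "\<forall>m. \<exists>b N0. m \<in> E \<longrightarrow> (\<forall>i. b i \<in> F) \<and> (\<forall>N\<ge>N0. d \<otimes> c m = (\<Oplus>i\<in>{..N::nat}. b i \<otimes> t [^] i))"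
    using simple_extension_rep[OF F t d(3)] by blast
  then obtain b N0 where b: "\<And>m i. m \<in> E \<Longrightarrow> b m i \<in> F"
      "\<And>m N. m \<in> E \<Longrightarrow> N \<ge> N0 m \<Longrightarrow> d \<otimes> c m = (\<Oplus>i\<in>{..N::nat}. b m i \<otimes> t [^] i)"
    by metis
  define N where "N = Max (N0 ` E)"
  have N: "d \<otimes> c m = (\<Oplus>i\<in>{..N}. b m i \<otimes> t [^] i)" if "m \<in> E" for m
    using b(2)[OF that, of N] that E(1) by (simp add: N_def)
  have bc: "b m i \<in> carrier R" if "m \<in> E" for m i using b(1)[OF that] Fc by blast
  let ?h = "\<lambda>m i. m + replicate_mset i t"
  let ?E = "\<Union>m\<in>E. ?h m ` {..N}"
  \<comment> \<open>the coefficient of the monomial \<open>n\<close> in the expanded relation\<close>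
  define c' where "c' n = b (filter_mset (\<lambda>x. x \<noteq> t) n) (count n t)" for n
  have tm: "count m t = 0" if "m \<in> E" for m using that E(2) S(2) by (auto simp: not_in_iff[symmetric])
  have rec: "filter_mset (\<lambda>x. x \<noteq> t) (?h m i) = m" "count (?h m i) t = i" if "m \<in> E" for m i
  proof -
    show "filter_mset (\<lambda>x. x \<noteq> t) (?h m i) = m"
      by (rule multiset_eqI) (use tm[OF that] in auto)
    show "count (?h m i) t = i" using tm[OF that] by simp
  qed
  have c'h: "c' (?h m i) = b m i" if "m \<in> E" for m i unfolding c'_def rec[OF that] ..
  have mvh: "monomial_value (?h m i) = monomial_value m \<otimes> t [^] i" if "m \<in> E" for m i
    using monomial_value_add[of m "replicate_mset i t"] that E(2) Sc t
    by (auto simp: monomial_value_replicate split: if_splits)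
  have inj: "inj_on (?h m) {..N}" if "m \<in> E" for m
  proof (rule inj_onI)
    fix i j assume "?h m i = ?h m j"
    then have "count (?h m i) t = count (?h m j) t" by (rule arg_cong)
    then show "i = j" unfolding rec(2)[OF that] .
  qed
  have inner: "(\<Oplus>n\<in>?h m ` {..N}. c' n \<otimes> monomial_value n) = d \<otimes> (c m \<otimes> monomial_value m)"
    if m: "m \<in> E" for m
  proof -
    have "(\<Oplus>n\<in>?h m ` {..N}. c' n \<otimes> monomial_value n) = (\<Oplus>i\<in>{..N}. c' (?h m i) \<otimes> monomial_value (?h m i))"
      by (rule finsum_reindex[OF _ inj[OF m]]) (use bc mc m t in \<open>auto simp: c'h mvh\<close>)
    also have "\<dots> = (\<Oplus>i\<in>{..N}. (b m i \<otimes> t [^] i) \<otimes> monomial_value m)"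
      by (rule add.finprod_cong') (use bc[OF m] mc[OF m] m t in \<open>auto simp: c'h mvh m_ac\<close>)
    also have "\<dots> = (\<Oplus>i\<in>{..N}. b m i \<otimes> t [^] i) \<otimes> monomial_value m"
      by (rule finsum_ldistr[symmetric]) (use bc[OF m] mc[OF m] t in auto)
    also have "\<dots> = d \<otimes> (c m \<otimes> monomial_value m)"
      unfolding N[OF m, symmetric] using dc cc[OF m] mc[OF m] by (simp add: m_assoc)
    finally show ?thesis .
  qed
  have "(\<Oplus>n\<in>?E. c' n \<otimes> monomial_value n) = (\<Oplus>m\<in>E. (\<Oplus>n\<in>?h m ` {..N}. c' n \<otimes> monomial_value n))"
  proof (rule add.finprod_UN_disjoint[OF E(1)])
    show "pairwise (\<lambda>m m'. disjnt (?h m ` {..N}) (?h m' ` {..N})) E"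
    proof (rule pairwiseI)
      fix m m' assume mm: "m \<in> E" "m' \<in> E" "m \<noteq> m'"
      show "disjnt (?h m ` {..N}) (?h m' ` {..N})"
        unfolding disjnt_def using rec(1)[OF mm(1)] rec(1)[OF mm(2)] mm(3) by (metis (no_types, lifting) disjoint_iff imageE)
    qed
  qed (use bc mc t in \<open>auto simp: c'h mvh\<close>)
  also have "\<dots> = (\<Oplus>m\<in>E. d \<otimes> (c m \<otimes> monomial_value m))"
    by (rule add.finprod_cong') (use inner dc cc mc in auto)
  also have "\<dots> = d \<otimes> (\<Oplus>m\<in>E. c m \<otimes> monomial_value m)"
    by (rule finsum_rdistr[symmetric]) (use E(1) dc cc mc in auto)
  also have "\<dots> = \<zero>" using z dc by simp
  finally have z': "(\<Oplus>n\<in>?E. c' n \<otimes> monomial_value n) = \<zero>" .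
  have fin: "finite ?E" using E(1) by blast
  have c'z: "c' n = \<zero>" if n: "n \<in> ?E" for n
  proof (rule alg_independentD[OF S(1) fin _ _ z' n])
    fix n assume "n \<in> ?E"
    then obtain m i where n: "m \<in> E" "n = ?h m i" by blast
    then show "set_mset n \<subseteq> insert t S" using E(2) by (auto split: if_splits)
    show "c' n \<in> F" unfolding n(2) c'h[OF n(1)] using b(1) n(1) .
  qed
  show "\<forall>m\<in>E. c m = \<zero>"
  proof
    fix m assume m: "m \<in> E"
    have "b m i = \<zero>" if "i \<le> N" for i
    proof -
      have "?h m i \<in> ?E" using that m by blast
      then show ?thesis using c'z c'h[OF m] by metis
    qed
    then have "(\<Oplus>i\<in>{..N}. b m i \<otimes> t [^] i) = (\<Oplus>i\<in>{..N}. \<zero>)"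
      by (intro add.finprod_cong') (use t in auto)
    then have "d \<otimes> c m = \<zero>" using N[OF m] by simp
    then show "c m = \<zero>" using d(2) dc cc[OF m] by (simp add: integral_iff)
  qed
qed

lemma alg_independent_nonzero:
  assumes F: "subfield F R" and S: "alg_independent R F S" "t \<in> S"
  shows "t \<noteq> \<zero>"
proof
  assume t: "t = \<zero>"
  note Fr = subfieldE(1)[OF F] and Fc = subfieldE(3)[OF F]
  let ?b = "\<lambda>i. if i = (1::nat) then \<one> else \<zero>"
  have "(\<Oplus>i\<in>{..1}. ?b i \<otimes> t [^] i) = \<zero>"
    unfolding t by (rule add.finprod_one_eqI) auto
  moreover have "?b i \<in> F" for i using subringE(2,3)[OF Fr] by simp
  ultimately have "?b 1 = \<zero>"
    by (intro alg_independent_powers[OF S Fc, where b = ?b and N = 1 and i = 1]) simp_all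
  then show False by simp
qed

section \<open>Extending a valuation to a larger field\<close>

text \<open>The element \<open>t\<close> is made infinitesimal over \<open>F\<close>: the polynomials in \<open>t\<close> whose constant term is a nonunit
  of \<open>W\<close> form a nonunital subring, and it contains \<open>t f\<close> for every \<open>f \<in> F\<close>. Transcendence is used only to
  see that one is not among them.\<close>

lemma transcendental_extension:
  assumes W: "valring F W" and t: "t \<in> carrier R"
    and tr: "\<And>p a. p \<in> simple_extension F t \<Longrightarrow> a \<in> F \<Longrightarrow> p \<otimes> t \<oplus> a = \<zero> \<Longrightarrow> a = \<zero>"
  shows "\<exists>V. valring (quot_field R (simple_extension F t)) V \<and> W \<subseteq> V \<and> nonunits W \<subseteq> nonunits V \<and>
    (\<forall>w\<in>F. w \<noteq> \<zero> \<longrightarrow> dominates V t w) \<and> t \<in> nonunits V"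
proof -
  have F: "subfield F R" and sW: "subring W R" using W by (rule valringD)+
  note Fr = subfieldE(1)[OF F] and Fc = subfieldE(3)[OF F] and WF = valringD(3)[OF W]
  let ?A = "simple_extension F t" and ?Q = "quot_field R (simple_extension F t)"
  have A: "subring ?A R" using simple_extension_is_subring[OF Fr t] .
  note Ac = subringE(1)[OF A]
  have FA: "F \<subseteq> ?A" using simple_extension_incl[OF Fc t] .
  have tA: "t \<in> ?A" using simple_extension_mem[OF Fr t] .
  have Q: "subfield ?Q R" by (rule quot_field_subfield[OF A])
  have AQ: "?A \<subseteq> ?Q" by (rule quot_field_incl[OF A])
  define J where "J = {p \<otimes> t \<oplus> a | p a. p \<in> ?A \<and> a \<in> nonunits W}"
  have JI: "p \<otimes> t \<oplus> a \<in> J" if "p \<in> ?A" "a \<in> nonunits W" for p a using that unfolding J_def by blast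
  have JE: "\<exists>p a. x = p \<otimes> t \<oplus> a \<and> p \<in> ?A \<and> a \<in> nonunits W \<and> p \<in> carrier R \<and> a \<in> carrier R \<and> a \<in> F \<and> a \<in> ?A \<and> a \<in> W"
    if "x \<in> J" for x
  proof -
    obtain p a where "x = p \<otimes> t \<oplus> a" "p \<in> ?A" "a \<in> nonunits W" using \<open>x \<in> J\<close> unfolding J_def by blast
    then show ?thesis using Ac Fc WF FA nonunits_subset[of W] by blast
  qed
  note wm = nonunits_mult(2)[OF sW] and wa = nonunits_add[OF W]
  have nu: "nonunital ?Q J" unfolding nonunital_def
  proof (intro conjI ballI)
    show "J \<subseteq> ?Q"
    proof
      fix x assume "x \<in> J"
      then obtain p a where "x = p \<otimes> t \<oplus> a" "p \<in> ?A" "a \<in> ?A" using JE by blast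
      then have "x \<in> ?A" using subringE(7)[OF A subringE(6)[OF A _ tA]] by blast
      then show "x \<in> ?Q" using AQ by blast
    qed
    show "\<zero> \<in> J" using JI[OF subringE(2)[OF A] zero_in_nonunits[OF sW]] t by simp
    fix x assume "x \<in> J"
    then obtain p a where x: "x = p \<otimes> t \<oplus> a" "p \<in> ?A" "a \<in> nonunits W" "p \<in> carrier R" "a \<in> carrier R" "a \<in> ?A" "a \<in> W"
      using JE by blast
    have "\<ominus> x = (\<ominus> p) \<otimes> t \<oplus> \<ominus> a" unfolding x(1) using x(4,5) t by algebra
    then show "\<ominus> x \<in> J" using JI[OF subringE(5)[OF A x(2)] nonunits_minus[OF sW x(3)]] by simp
    fix y assume "y \<in> J"
    then obtain q b where y: "y = q \<otimes> t \<oplus> b" "q \<in> ?A" "b \<in> nonunits W" "q \<in> carrier R" "b \<in> carrier R" "b \<in> ?A" "b \<in> W"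
      using JE by blast
    have "x \<oplus> y = (p \<oplus> q) \<otimes> t \<oplus> (a \<oplus> b)" unfolding x(1) y(1) using x(4,5) y(4,5) t by algebra
    then show "x \<oplus> y \<in> J" using JI[OF subringE(7)[OF A x(2) y(2)] wa[OF x(3) y(3)]] by simp
    have "x \<otimes> y = (p \<otimes> (q \<otimes> t) \<oplus> p \<otimes> b \<oplus> a \<otimes> q) \<otimes> t \<oplus> a \<otimes> b"
      unfolding x(1) y(1) using x(4,5) y(4,5) t by algebra
    moreover have "p \<otimes> (q \<otimes> t) \<oplus> p \<otimes> b \<oplus> a \<otimes> q \<in> ?A"
      by (intro subringE(6,7)[OF A] x y tA)
    ultimately show "x \<otimes> y \<in> J" using JI[OF _ wm[OF y(3) x(7)]] by simp
  qed
  have one: "\<one> \<notin> J"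
  proof
    assume "\<one> \<in> J"
    then obtain p a where x: "\<one> = p \<otimes> t \<oplus> a" "p \<in> ?A" "a \<in> nonunits W" "p \<in> carrier R" "a \<in> carrier R" "a \<in> F"
      using JE by blast
    have "p \<otimes> t \<oplus> (a \<oplus> \<ominus> \<one>) = (p \<otimes> t \<oplus> a) \<oplus> \<ominus> \<one>" using x(4,5) t by algebra
    also have "\<dots> = \<zero>" unfolding x(1)[symmetric] by (simp add: r_neg)
    finally have "a \<oplus> \<ominus> \<one> = \<zero>" using tr[OF x(2)] subringE(7)[OF Fr x(6) subringE(5)[OF Fr subringE(3)[OF Fr]]] by blast
    then have "a = \<one>" using x(5) by (metis minus_eq one_closed r_right_minus_eq)
    then show False using x(3) one_notin_nonunits[OF sW] by blast
  qed
  have WJ: "w \<otimes> j \<in> J" if w: "w \<in> W" and j: "j \<in> J" for w j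
  proof -
    obtain p a where x: "j = p \<otimes> t \<oplus> a" "p \<in> ?A" "a \<in> nonunits W" "p \<in> carrier R" "a \<in> carrier R"
      using JE[OF j] by blast
    have w': "w \<in> ?A" "w \<in> carrier R" using w WF FA Fc by auto
    have "w \<otimes> j = (w \<otimes> p) \<otimes> t \<oplus> w \<otimes> a" unfolding x(1) using x(4,5) t w' by algebra
    then show ?thesis using JI[OF subringE(6)[OF A w'(1) x(2)] wm[OF x(3) w]] by simp
  qed
  have WQ: "W \<subseteq> ?Q" using WF FA AQ by blast
  obtain V where V: "valring ?Q V" "W \<subseteq> V" "J \<subseteq> nonunits V"
    by (rule exists_valuation_ring[OF Q nu one WQ WJ])
  have wJ: "nonunits W \<subseteq> J"
  proof
    fix a assume a: "a \<in> nonunits W"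
    then have "a \<in> carrier R" using Fc WF nonunits_subset[of W] by blast
    then show "a \<in> J" using JI[OF subringE(2)[OF A] a] t by simp
  qed
  have tJ: "t \<otimes> f \<in> J" if f: "f \<in> F" for f
  proof -
    have "f \<in> ?A" "f \<in> carrier R" using f FA Fc by auto
    then show ?thesis using JI[OF _ zero_in_nonunits[OF sW], of f] t by (simp add: m_comm)
  qed
  have "dominates V t w" if w: "w \<in> F" "w \<noteq> \<zero>" for w
    unfolding dominates_def
  proof
    fix n :: nat
    have "inv (w [^] n) \<in> F"
      using subfield_inv[OF F subring_pow[OF Fr w(1)]] w Fc by auto
    then show "t \<otimes> inv (w [^] n) \<in> nonunits V" using tJ V(3) by blast
  qed
  moreover have "t \<in> nonunits V" using tJ[OF subringE(3)[OF Fr]] V(3) t by auto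
  ultimately show ?thesis using V(1,2,3) wJ by blast
qed

lemma valring_nonunital:
  assumes "valring Q V" "Q \<subseteq> Q'"
  shows "nonunital Q' (nonunits V)"
proof -
  have sV: "subring V R" using assms(1) by (rule valringD)
  show ?thesis unfolding nonunital_def
  proof (intro conjI ballI)
    show "nonunits V \<subseteq> Q'" using valringD(3)[OF assms(1)] assms(2) nonunits_subset[of V] by blast
    show "\<zero> \<in> nonunits V" by (rule zero_in_nonunits[OF sV])
    fix a assume a: "a \<in> nonunits V"
    then show "\<ominus> a \<in> nonunits V" by (rule nonunits_minus[OF sV])
    fix b assume b: "b \<in> nonunits V"
    show "a \<oplus> b \<in> nonunits V" by (rule nonunits_add[OF assms(1) a b])
    show "a \<otimes> b \<in> nonunits V" using nonunits_mult(1)[OF sV a] b nonunits_subset[of V] by blast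
  qed
qed

text \<open>The elements of \<open>S\<close> are adjoined one by one, and each of them is put in front of the lexchain. The
  quotient field of \<open>F[t]\<close> takes the role of \<open>F\<close> in the next step.\<close>

theorem valuation_extension:
  assumes S: "finite S"
  shows "valring F W \<Longrightarrow> lexchain W ws \<Longrightarrow> alg_independent R F S \<Longrightarrow>
    \<exists>V xs. valring (carrier R) V \<and> W \<subseteq> V \<and> nonunits W \<subseteq> nonunits V \<and> lexchain V xs \<and>
      length xs = length ws + card S"
  using S
proof (induct S arbitrary: F W ws rule: finite_induct)
  case empty
  note W = empty(1)
  have sW: "subring W R" using W by (rule valringD)
  have "nonunital (carrier R) (nonunits W)" by (rule valring_nonunital[OF W valringD(4)[OF W]])
  then obtain V where V: "valring (carrier R) V" "W \<subseteq> V" "nonunits W \<subseteq> nonunits V"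
    by (rule exists_valuation_ring[OF carrier_is_subfield _ one_notin_nonunits[OF sW] valringD(5)[OF W]
          nonunits_mult(2)[OF sW]])
  then show ?case using lexchain_mono[OF empty(2) V(3)] by (intro exI[of _ V] exI[of _ ws]) simp
next
  case (insert t S)
  note W = insert(4) and ind = insert(6)
  have F: "subfield F R" and sW: "subring W R" using W by (rule valringD)+
  have t: "t \<in> carrier R" using alg_independent_carrier[OF ind] by blast
  obtain V where V: "valring (quot_field R (simple_extension F t)) V" "W \<subseteq> V" "nonunits W \<subseteq> nonunits V"
      "\<And>w. w \<in> F \<Longrightarrow> w \<noteq> \<zero> \<Longrightarrow> dominates V t w" "t \<in> nonunits V"
    using transcendental_extension[OF W t] alg_independent_no_relation[OF F ind, of t] by blast
  have "dominates V t w" if w: "w \<in> set ws" for w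
  proof (rule V(4))
    show "w \<noteq> \<zero>" using w insert(5) by (auto simp: lexchain_def)
    show "w \<in> F" using w insert(5) valringD(3)[OF W] nonunits_subset[of W] unfolding lexchain_def by blast
  qed
  then have "lexchain V (t # ws)"
    using V(5) alg_independent_nonzero[OF F ind, of t] lexchain_mono[OF insert(5) V(3)]
    by (simp add: lexchain_Cons)
  from insert(3)[OF V(1) this alg_independent_insert[OF F ind insert(2)]]
  obtain U xs where U: "valring (carrier R) U" "V \<subseteq> U" "nonunits V \<subseteq> nonunits U" "lexchain U xs"
      "length xs = length (t # ws) + card S" by blast
  have "length xs = length ws + card (insert t S)" using U(5) insert(1,2) by simp
  then show ?case using U V(2,3) by blast
qed

end

section \<open>Restricting a valuation to a subfield\<close>

context field
begin

text \<open>On the nonzero nonunits, \<open>dominates V\<close> is thus the strict part of a total preorder: not dominating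
  \<open>y\<close> means dividing some power of \<open>y\<close>.\<close>

lemma not_dominates_trans:
  assumes V: "valring Q V" and x: "x \<in> Q" "x \<noteq> \<zero>" and y: "y \<in> Q" "y \<noteq> \<zero>" and z: "z \<in> Q" "z \<noteq> \<zero>"
    and xy: "\<not> dominates V x y" and yz: "\<not> dominates V y z"
  shows "\<not> dominates V x z"
proof -
  have sV: "subring V R" using V by (rule valringD)
  have c: "x \<in> carrier R" "y \<in> carrier R" "z \<in> carrier R" using x y z valringD(4)[OF V] by auto
  obtain n where n: "y [^] (n::nat) \<otimes> inv x \<in> V" using xy not_dominates_iff[OF V x(1) y(1,2) x(2)] by blast
  obtain m where m: "z [^] (m::nat) \<otimes> inv y \<in> V" using yz not_dominates_iff[OF V y(1) z(1,2) y(2)] by blast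
  have "inv y [^] n \<otimes> (y [^] n \<otimes> inv x) = inv x"
    using field_cancel_l(2)[of "y [^] n" "inv x"] c x y by simp
  then have "(z [^] m \<otimes> inv y) [^] n \<otimes> (y [^] n \<otimes> inv x) = z [^] (m * n) \<otimes> inv x"
    using c x y by (simp add: nat_pow_distrib nat_pow_pow m_assoc)
  then have "z [^] (m * n) \<otimes> inv x \<in> V" using subringE(6)[OF sV subring_pow[OF sV m, of n] n] by simp
  then show ?thesis using not_dominates_iff[OF V x(1) z(1,2) x(2)] by blast
qed

lemma dominates_irrefl:
  assumes V: "valring Q V" and x: "x \<in> Q" "x \<noteq> \<zero>"
  shows "\<not> dominates V x x"
proof -
  have "x \<in> carrier R" using x valringD(4)[OF V] by blast
  then have "x [^] (1::nat) \<otimes> inv x \<in> V" using x subringE(3)[OF valringD(2)[OF V]] by simp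
  then show ?thesis using not_dominates_iff[OF V x(1) x x(2)] by blast
qed

lemma nonunits_sqrt:
  assumes V: "valring Q V" and x: "x \<in> Q" "x \<otimes> x \<in> nonunits V"
  shows "x \<in> nonunits V"
proof (rule ccontr)
  assume n: "x \<notin> nonunits V"
  have sV: "subring V R" using V by (rule valringD)
  have xc: "x \<in> carrier R" using x valringD(4)[OF V] by blast
  have nz: "x \<noteq> \<zero>" using n zero_in_nonunits[OF sV] by blast
  have i: "inv x \<in> V"
    using n valring_notin[OF V x(1)] not_nonunit(2)[OF sV _ n] nonunits_subset[of V] by blast
  have "inv x \<otimes> (x \<otimes> x) \<in> nonunits V" by (rule nonunits_mult(2)[OF sV x(2) i])
  then show False using n xc nz by simp
qed

text \<open>The square of \<open>x / (y z)\<^sup>n\<close> is the product of \<open>x / y\<^sup>2\<^sup>n\<close> and \<open>x / z\<^sup>2\<^sup>n\<close>.\<close>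

lemma dominates_mult:
  assumes V: "valring Q V" and x: "x \<in> Q" and y: "y \<in> Q" "y \<noteq> \<zero>" and z: "z \<in> Q" "z \<noteq> \<zero>"
    and d: "dominates V x y" "dominates V x z"
  shows "dominates V x (y \<otimes> z)"
  unfolding dominates_def
proof
  fix n :: nat
  have sV: "subring V R" and sQ: "subfield Q R" using V by (rule valringD)+
  note Qr = subfieldE(1)[OF sQ]
  have c: "x \<in> carrier R" "y \<in> carrier R" "z \<in> carrier R" "inv y \<in> carrier R" "inv z \<in> carrier R"
    using x y z valringD(4)[OF V] by auto
  have yz: "y \<otimes> z \<in> Q" "y \<otimes> z \<noteq> \<zero>" using subringE(6)[OF Qr y(1) z(1)] y z c by (auto simp: integral_iff)
  let ?q = "x \<otimes> inv ((y \<otimes> z) [^] n)"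
  have q: "?q \<in> Q" using valring_pow_in[OF V x yz] by blast
  have e: "?q = x \<otimes> (inv y [^] n \<otimes> inv z [^] n)"
    using c y z yz by (simp add: nat_pow_distrib)
  have "x \<otimes> inv (y [^] (n + n)) = x \<otimes> (inv y [^] n \<otimes> inv y [^] n)"
      "x \<otimes> inv (z [^] (n + n)) = x \<otimes> (inv z [^] n \<otimes> inv z [^] n)"
    using c y z by (simp_all add: nat_pow_mult)
  then have "(x \<otimes> inv (y [^] (n + n))) \<otimes> (x \<otimes> inv (z [^] (n + n))) = ?q \<otimes> ?q"
    unfolding e using c by (simp add: m_ac)
  moreover have "(x \<otimes> inv (y [^] (n + n))) \<otimes> (x \<otimes> inv (z [^] (n + n))) \<in> nonunits V"
    using nonunits_mult(1)[OF sV] d nonunits_subset[of V] unfolding dominates_def by blast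
  ultimately show "?q \<in> nonunits V" using nonunits_sqrt[OF V q] by simp
qed

lemma dominates_pow:
  assumes V: "valring Q V" and y: "y \<in> carrier R" and d: "dominates V x y"
  shows "dominates V x (y [^] (k::nat))"
  using d y unfolding dominates_def by (simp add: nat_pow_pow)

lemma dominates_one: "x \<in> carrier R \<Longrightarrow> x \<in> nonunits V \<Longrightarrow> dominates V x \<one>"
  by (simp add: dominates_def)

text \<open>If \<open>h\<close> and \<open>h'\<close> are negligible compared with \<open>x\<close>, then the value of \<open>a\<close> is approximately \<open>d + 1\<close> times
  the value of \<open>x\<close>, so that \<open>a\<close> and \<open>x\<close> generate the same convex subgroup. In the form needed here:
  neither dominates the other.\<close>

lemma monomial_comparison:
  assumes V: "valring Q V" and x: "x \<in> nonunits V" "x \<noteq> \<zero>"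
    and h: "h \<in> V" "h \<noteq> \<zero>" "dominates V x h" and h': "h' \<in> V" "h' \<noteq> \<zero>" "dominates V x h'"
    and a: "a \<in> Q" "a \<noteq> \<zero>" and u: "u \<in> V" "u \<notin> nonunits V"
    and eq: "x [^] Suc d \<otimes> h = a \<otimes> h' \<otimes> u"
  shows "a \<in> nonunits V" "\<not> dominates V x a" "\<not> dominates V a x"
proof -
  have sV: "subring V R" using V by (rule valringD)
  note VQ = valringD(3)[OF V] and Vc = valringD(5)[OF V]
  have xV: "x \<in> V" using x nonunits_subset by blast
  have iu: "inv u \<in> V" "u \<noteq> \<zero>" using not_nonunit[OF sV u] by auto
  have c: "x \<in> carrier R" "h \<in> carrier R" "h' \<in> carrier R" "a \<in> carrier R" "u \<in> carrier R"
    "inv u \<in> carrier R" "inv h' \<in> carrier R" "inv x \<in> carrier R" "inv h \<in> carrier R" "x [^] d \<in> carrier R"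
    using xV h h' a u Vc valringD(4)[OF V] iu x by auto
  have y: "x \<otimes> inv h' \<in> nonunits V" using dominatesD(2)[OF V h'(3)] c h' by blast
  have yh: "x \<otimes> inv h \<in> V" using dominatesD(2)[OF V h(3)] c h nonunits_subset[of V] by blast
  \<comment> \<open>\<open>a = g (x / h)\<close> shows that \<open>a\<close> is a nonunit and that \<open>x\<close> divides \<open>a\<^sup>2\<close>\<close>
  define g where "g = x [^] d \<otimes> h \<otimes> inv u"
  have g: "g \<in> V" unfolding g_def by (intro subringE(6)[OF sV] subring_pow[OF sV] xV h iu)
  have gc: "g \<in> carrier R" using g Vc by blast
  have "a = (a \<otimes> h' \<otimes> u) \<otimes> (inv u \<otimes> inv h')"
    using c h' iu by (simp add: m_ac)
  also have "\<dots> = g \<otimes> (x \<otimes> inv h')" unfolding eq[symmetric] g_def using c by (simp add: m_ac)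
  finally have ag: "a = g \<otimes> (x \<otimes> inv h')" .
  show "a \<in> nonunits V" unfolding ag by (rule nonunits_mult(2)[OF sV y g])
  have h2: "x \<otimes> inv (h' [^] (2::nat)) \<in> V"
    using h'(3) nonunits_subset[of V] unfolding dominates_def by blast
  have "a [^] (2::nat) \<otimes> inv x = (g \<otimes> g) \<otimes> (x \<otimes> inv (h' [^] (2::nat)))"
  proof -
    have "a [^] (2::nat) \<otimes> inv x = g \<otimes> (x \<otimes> inv h') \<otimes> (g \<otimes> (x \<otimes> inv h')) \<otimes> inv x"
      using ag c by (simp add: numeral_2_eq_2)
    also have "\<dots> = (g \<otimes> g) \<otimes> (x \<otimes> (inv h' \<otimes> inv h')) \<otimes> (x \<otimes> inv x)"
      using gc c(1,7,8) by algebra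
    also have "\<dots> = (g \<otimes> g) \<otimes> (x \<otimes> inv (h' [^] (2::nat)))"
      using gc c h' x by (simp add: numeral_2_eq_2)
    finally show ?thesis .
  qed
  then have "a [^] (2::nat) \<otimes> inv x \<in> V" using subringE(6)[OF sV subringE(6)[OF sV g g] h2] by simp
  then show "\<not> dominates V x a"
    using not_dominates_iff[OF V _ a(1,2) x(2)] xV VQ by blast
  have "x [^] Suc (Suc d) \<otimes> inv a = h' \<otimes> u \<otimes> (x \<otimes> inv h)"
  proof -
    have "(x [^] Suc d \<otimes> h) \<otimes> (x \<otimes> inv h) = (x [^] Suc d \<otimes> x) \<otimes> (h \<otimes> inv h)"
      using c(1,2,9) nat_pow_closed[OF c(1), of "Suc d"] by algebra
    then have "x [^] Suc (Suc d) = (x [^] Suc d \<otimes> h) \<otimes> (x \<otimes> inv h)"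
      using c h by simp
    also have "\<dots> = a \<otimes> (h' \<otimes> u \<otimes> (x \<otimes> inv h))" unfolding eq using c by (simp add: m_ac)
    finally have "x [^] Suc (Suc d) \<otimes> inv a = a \<otimes> (h' \<otimes> u \<otimes> (x \<otimes> inv h)) \<otimes> inv a" by (rule arg_cong)
    also have "\<dots> = (h' \<otimes> u \<otimes> (x \<otimes> inv h)) \<otimes> (a \<otimes> inv a)" using c a by (simp only: m_ac m_closed field_inv_closed not_False_eq_True)
    finally show ?thesis using c a by simp
  qed
  moreover have "h' \<otimes> u \<otimes> (x \<otimes> inv h) \<in> V" by (intro subringE(6)[OF sV] h' u yh)
  ultimately have "x [^] Suc (Suc d) \<otimes> inv a \<in> V" by simp
  then show "\<not> dominates V a x" using not_dominates_iff[OF V a(1) _ x(2) a(2)] xV VQ by blast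
qed

fun list_monomial :: "'a list \<Rightarrow> ('a \<Rightarrow> nat) \<Rightarrow> 'a" where
  "list_monomial [] e = \<one>"
| "list_monomial (x # xs) e = x [^] e x \<otimes> list_monomial xs e"

lemma list_monomial_eq:
  assumes "distinct xs" "set xs \<subseteq> carrier R"
  shows "list_monomial xs e = (\<Otimes>x\<in>set xs. x [^] e x)"
  using assms
proof (induct xs)
  case (Cons x xs)
  have "(\<Otimes>y\<in>set (x # xs). y [^] e y) = x [^] e x \<otimes> (\<Otimes>y\<in>set xs. y [^] e y)"
    unfolding list.set by (rule finprod_insert) (use Cons in auto)
  then show ?case using Cons by simp
qed simp

lemma list_monomial_props:
  assumes V: "valring Q V"
  shows "lexchain V xs \<Longrightarrow> list_monomial xs e \<in> V \<and> list_monomial xs e \<noteq> \<zero>"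
    "lexchain V (x # xs) \<Longrightarrow> dominates V x (list_monomial xs e)"
proof -
  have sV: "subring V R" using V by (rule valringD)
  note VQ = valringD(3)[OF V] and Vc = valringD(5)[OF V]
  show 1: "lexchain V xs \<Longrightarrow> list_monomial xs e \<in> V \<and> list_monomial xs e \<noteq> \<zero>" for xs
  proof (induct xs)
    case Nil then show ?case using subringE(3)[OF sV] by simp
  next
    case (Cons x xs)
    then have x: "x \<in> V" "x \<noteq> \<zero>" using nonunits_subset[of V] by (auto simp: lexchain_Cons)
    have IH: "list_monomial xs e \<in> V" "list_monomial xs e \<noteq> \<zero>" using Cons by (auto simp: lexchain_Cons)
    have c: "x \<in> carrier R" "list_monomial xs e \<in> carrier R" using x IH Vc by auto
    show ?case using subringE(6)[OF sV subring_pow[OF sV x(1)] IH(1)] c x IH by (simp add: integral_iff)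
  qed
  show "lexchain V (x # xs) \<Longrightarrow> dominates V x (list_monomial xs e)"
  proof (induct xs)
    case Nil
    then have "x \<in> nonunits V" by (simp add: lexchain_Cons)
    moreover have "x \<in> carrier R" using calculation nonunits_subset[of V] Vc by blast
    ultimately show ?case by (simp add: dominates_one)
  next
    case (Cons y xs)
    then have l: "lexchain V (x # xs)" "lexchain V xs" "x \<in> nonunits V" "y \<in> nonunits V" "y \<noteq> \<zero>" "dominates V x y"
      by (auto simp: lexchain_Cons)
    have xy: "x \<in> Q" "y \<in> Q" "y \<in> carrier R" "y \<in> V" using l nonunits_subset[of V] VQ Vc by auto
    have p: "y [^] e y \<in> Q" "y [^] e y \<noteq> \<zero>"
      using subring_pow[OF sV xy(4)] VQ xy l by auto
    have m: "list_monomial xs e \<in> Q" "list_monomial xs e \<noteq> \<zero>" using 1[OF l(2)] VQ by auto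
    show ?case
      using dominates_mult[OF V xy(1) p m dominates_pow[OF V xy(3) l(6)] Cons(1)[OF l(1)]] by simp
  qed
qed

text \<open>The hypothesis says that no element of the lexchain has the magnitude of a nonunit in \<open>F\<close>. Two
  monomials with different exponents then have different values modulo the values of \<open>F\<close>: after
  cancellation, the first variable whose exponents differ would have the magnitude of \<open>a\<close> or of \<open>1/a\<close>.\<close>

lemma monomials_distinct_values:
  assumes V: "valring Q V" and F: "subfield F R" "F \<subseteq> Q"
  shows "lexchain V xs \<Longrightarrow>
    (\<And>x a. x \<in> set xs \<Longrightarrow> a \<in> F \<Longrightarrow> a \<in> nonunits V \<Longrightarrow> a \<noteq> \<zero> \<Longrightarrow> dominates V x a \<or> dominates V a x) \<Longrightarrow>
    z \<in> set xs \<Longrightarrow> e z \<noteq> e' z \<Longrightarrow> a \<in> F \<Longrightarrow> a \<noteq> \<zero> \<Longrightarrow> u \<in> V \<Longrightarrow> u \<notin> nonunits V \<Longrightarrow>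
    list_monomial xs e \<noteq> a \<otimes> list_monomial xs e' \<otimes> u"
proof (induct xs arbitrary: a u)
  case Nil then show ?case by simp
next
  case (Cons x xs)
  have sV: "subring V R" using V by (rule valringD)
  note VQ = valringD(3)[OF V] and Vc = valringD(5)[OF V]
  have lx: "lexchain V xs" "x \<in> nonunits V" "x \<noteq> \<zero>" using Cons(2) by (auto simp: lexchain_Cons)
  have xc: "x \<in> carrier R" using lx nonunits_subset[of V] Vc by blast
  let ?h = "list_monomial xs e" and ?h' = "list_monomial xs e'"
  have h: "?h \<in> V" "?h \<noteq> \<zero>" "?h' \<in> V" "?h' \<noteq> \<zero>"
    using list_monomial_props(1)[OF V lx(1)] by auto
  have d: "dominates V x ?h" "dominates V x ?h'" using list_monomial_props(2)[OF V Cons(2)] by auto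
  have iu: "inv u \<in> V" "u \<noteq> \<zero>" "inv u \<notin> nonunits V" using not_nonunit[OF sV Cons(8,9)] by auto
  have ia: "inv a \<in> F" "inv a \<noteq> \<zero>" using subfield_inv[OF F(1) Cons(6,7)] Cons(6,7) subfieldE(3)[OF F(1)] by auto
  have c: "?h \<in> carrier R" "?h' \<in> carrier R" "a \<in> carrier R" "u \<in> carrier R"
    using h Vc Cons(6,8) subfieldE(3)[OF F(1)] by auto
  have cp: "dominates V x b \<or> dominates V b x" if "b \<in> F" "b \<in> nonunits V" "b \<noteq> \<zero>" for b
    using Cons(3)[of x b] that by simp
  show ?case
  proof
    assume "list_monomial (x # xs) e = a \<otimes> list_monomial (x # xs) e' \<otimes> u"
    then have eq: "x [^] e x \<otimes> ?h = a \<otimes> (x [^] e' x \<otimes> ?h') \<otimes> u" by simp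
    have cancel: "p = q" if "x [^] (n::nat) \<otimes> p = x [^] n \<otimes> q" "p \<in> carrier R" "q \<in> carrier R" for n p q
      using that m_lcancel[of "x [^] n" p q] xc lx by simp
    consider "e x = e' x" | k where "e x = e' x + Suc k" | k where "e' x = e x + Suc k"
      by (metis less_imp_Suc_add nat_neq_iff add_Suc_right)
    then show False
    proof cases
      case 1
      have "x [^] e' x \<otimes> ?h = x [^] e' x \<otimes> (a \<otimes> ?h' \<otimes> u)" using eq c xc unfolding 1 by (simp add: m_ac)
      then have "?h = a \<otimes> ?h' \<otimes> u" using cancel c by simp
      moreover have "z \<in> set xs" using Cons(4,5) 1 by auto
      ultimately show False using Cons(1)[OF lx(1) _ _ Cons(5,6,7,8,9)] Cons(3) by simp
    next
      case 2
      have "x [^] e x \<otimes> ?h = x [^] e' x \<otimes> (x [^] Suc k \<otimes> ?h)"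
        unfolding 2 using c xc by (simp add: m_assoc flip: nat_pow_mult)
      then have "x [^] e' x \<otimes> (x [^] Suc k \<otimes> ?h) = x [^] e' x \<otimes> (a \<otimes> ?h' \<otimes> u)"
        using eq c xc by (simp add: m_ac)
      then have e1: "x [^] Suc k \<otimes> ?h = a \<otimes> ?h' \<otimes> u"
        by (rule cancel) (use c xc in auto)
      have aQ: "a \<in> Q" using Cons(6) F(2) by blast
      show False
        using monomial_comparison[OF V lx(2,3) h(1,2) d(1) h(3,4) d(2) aQ Cons(7,8,9) e1] cp Cons(6,7) by blast
    next
      case 3
      have e3: "x [^] e' x = x [^] e x \<otimes> x [^] Suc k"
        unfolding 3 using nat_pow_mult[OF xc, of "e x" "Suc k"] by (rule sym)
      have "x [^] e x \<otimes> ?h = x [^] e x \<otimes> (a \<otimes> (x [^] Suc k \<otimes> ?h') \<otimes> u)"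
        unfolding eq e3 using c xc by (simp del: nat_pow_Suc add: m_ac)
      then have "?h = a \<otimes> (x [^] Suc k \<otimes> ?h') \<otimes> u"
        by (rule cancel) (use c xc in auto)
      then have "inv a \<otimes> ?h \<otimes> inv u = inv a \<otimes> (a \<otimes> (x [^] Suc k \<otimes> ?h') \<otimes> u) \<otimes> inv u" by simp
      also have "\<dots> = (inv a \<otimes> a) \<otimes> (x [^] Suc k \<otimes> ?h') \<otimes> (u \<otimes> inv u)"
        using c xc Cons(7) iu by (simp del: nat_pow_Suc field_l_inv field_r_inv field_cancel_l add: m_ac)
      finally have e1: "x [^] Suc k \<otimes> ?h' = inv a \<otimes> ?h \<otimes> inv u"
        using c xc Cons(7) iu by (simp del: nat_pow_Suc)
      have aQ: "inv a \<in> Q" using ia F(2) by blast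
      show False
        using monomial_comparison[OF V lx(2,3) h(3,4) d(2) h(1,2) d(1) aQ ia(2) iu(1,3) e1] cp ia by blast
    qed
  qed
qed

text \<open>The sum has the value of the term of least value.\<close>

lemma sum_distinct_values:
  assumes V: "valring Q V" and E: "finite E" "E \<noteq> {}"
  shows "(\<And>m. m \<in> E \<Longrightarrow> f m \<in> Q \<and> f m \<noteq> \<zero>) \<Longrightarrow>
    (\<And>m n u. m \<in> E \<Longrightarrow> n \<in> E \<Longrightarrow> m \<noteq> n \<Longrightarrow> u \<in> V \<Longrightarrow> u \<notin> nonunits V \<Longrightarrow> f m \<noteq> f n \<otimes> u) \<Longrightarrow>
    \<exists>m\<in>E. \<exists>u. u \<in> V \<and> u \<notin> nonunits V \<and> (\<Oplus>m\<in>E. f m) = f m \<otimes> u"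
  using E
proof (induct E rule: finite_ne_induct)
  case (singleton m)
  have sV: "subring V R" using V by (rule valringD)
  have "f m \<in> carrier R" using singleton(1)[of m] valringD(4)[OF V] by blast
  then have "(\<Oplus>m\<in>{m}. f m) = f m \<otimes> \<one>" by simp
  then show ?case using subringE(3)[OF sV] one_notin_nonunits[OF sV] by blast
next
  case (insert m E)
  have sV: "subring V R" and sQ: "subfield Q R" using V by (rule valringD)+
  note Vc = valringD(5)[OF V] and Qc = valringD(4)[OF V]
  note fQ = insert(5)
  have fc: "f n \<in> carrier R" if "n \<in> insert m E" for n using fQ[OF that] Qc by blast
  obtain n u where n: "n \<in> E" "u \<in> V" "u \<notin> nonunits V" "(\<Oplus>m\<in>E. f m) = f n \<otimes> u"
    using insert(4) insert(5,6) by (metis insertCI)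
  have mn: "f m \<in> Q" "f m \<noteq> \<zero>" "f n \<in> Q" "f n \<noteq> \<zero>" "m \<noteq> n" using fQ n insert(3) by auto
  have c: "f m \<in> carrier R" "f n \<in> carrier R" "u \<in> carrier R" using mn n Qc Vc by auto
  have sum: "(\<Oplus>m\<in>insert m E. f m) = f m \<oplus> f n \<otimes> u"
    using finsum_insert[OF insert(1,3), of f] fc n(4) by (auto simp: Pi_iff)
  have unit: "q \<oplus> v \<in> V \<and> q \<oplus> v \<notin> nonunits V" if q: "q \<in> nonunits V" and v: "v \<in> V" "v \<notin> nonunits V" for q v
  proof -
    have qV: "q \<in> V" using q nonunits_subset by blast
    have cc: "q \<in> carrier R" "v \<in> carrier R" using qV v Vc by auto
    have "v = (q \<oplus> v) \<oplus> \<ominus> q" using cc by algebra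
    then show ?thesis
      using subringE(7)[OF sV qV v(1)] nonunits_add[OF V _ nonunits_minus[OF sV q]] v(2) by metis
  qed
  let ?q = "f m \<otimes> inv (f n)"
  have qQ: "?q \<in> Q" using subringE(6)[OF subfieldE(1)[OF sQ] mn(1) subfield_inv[OF sQ mn(3,4)]] .
  have fm: "f m = f n \<otimes> ?q" using c mn m_lcomm[of "f n" "f m" "inv (f n)"] by simp
  have q: "?q \<notin> V \<or> ?q \<in> nonunits V"
    using insert(6)[of m n ?q] fm mn(5) n(1) by auto
  show ?case
  proof (cases "?q \<in> nonunits V")
    case True
    have "?q \<in> carrier R" using qQ Qc by blast
    then have "f m \<oplus> f n \<otimes> u = f n \<otimes> (?q \<oplus> u)"
      using fm c by (metis r_distr)
    then show ?thesis using unit[OF True n(2,3)] n(1) sum by auto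
  next
    case False
    then have nV: "?q \<notin> V" using q by blast
    have r: "inv ?q \<in> nonunits V" using valring_notin[OF V qQ nV] by blast
    have iq: "inv ?q = f n \<otimes> inv (f m)" using c mn by (simp add: m_comm)
    have "f n = f m \<otimes> inv ?q" unfolding iq using c mn m_lcomm[of "f m" "f n" "inv (f m)"] by simp
    moreover have "inv ?q \<in> carrier R" using r nonunits_subset[of V] Vc by blast
    ultimately have "f m \<oplus> f n \<otimes> u = f m \<otimes> (inv ?q \<otimes> u \<oplus> \<one>)"
      using c by (metis (no_types, lifting) a_comm m_assoc m_closed one_closed r_distr r_one)
    moreover have "inv ?q \<otimes> u \<oplus> \<one> \<in> V \<and> inv ?q \<otimes> u \<oplus> \<one> \<notin> nonunits V"
      by (rule unit[OF nonunits_mult(1)[OF sV r n(2)] subringE(3)[OF sV] one_notin_nonunits[OF sV]])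
    ultimately show ?thesis using sum by auto
  qed
qed

text \<open>The rank form of Abhyankar's inequality. Elements whose magnitude occurs in \<open>F\<close> are replaced by
  elements of \<open>F\<close>; this keeps the order of domination because domination depends on magnitudes only.
  The remaining ones are algebraically independent, because the terms of a polynomial in them have
  distinct values.\<close>

theorem lexchain_split:
  assumes V: "valring Q V" and F: "subfield F R" "F \<subseteq> Q" and xs: "lexchain V xs"
  shows "\<exists>ys S. set ys \<subseteq> F \<and> lexchain V ys \<and> finite S \<and> alg_independent R F S \<and>
    length ys + card S = length xs"
proof -
  have sV: "subring V R" and sQ: "subfield Q R" using V by (rule valringD)+
  note VQ = valringD(3)[OF V] and Qc = valringD(4)[OF V] and Vc = valringD(5)[OF V]
  have inQ: "x \<in> Q" if "x \<in> nonunits V" for x using that VQ nonunits_subset[of V] by blast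
  have xsN: "x \<in> nonunits V" "x \<noteq> \<zero>" if "x \<in> set xs" for x using that xs by (auto simp: lexchain_def)
  define eq where "eq x a \<longleftrightarrow> a \<in> F \<and> a \<in> nonunits V \<and> a \<noteq> \<zero> \<and> \<not> dominates V x a \<and> \<not> dominates V a x" for x a
  let ?p = "\<lambda>x. \<exists>a. eq x a"
  define r where "r x = (SOME a. eq x a)" for x
  have r: "eq x (r x)" if "?p x" for x using that unfolding r_def by (rule someI_ex)
  let ?ys = "map r (filter ?p xs)" and ?S = "filter (\<lambda>x. \<not> ?p x) xs"
  have rr: "dominates V (r x) (r y)" if x: "x \<in> set xs" "?p x" and y: "y \<in> set xs" "?p y" and d: "dominates V x y" for x y
  proof (rule ccontr)
    note ex = r[OF x(2), unfolded eq_def] and ey = r[OF y(2), unfolded eq_def]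
    assume n: "\<not> dominates V (r x) (r y)"
    note t = not_dominates_trans[OF V]
    have "\<not> dominates V x (r y)"
      by (rule t[of x "r x"]) (use ex ey n xsN[OF x(1)] inQ in auto)
    then have "\<not> dominates V x y"
      by (rule t[of x "r y", rotated -2]) (use ex ey xsN[OF x(1)] xsN[OF y(1)] inQ in auto)
    then show False using d by blast
  qed
  have "lexchain V (filter ?p xs)" by (rule lexchain_filter[OF xs])
  then have "sorted_wrt (dominates V) (filter ?p xs)" by (simp add: lexchain_def)
  then have "sorted_wrt (\<lambda>x y. dominates V (r x) (r y)) (filter ?p xs)"
    by (rule sorted_wrt_mono_rel[rotated]) (use rr in auto)
  then have ys: "lexchain V ?ys" "set ?ys \<subseteq> F"
    using r unfolding lexchain_def eq_def by (auto simp: sorted_wrt_map)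
  have lS: "lexchain V ?S" by (rule lexchain_filter[OF xs])
  have "sorted_wrt (dominates V) xs" using xs by (simp add: lexchain_def)
  then have "sorted_wrt (\<noteq>) xs"
    by (rule sorted_wrt_mono_rel[rotated]) (use dominates_irrefl[OF V] xsN inQ in blast)
  then have dist: "distinct ?S" by (induct xs) auto
  have Sc: "set ?S \<subseteq> carrier R" using xsN(1) inQ Qc by auto
  have cmp: "dominates V x a \<or> dominates V a x"
    if "x \<in> set ?S" "a \<in> F" "a \<in> nonunits V" "a \<noteq> \<zero>" for x a
    using that unfolding eq_def by auto
  have mv: "monomial_value m = list_monomial ?S (count m)" if "set_mset m \<subseteq> set ?S" for m
    using monomial_value_superset[OF _ that Sc] list_monomial_eq[OF dist Sc] by simp
  note Fc = subfieldE(3)[OF F(1)] and Fr = subfieldE(1)[OF F(1)]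
  have "alg_independent R F (set ?S)" unfolding alg_independent_iff
  proof (intro conjI allI impI)
    show "set ?S \<subseteq> carrier R" by fact
    fix E c
    assume E: "finite E" "\<forall>m\<in>E. set_mset m \<subseteq> set ?S \<and> c m \<in> F"
      and z: "(\<Oplus>m\<in>E. c m \<otimes> monomial_value m) = \<zero>"
    show "\<forall>m\<in>E. c m = \<zero>"
    proof (rule ccontr)
      assume nz: "\<not> ?thesis"
      define E' where "E' = {m \<in> E. c m \<noteq> \<zero>}"
      have E': "finite E'" "E' \<noteq> {}" using E(1) nz by (auto simp: E'_def)
      have lm: "list_monomial ?S (count m) \<in> V" "list_monomial ?S (count m) \<noteq> \<zero>" for m
        using list_monomial_props(1)[OF V lS] by auto
      have lc: "list_monomial ?S (count m) \<in> carrier R" for m using lm Vc by blast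
      have cc: "c m \<in> carrier R" if "m \<in> E" for m using that E(2) Fc by blast
      let ?f = "\<lambda>m. c m \<otimes> list_monomial ?S (count m)"
      have "(\<Oplus>m\<in>E'. ?f m) = (\<Oplus>m\<in>E. c m \<otimes> monomial_value m)"
      proof (rule add.finprod_mono_neutral_cong_left[OF E(1)])
        show "E' \<subseteq> E" by (auto simp: E'_def)
        show "c m \<otimes> monomial_value m = \<zero>" if "m \<in> E - E'" for m
          using that mv[of m] E(2) lc by (auto simp: E'_def)
        show "?f m = c m \<otimes> monomial_value m" if "m \<in> E'" for m
          using that mv[of m] E(2) by (auto simp: E'_def)
        show "(\<lambda>m. c m \<otimes> monomial_value m) \<in> E \<rightarrow> carrier R" using mv E(2) lc cc by auto
      qed
      then have z': "(\<Oplus>m\<in>E'. ?f m) = \<zero>" using z by simp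
      have "\<exists>m\<in>E'. \<exists>u. u \<in> V \<and> u \<notin> nonunits V \<and> (\<Oplus>m\<in>E'. ?f m) = ?f m \<otimes> u"
      proof (rule sum_distinct_values[OF V E'])
        fix m assume m: "m \<in> E'"
        then have "c m \<in> Q" "c m \<noteq> \<zero>" "c m \<in> carrier R" using E(2) F(2) cc by (auto simp: E'_def)
        then show "?f m \<in> Q \<and> ?f m \<noteq> \<zero>"
          using subringE(6)[OF subfieldE(1)[OF sQ], of "c m"] lm[of m] lc[of m] VQ by (auto simp: integral_iff)
      next
        fix m n u assume mn: "m \<in> E'" "n \<in> E'" "m \<noteq> n" and u: "u \<in> V" "u \<notin> nonunits V"
        have cm: "c m \<in> F" "c n \<in> F" "c m \<noteq> \<zero>" "c n \<noteq> \<zero>" using mn E(2) by (auto simp: E'_def)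
        then have cmc: "c m \<in> carrier R" "c n \<in> carrier R" "inv (c m) \<in> carrier R" "u \<in> carrier R"
          using Fc u Vc by auto
        have "\<exists>z\<in>set ?S. count m z \<noteq> count n z"
        proof (rule ccontr)
          assume "\<not> ?thesis"
          moreover have "set_mset m \<subseteq> set ?S" "set_mset n \<subseteq> set ?S" using mn E(2) by (auto simp: E'_def)
          ultimately have "m = n" by (intro multiset_eqI) (metis not_in_iff subsetD)
          then show False using mn by blast
        qed
        then obtain w where w: "w \<in> set ?S" "count m w \<noteq> count n w" by blast
        have i: "inv (c m) \<otimes> c n \<in> F" using subringE(6)[OF Fr subfield_inv[OF F(1) cm(1,3)] cm(2)] .
        have inz: "inv (c m) \<otimes> c n \<noteq> \<zero>" using cm cmc by (simp add: integral_iff)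
        have ne: "list_monomial ?S (count m) \<noteq> (inv (c m) \<otimes> c n) \<otimes> list_monomial ?S (count n) \<otimes> u"
          by (rule monomials_distinct_values[OF V F lS cmp, where z = w and e = "count m" and e' = "count n"])
             (use w i inz u in auto)
        show "?f m \<noteq> ?f n \<otimes> u"
        proof
          assume "?f m = ?f n \<otimes> u"
          then have "inv (c m) \<otimes> ?f m = inv (c m) \<otimes> (?f n \<otimes> u)" by simp
          then show False using ne cm cmc lc by (simp add: m_assoc)
        qed
      qed
      then obtain m u where m: "m \<in> E'" "u \<in> V" "u \<notin> nonunits V" "?f m \<otimes> u = \<zero>" using z' by metis
      have "c m \<in> carrier R" "c m \<noteq> \<zero>" "u \<noteq> \<zero>" "u \<in> carrier R"
        using m cc zero_in_nonunits[OF sV] Vc by (auto simp: E'_def)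
      then show False using m(4) lm[of m] lc[of m] by (simp add: integral_iff)
    qed
  qed
  moreover have "length ?ys + card (set ?S) = length xs"
    using distinct_card[OF dist] sum_length_filter_compl[of ?p xs] by simp
  ultimately show ?thesis using ys by (intro exI[of _ ?ys] exI[of _ "set ?S"]) auto
qed

lemma valring_restrict:
  assumes V: "valring Q V" and F: "subfield F R" "F \<subseteq> Q"
  shows "valring F (V \<inter> F)" "nonunits (V \<inter> F) = nonunits V \<inter> F"
    "lexchain V ys \<Longrightarrow> set ys \<subseteq> F \<Longrightarrow> lexchain (V \<inter> F) ys"
proof -
  have sV: "subring V R" using V by (rule valringD)
  note Fr = subfieldE(1)[OF F(1)] and Fc = subfieldE(3)[OF F(1)]
  show "valring F (V \<inter> F)" unfolding valring_def
    using F(1) subring_inter[OF sV Fr] valringD(6)[OF V] F(2) subfield_inv[OF F(1)] by blast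
  show 1: "nonunits (V \<inter> F) = nonunits V \<inter> F"
    unfolding nonunits_def using subfield_inv[OF F(1)] by blast
  show "lexchain (V \<inter> F) ys" if ys: "lexchain V ys" "set ys \<subseteq> F"
    unfolding lexchain_def
  proof
    show "set ys \<subseteq> nonunits (V \<inter> F) - {\<zero>}" using ys 1 by (auto simp: lexchain_def)
    have "sorted_wrt (dominates V) ys" using ys by (simp add: lexchain_def)
    then show "sorted_wrt (dominates (V \<inter> F)) ys"
    proof (rule sorted_wrt_mono_rel[rotated])
      fix x y assume xy: "x \<in> set ys" "y \<in> set ys" "dominates V x y"
      have "x \<otimes> inv (y [^] n) \<in> F" for n :: nat
      proof -
        have y: "y \<in> F" "y \<noteq> \<zero>" "y \<in> carrier R" "x \<in> F" using xy ys Fc by (auto simp: lexchain_def)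
        have "inv (y [^] n) \<in> F" using subfield_inv[OF F(1) subring_pow[OF Fr y(1)]] y by simp
        then show ?thesis using subringE(6)[OF Fr y(4)] by blast
      qed
      then show "dominates (V \<inter> F) x y" using xy(3) unfolding dominates_def 1 by blast
    qed
  qed
qed

end

section \<open>Pullbacks along a residue map\<close>

lemma enat_le_plus_iff:
  "enat n \<le> a + b \<longleftrightarrow> (\<exists>i j. n = i + j \<and> enat i \<le> a \<and> enat j \<le> b)"
proof
  assume n: "enat n \<le> a + b"
  show "\<exists>i j. n = i + j \<and> enat i \<le> a \<and> enat j \<le> b"
  proof (cases "a = \<infinity>")
    case True
    then show ?thesis by (intro exI[of _ n] exI[of _ 0]) (simp add: zero_enat_def[symmetric])
  next
    case False
    then obtain p where p: "a = enat p" by auto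
    have "enat (n - min n p) \<le> b" using n p by (cases b) auto
    then show ?thesis using p by (intro exI[of _ "min n p"] exI[of _ "n - min n p"]) auto
  qed
next
  assume "\<exists>i j. n = i + j \<and> enat i \<le> a \<and> enat j \<le> b"
  then show "enat n \<le> a + b" by (metis add_mono plus_enat_simps(1))
qed

text \<open>Used to see that, in a ring with a single maximal ideal \<open>M\<close>, the elements outside of \<open>M\<close> are units.\<close>

lemma (in field) exists_maximalideal_containing:
  assumes T: "subring T R" and t: "t \<in> T" and n: "t = \<zero> \<or> inv t \<notin> T"
  shows "\<exists>N. maximalideal N (R\<lparr>carrier := T\<rparr>) \<and> t \<in> N"
proof -
  note Tc = subringE(1)[OF T]
  have tc: "t \<in> carrier R" using t Tc by blast
  interpret RT: cring "R\<lparr>carrier := T\<rparr>"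
    using subcringI'[OF T] subcring_iff[OF Tc] by blast
  define S where "S = {I. ideal I (R\<lparr>carrier := T\<rparr>) \<and> t \<in> I \<and> \<one> \<notin> I}"
  let ?P = "PIdl\<^bsub>R\<lparr>carrier := T\<rparr>\<^esub> t"
  have "\<one> \<notin> ?P"
  proof
    assume "\<one> \<in> ?P"
    then obtain x where x: "x \<in> T" "\<one> = x \<otimes> t" by (auto simp: cgenideal_def)
    have xc: "x \<in> carrier R" using x Tc by blast
    have "t \<noteq> \<zero>" using x xc by auto
    moreover have "inv t = x" by (rule field_inv_unique) (use x xc tc m_comm in auto)
    ultimately show False using n x by simp
  qed
  then have P: "?P \<in> S"
    using RT.cgenideal_ideal[of t] RT.cgenideal_self[of t] t by (simp add: S_def)
  have "\<exists>N\<in>S. \<forall>Z\<in>S. N \<subseteq> Z \<longrightarrow> Z = N"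
  proof (rule subset_Zorn_nonempty)
    show "S \<noteq> {}" using P by blast
    fix C assume C: "C \<noteq> {}" "subset.chain S C"
    have CS: "C \<subseteq> S" using C by (auto simp: subset.chain_def)
    have "subset.chain {I. ideal I (R\<lparr>carrier := T\<rparr>)} C"
      using C CS by (auto simp: subset.chain_def S_def)
    then have "ideal (\<Union>C) (R\<lparr>carrier := T\<rparr>)" using RT.chain_Union_is_ideal[of C] C(1) by simp
    moreover have "t \<in> \<Union>C" "\<one> \<notin> \<Union>C" using C(1) CS by (auto simp: S_def)
    ultimately show "\<Union>C \<in> S" by (simp add: S_def)
  qed
  then obtain N where N: "N \<in> S" "\<And>Z. Z \<in> S \<Longrightarrow> N \<subseteq> Z \<Longrightarrow> Z = N" by blast
  have id: "ideal N (R\<lparr>carrier := T\<rparr>)" "t \<in> N" "\<one> \<notin> N" using N by (auto simp: S_def)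
  have "maximalideal N (R\<lparr>carrier := T\<rparr>)"
  proof (rule maximalidealI[OF id(1)])
    show "carrier (R\<lparr>carrier := T\<rparr>) \<noteq> N" using id(3) subringE(3)[OF T] by auto
    fix J assume J: "ideal J (R\<lparr>carrier := T\<rparr>)" "N \<subseteq> J" "J \<subseteq> carrier (R\<lparr>carrier := T\<rparr>)"
    show "J = N \<or> J = carrier (R\<lparr>carrier := T\<rparr>)"
    proof (cases "\<one> \<in> J")
      case True then show ?thesis using ideal.one_imp_carrier[OF J(1)] by simp
    next
      case False
      then have "J \<in> S" using J id(2) by (auto simp: S_def)
      then show ?thesis using N(2) J(2) by blast
    qed
  qed
  then show ?thesis using id(2) by blast
qed

locale pullback = residue_field K k T M \<phi>
  for K :: "('a, 'm) ring_scheme" (structure) and k :: "('b, 'n) ring_scheme" and T M :: "'a set" and \<phi> :: "'a \<Rightarrow> 'b" +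
  fixes D :: "'b set"
  assumes D: "subring D k" and D_proper: "D \<noteq> carrier k" and M_nonzero: "M \<noteq> {\<zero>}"
begin

text \<open>The pullback of \<open>D\<close> along the residue map.\<close>

definition A :: "'a set" where "A = {t \<in> T. \<phi> t \<in> D}"

abbreviation Q :: "'a set" where "Q \<equiv> quot_field K T"
abbreviation F :: "'b set" where "F \<equiv> quot_field k D"

lemma A_subring: "subring A K"
  unfolding A_def by (rule pullback_subring[OF D])

lemma M_A: "M \<subseteq> A"
proof
  fix m assume m: "m \<in> M"
  then have "m \<in> T" "\<phi> m = \<zero>\<^bsub>k\<^esub>" using M_subset phi_zero_iff by auto
  then show "m \<in> A" using subringE(2)[OF D] by (simp add: A_def)
qed

lemma A_T: "A \<subseteq> T" by (auto simp: A_def)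

lemma D_carrier: "D \<subseteq> carrier k" by (rule subringE(1)[OF D])

lemma F_subfield: "subfield F k" by (rule k.quot_field_subfield[OF D])

lemma T_Q: "T \<subseteq> Q" by (rule K.quot_field_incl[OF T])

lemma obtain_M: obtains m where "m \<in> M" "m \<noteq> \<zero>" "m \<in> T" "m \<in> carrier K"
  using M_nonzero zero_in_M M_subset T_carrier by blast

text \<open>Multiplication by a nonzero element of \<open>M\<close> maps \<open>T\<close> into \<open>M \<subseteq> A\<close>.\<close>

lemma quot_field_A: "quot_field K A = Q"
proof (rule K.quot_field_eqI[OF A_subring T A_T, symmetric])
  show "T \<subseteq> quot_field K A"
  proof
    fix t assume t: "t \<in> T"
    obtain m where m: "m \<in> M" "m \<noteq> \<zero>" "m \<in> T" "m \<in> carrier K" by (rule obtain_M)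
    have "t \<otimes> m \<in> A" using M_closed(1)[OF t m(1)] M_A by blast
    then have "(t \<otimes> m) \<otimes> inv m \<in> quot_field K A" using K.quot_field_memI m M_A by blast
    then show "t \<in> quot_field K A" using t T_carrier m by (simp add: K.m_assoc subset_iff)
  qed
qed

lemma image_A: "d \<in> D \<Longrightarrow> \<exists>a\<in>A. \<phi> a = d"
proof -
  assume "d \<in> D"
  then have "d \<in> \<phi> ` T" using D_carrier phi_surj by blast
  then show ?thesis using \<open>d \<in> D\<close> by (auto simp: A_def)
qed

text \<open>If \<open>us\<close> were contained in \<open>M\<close>, then \<open>t us \<subseteq> M \<subseteq> A\<close> for every \<open>t \<in> T\<close>, and so \<open>T \<subseteq> A\<close>.\<close>

lemma gv_set_not_in_M:
  assumes "K.gv_set A us"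
  shows "\<not> us \<subseteq> M"
proof
  assume u: "us \<subseteq> M"
  obtain x where "x \<in> carrier k" "x \<notin> D" using D_proper D_carrier by blast
  moreover from this have "x \<in> \<phi> ` T" using phi_surj by blast
  ultimately obtain t where t: "t \<in> T" "\<phi> t \<notin> D" by blast
  have "\<forall>u\<in>us. t \<otimes> u \<in> A" using M_closed(1)[OF t(1)] u M_A by blast
  then have "t \<in> A" using assms t(1) T_Q by (auto simp: K.gv_set_def quot_field_A)
  then show False using t by (simp add: A_def)
qed

text \<open>One of the generators is a unit of \<open>T\<close>, so \<open>x us \<subseteq> A\<close> forces \<open>x \<in> T\<close>. For such \<open>x\<close> both conditions
  say the same about the residue of \<open>x\<close>.\<close>

lemma gv_set_pullback:
  assumes us: "finite us" "us \<subseteq> A"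
  shows "K.gv_set A us \<longleftrightarrow> k.gv_set D (\<phi> ` us)"
proof
  assume gv: "K.gv_set A us"
  obtain u where u: "u \<in> us" "u \<notin> M" using gv_set_not_in_M[OF gv] by blast
  then have "\<phi> u \<noteq> \<zero>\<^bsub>k\<^esub>" using phi_zero_iff us A_T by blast
  moreover have "\<phi> ` us \<subseteq> D" using us by (auto simp: A_def)
  moreover have "x \<in> D" if x: "x \<in> F" "\<forall>v\<in>\<phi> ` us. x \<otimes>\<^bsub>k\<^esub> v \<in> D" for x
  proof -
    have "x \<in> \<phi> ` T" using x k.quot_field_carrier[OF D] phi_surj by blast
    then obtain t where t: "t \<in> T" "x = \<phi> t" by blast
    have "t \<otimes> v \<in> A" if v: "v \<in> us" for v
    proof -
      have vT: "v \<in> T" using v us A_T by blast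
      have "\<phi> (t \<otimes> v) \<in> D" using phi_mult[OF t(1) vT] x(2) v t(2) by simp
      then show ?thesis using subringE(6)[OF T t(1) vT] by (simp add: A_def)
    qed
    then have "t \<in> A" using gv t T_Q by (auto simp: K.gv_set_def quot_field_A)
    then show "x \<in> D" using t by (simp add: A_def)
  qed
  ultimately show "k.gv_set D (\<phi> ` us)" unfolding k.gv_set_def using us(1) u(1) by blast
next
  assume gv: "k.gv_set D (\<phi> ` us)"
  then obtain u where u: "u \<in> us" "\<phi> u \<noteq> \<zero>\<^bsub>k\<^esub>" by (auto simp: k.gv_set_def)
  have uT: "u \<in> T" "u \<in> A" using u us A_T by auto
  have uM: "u \<notin> M" using u phi_zero_iff uT by blast
  note ud = unitD[OF uT(1) uM]
  have "x \<in> A" if x: "x \<in> quot_field K A" "\<forall>v\<in>us. x \<otimes> v \<in> A" for x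
  proof -
    have xc: "x \<in> carrier K" using x K.quot_field_carrier[OF A_subring] by blast
    have "x \<otimes> u \<in> T" using x(2) u(1) A_T by blast
    then have "(x \<otimes> u) \<otimes> inv u \<in> T" using subringE(6)[OF T _ ud(2)] by blast
    then have xT: "x \<in> T" using xc ud by (simp add: K.m_assoc)
    have d: "\<phi> x \<otimes>\<^bsub>k\<^esub> v \<in> D" if v: "v \<in> \<phi> ` us" for v
    proof -
      obtain w where w: "w \<in> us" "v = \<phi> w" using v by blast
      then have "w \<in> T" using us A_T by blast
      then show ?thesis using x(2) w phi_mult[OF xT] by (auto simp: A_def)
    qed
    have "(\<phi> x \<otimes>\<^bsub>k\<^esub> \<phi> u) \<otimes>\<^bsub>k\<^esub> inv\<^bsub>k\<^esub> \<phi> u \<in> F"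
      by (rule k.quot_field_memI) (use d u uT in \<open>auto simp: A_def\<close>)
    then have "\<phi> x \<in> F" using xT uT u by (simp add: k.m_assoc)
    then have "\<phi> x \<in> D" using gv d by (auto simp: k.gv_set_def)
    then show "x \<in> A" using xT by (simp add: A_def)
  qed
  moreover have "\<not> us \<subseteq> {\<zero>}" using u(1) ud(1) by blast
  ultimately show "K.gv_set A us" unfolding K.gv_set_def using us by blast
qed

lemma gv_set_lift:
  assumes "k.gv_set D vs" "B \<subseteq> A" "vs \<subseteq> \<phi> ` B"
  obtains us where "us \<subseteq> B" "\<phi> ` us = vs" "K.gv_set A us"
proof -
  have "finite vs" using assms(1) by (simp add: k.gv_set_def)
  then obtain us where us: "us \<subseteq> B" "finite us" "vs = \<phi> ` us" using finite_subset_image[OF _ assms(3)] by blast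
  then have "K.gv_set A us" using gv_set_pullback[of us] assms by auto
  then show ?thesis using that us by blast
qed

section \<open>The \<open>w\<close>-valuative dimension of a pullback\<close>

lemma w_val_dim_lower:
  assumes i: "enat i \<le> w_val_dim k D" and j: "enat j \<le> val_dim K T" and l: "enat l \<le> trans_degree k F"
  shows "enat (i + j + l) \<le> w_val_dim K A"
proof -
  obtain W ws where W: "w_valuation_overring k D W" and ws: "k.lexchain W ws" "length ws = i"
    using i unfolding k.w_val_dim_ge_iff[OF D] by blast
  have Wv: "k.valring F W" "D \<subseteq> W" "\<And>vs. k.gv_set D vs \<Longrightarrow> \<not> vs \<subseteq> k.nonunits W"
    using W unfolding k.w_valuation_overring_iff[OF D] by auto
  obtain U0 us where U0: "K.valring Q U0" "T \<subseteq> U0" "K.lexchain U0 us" "length us = j"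
    using j unfolding K.val_dim_ge_iff[OF T] by blast
  obtain S where S: "finite S" "alg_independent k F S" "card S = l"
    using l k.trans_degree_ge_iff[OF k.quot_field_carrier[OF D]] by blast
  obtain U where U: "K.valring Q U" "T \<subseteq> U" "M \<subseteq> K.nonunits U" "K.nonunits U0 \<subseteq> K.nonunits U"
    using dominating_valring[OF U0(1,2)] by blast
  have usU: "K.lexchain U us" by (rule K.lexchain_mono[OF U0(3) U(4)])
  obtain W' zs where W': "k.valring (carrier k) W'" "W \<subseteq> W'" "k.nonunits W \<subseteq> k.nonunits W'"
      "k.lexchain W' zs" "length zs = length ws + card S"
    using k.valuation_extension[OF S(1) Wv(1) ws(1) S(2)] by (elim exE conjE) (rule that)
  obtain V where V: "K.valring Q V" "K.nonunits U \<subseteq> K.nonunits V" "{t \<in> T. \<phi> t \<in> W'} \<subseteq> V" "compatible V W'"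
    by (rule composite_valring[OF U(1,2) W'(1)])
  obtain xs where xs: "K.lexchain V xs" "length xs = length us + length zs"
    using composite_lexchain[OF U(1,2) V(2,4) W'(1) usU W'(4)] by blast
  have "A \<subseteq> V" using V(3) Wv(2) W'(2) by (auto simp: A_def)
  moreover have "\<not> us \<subseteq> K.nonunits V" if us: "K.gv_set A us" for us
  proof -
    have us': "finite us" "us \<subseteq> A" using us by (auto simp: K.gv_set_def)
    then have "k.gv_set D (\<phi> ` us)" using gv_set_pullback us by blast
    then obtain u where u: "u \<in> us" "\<phi> u \<notin> k.nonunits W" using Wv(3) by blast
    have uA: "u \<in> T" "\<phi> u \<in> W" using u us' Wv(2) by (auto simp: A_def)
    have "inv\<^bsub>k\<^esub> (\<phi> u) \<in> W'" "\<phi> u \<noteq> \<zero>\<^bsub>k\<^esub>"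
      using k.not_nonunit[OF k.valringD(2)[OF Wv(1)] uA(2) u(2)] W'(2) by auto
    then have "\<phi> u \<notin> k.nonunits W'" by (auto simp: k.nonunits_def)
    then have "u \<notin> K.nonunits V" using V(4) uA by (simp add: compatible_def)
    then show ?thesis using u by blast
  qed
  ultimately have "w_valuation_overring K A V"
    unfolding K.w_valuation_overring_iff[OF A_subring] quot_field_A using V(1) by blast
  moreover have "length xs = i + j + l" using xs(2) W'(5) ws U0(4) S(3) by simp
  ultimately show ?thesis unfolding K.w_val_dim_ge_iff[OF A_subring] using xs(1) by blast
qed

text \<open>The products \<open>v t\<close> are closed under addition, because of two of them one divides the other in \<open>V\<close>.
  The center of \<open>U\<close> on \<open>T\<close> is still \<open>M\<close>: an equation \<open>1 = v t m\<close> with \<open>m \<in> M\<close> is impossible since \<open>t m \<in> M\<close> is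
  a nonunit of \<open>V\<close>.\<close>

lemma product_overring:
  assumes V: "K.valring Q V" "A \<subseteq> V" "M \<subseteq> K.nonunits V"
  obtains U where "K.valring Q U" "T \<subseteq> U" "V \<subseteq> U" "M \<subseteq> K.nonunits U"
proof -
  have sV: "subring V K" and sQ: "subfield Q K" using V(1) by (rule K.valringD)+
  note VQ = K.valringD(3)[OF V(1)] and Vc = K.valringD(5)[OF V(1)] and Qc = K.valringD(4)[OF V(1)]
  note Qr = subfieldE(1)[OF sQ]
  define U where "U = {v \<otimes> t | v t. v \<in> V \<and> t \<in> T}"
  have UI: "v \<otimes> t \<in> U" if "v \<in> V" "t \<in> T" for v t using that unfolding U_def by blast
  have UE: "\<exists>v t. x = v \<otimes> t \<and> v \<in> V \<and> t \<in> T \<and> v \<in> carrier K \<and> t \<in> carrier K" if x: "x \<in> U" for x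
    using x Vc T_carrier unfolding U_def by blast
  have VU: "V \<subseteq> U"
  proof
    fix v assume v: "v \<in> V"
    then have "v \<in> carrier K" using Vc by blast
    then show "v \<in> U" using UI[OF v subringE(3)[OF T]] by simp
  qed
  have TU: "T \<subseteq> U"
  proof
    fix t assume t: "t \<in> T"
    then have "t \<in> carrier K" using T_carrier by blast
    then show "t \<in> U" using UI[OF subringE(3)[OF sV] t] by simp
  qed
  have UQ: "U \<subseteq> Q"
  proof
    fix x assume "x \<in> U"
    then obtain v t where "x = v \<otimes> t" "v \<in> V" "t \<in> T" using UE by blast
    then show "x \<in> Q" using subringE(6)[OF Qr] VQ T_Q by blast
  qed
  have add: "v \<otimes> t \<oplus> w \<otimes> s \<in> U"
    if x: "v \<in> V" "t \<in> T" "w \<in> V" "s \<in> T" and nz: "w \<otimes> s \<noteq> \<zero>" and d: "(v \<otimes> t) \<otimes> inv (w \<otimes> s) \<in> V" for v t w s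
  proof -
    let ?q = "(v \<otimes> t) \<otimes> inv (w \<otimes> s)"
    have c: "v \<in> carrier K" "t \<in> carrier K" "w \<in> carrier K" "s \<in> carrier K" using x Vc T_carrier by auto
    have qc: "?q \<in> carrier K" using d Vc by blast
    have "(w \<otimes> s) \<otimes> ?q = v \<otimes> t"
      using K.m_lcomm[of "w \<otimes> s" "v \<otimes> t" "inv (w \<otimes> s)"] K.field_r_inv[of "w \<otimes> s"] c nz
      by (simp del: K.field_inv_mult K.field_r_inv)
    then have "v \<otimes> t \<oplus> w \<otimes> s = (w \<otimes> s) \<otimes> ?q \<oplus> w \<otimes> s" by simp
    also have "\<dots> = (w \<otimes> (?q \<oplus> \<one>)) \<otimes> s" using c(3,4) qc by algebra
    finally show ?thesis
      using UI[OF subringE(6)[OF sV x(3) subringE(7)[OF sV d subringE(3)[OF sV]]] x(4)] by simp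
  qed
  have "subring U K"
  proof (rule K.subringI)
    show "U \<subseteq> carrier K" using UQ Qc by blast
    show "\<one> \<in> U" using VU subringE(3)[OF sV] by blast
    fix x assume "x \<in> U"
    then obtain v t where x: "x = v \<otimes> t" "v \<in> V" "t \<in> T" "v \<in> carrier K" "t \<in> carrier K" using UE by blast
    have "\<ominus> x = (\<ominus> v) \<otimes> t" using x by (simp add: K.l_minus)
    then show "\<ominus> x \<in> U" using UI[OF subringE(5)[OF sV x(2)] x(3)] by simp
    fix y assume yU: "y \<in> U"
    then obtain w s where y: "y = w \<otimes> s" "w \<in> V" "s \<in> T" "w \<in> carrier K" "s \<in> carrier K" using UE by blast
    have "x \<otimes> y = (v \<otimes> w) \<otimes> (t \<otimes> s)" unfolding x(1) y(1) using x(4,5) y(4,5) by algebra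
    then show "x \<otimes> y \<in> U" using UI[OF subringE(6)[OF sV x(2) y(2)] subringE(6)[OF T x(3) y(3)]] by simp
    show "x \<oplus> y \<in> U"
    proof (cases "x = \<zero> \<or> y = \<zero>")
      case True
      have "x \<in> carrier K" "y \<in> carrier K" using x y by auto
      then show ?thesis using True \<open>x \<in> U\<close> yU by auto
    next
      case False
      have xy: "x \<in> Q" "y \<in> Q" "x \<in> carrier K" "y \<in> carrier K" using \<open>x \<in> U\<close> yU UQ Qc by auto
      have q: "x \<otimes> inv y \<in> Q" using subringE(6)[OF Qr xy(1) K.subfield_inv[OF sQ xy(2)]] False by blast
      have "x \<otimes> inv y \<noteq> \<zero>" using False xy by (simp add: K.integral_iff)
      then have "x \<otimes> inv y \<in> V \<or> inv (x \<otimes> inv y) \<in> V" using K.valringD(6)[OF V(1) q] by blast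
      moreover have "inv (x \<otimes> inv y) = y \<otimes> inv x" using xy False by (simp add: K.m_comm)
      ultimately consider "x \<otimes> inv y \<in> V" | "y \<otimes> inv x \<in> V" by auto
      then show ?thesis
      proof cases
        case 1 then show ?thesis using add[OF x(2,3) y(2,3)] x(1) y(1) False by auto
      next
        case 2
        then have "y \<oplus> x \<in> U" using add[OF y(2,3) x(2,3)] x(1) y(1) False by auto
        then show ?thesis using xy by (simp add: K.a_comm)
      qed
    qed
  qed
  then have U: "K.valring Q U" using K.valring_overring(1)[OF V(1) _ VU UQ] by blast
  have "M \<subseteq> K.nonunits U"
  proof
    fix m assume m: "m \<in> M"
    then have mT: "m \<in> T" "m \<in> carrier K" using M_subset T_carrier by auto
    show "m \<in> K.nonunits U"
    proof (rule ccontr)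
      assume "m \<notin> K.nonunits U"
      then have nz: "m \<noteq> \<zero>" "inv m \<in> U" using mT TU by (auto simp: K.nonunits_def)
      obtain v t where vt: "inv m = v \<otimes> t" "v \<in> V" "t \<in> T" "v \<in> carrier K" "t \<in> carrier K" using UE[OF nz(2)] by blast
      have "\<one> = v \<otimes> (t \<otimes> m)"
        using K.field_l_inv[OF mT(2) nz(1)] vt mT by (simp add: K.m_assoc)
      moreover have "t \<otimes> m \<in> K.nonunits V" using M_closed(1)[OF vt(3) m] V(3) by blast
      ultimately have "\<one> \<in> K.nonunits V" using K.nonunits_mult(2)[OF sV _ vt(2)] by simp
      then show False using K.one_notin_nonunits[OF sV] by blast
    qed
  qed
  then show thesis using that U TU VU by blast
qed

text \<open>Inside the residue field \<open>\<kappa>\<close> of \<open>U = V T\<close>, the image \<open>?k\<close> of \<open>T\<close> is a copy of \<open>k\<close>. The part of \<open>xs\<close>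
  that consists of units of \<open>U\<close> is split over \<open>?k\<close>. The elements \<open>S\<close> that are independent over \<open>?k\<close> give a
  valuation of \<open>\<kappa>\<close> that is trivial on \<open>?k\<close>. Its composite with \<open>U\<close> contains \<open>T\<close> and has a lexchain that
  consists of the nonunits of \<open>U\<close> in \<open>xs\<close> and of \<open>card S\<close> further elements.\<close>

lemma split_over_T:
  assumes V: "K.valring Q V" "A \<subseteq> V" "M \<subseteq> K.nonunits V" and xs: "K.lexchain V xs"
  shows "\<exists>ts j. set ts \<subseteq> T - M \<and> K.lexchain V ts \<and> enat j \<le> val_dim K T \<and> length xs = length ts + j"
proof -
  obtain U where U: "K.valring Q U" "T \<subseteq> U" "V \<subseteq> U" "M \<subseteq> K.nonunits U"
    by (rule product_overring[OF V])
  have sU: "subring U K" and sV: "subring V K" using U(1) V(1) by (auto dest: K.valringD)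
  note UQ = K.valringD(3)[OF U(1)]
  have UV: "K.nonunits U \<subseteq> K.nonunits V" by (rule K.valring_overring(2)[OF V(1) sU U(3) UQ])
  define \<kappa> where "\<kappa> = (K\<lparr>carrier := U\<rparr>) Quot K.nonunits U"
  define \<psi> where "\<psi> = (\<lambda>x. K.nonunits U +>\<^bsub>K\<lparr>carrier := U\<rparr>\<^esub> x)"
  have "residue_field K \<kappa> U (K.nonunits U) \<psi>"
    unfolding \<kappa>_def \<psi>_def
    by (rule K.local_ring_residue_field[OF sU K.nonunits_maximalideal[OF U(1)] K.not_nonunit(2)[OF sU]])
  then interpret u: residue_field K \<kappa> U "K.nonunits U" \<psi> .
  let ?V = "\<psi> ` (V \<inter> U)"
  have Vb: "u.k.valring (carrier \<kappa>) ?V" "u.compatible V ?V"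
    using u.residue_valring[OF V(1) UQ UV] by auto
  let ?xa = "filter (\<lambda>x. x \<in> K.nonunits U) xs" and ?xr = "filter (\<lambda>x. x \<notin> K.nonunits U) xs"
  have xsV: "x \<in> K.nonunits V" "x \<noteq> \<zero>" "x \<in> V" "x \<in> U" "x \<in> carrier K" if "x \<in> set xs" for x
    using that xs K.nonunits_subset[of V] U(3) K.valringD(5)[OF V(1)] unfolding K.lexchain_def by blast+
  have xa: "K.lexchain U ?xa" unfolding K.lexchain_def
  proof
    show "set ?xa \<subseteq> K.nonunits U - {\<zero>}" using xsV by auto
    have "sorted_wrt (K.dominates V) ?xa" using K.lexchain_filter[OF xs] by (simp add: K.lexchain_def)
    then show "sorted_wrt (K.dominates U) ?xa"
    proof (rule sorted_wrt_mono_rel[rotated])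
      fix x y assume xy: "x \<in> set ?xa" "y \<in> set ?xa" "K.dominates V x y"
      have x: "x \<in> carrier K" and y: "y \<in> carrier K" "y \<noteq> \<zero>" "y \<in> K.nonunits U" using xy xsV by auto
      show "K.dominates U x y" unfolding K.dominates_def
      proof
        fix n :: nat
        \<comment> \<open>domination in \<open>V\<close> only puts the quotients into \<open>U\<close>; one more factor \<open>y\<close> makes them nonunits\<close>
        have "x \<otimes> inv (y [^] Suc n) \<in> U"
          using xy(3) K.nonunits_subset[of V] U(3) unfolding K.dominates_def by blast
        then have "y \<otimes> (x \<otimes> inv (y [^] Suc n)) \<in> K.nonunits U" by (rule K.nonunits_mult(1)[OF sU y(3)])
        moreover have "y \<otimes> (x \<otimes> inv (y [^] Suc n)) = x \<otimes> inv (y [^] n)"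
        proof -
          have ic: "inv y \<in> carrier K" using y by simp
          have "y \<otimes> (x \<otimes> (inv y [^] n \<otimes> inv y)) = x \<otimes> inv y [^] n \<otimes> (y \<otimes> inv y)"
            using x y(1) ic K.nat_pow_closed[OF ic, of n] by algebra
          then show ?thesis using x y ic by simp
        qed
        ultimately show "x \<otimes> inv (y [^] n) \<in> K.nonunits U" by simp
      qed
    qed
  qed
  have xr: "set ?xr \<subseteq> U - K.nonunits U" using xsV by auto
  have lr: "u.k.lexchain ?V (map \<psi> ?xr)"
    using u.compatible_lexchain[OF Vb(2) xr] K.lexchain_filter[OF xs] by blast
  let ?k = "\<psi> ` (T \<inter> U)"
  have k': "subfield ?k \<kappa>"
  proof (rule u.k.subfieldI'[OF u.image_subring[OF T]])
    fix y assume y: "y \<in> ?k - {\<zero>\<^bsub>\<kappa>\<^esub>}"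
    then obtain t where t: "t \<in> T" "t \<in> U" "y = \<psi> t" "\<psi> t \<noteq> \<zero>\<^bsub>\<kappa>\<^esub>" by blast
    have tn: "t \<notin> K.nonunits U" using u.phi_zero_iff[OF t(2)] t(4) by blast
    then have "t \<notin> M" using U(4) by blast
    then have it: "inv t \<in> T" using unitD[OF t(1)] by blast
    then have "\<psi> (inv t) \<in> ?k" using U(2) by blast
    then show "inv\<^bsub>\<kappa>\<^esub> y \<in> ?k" using u.unitD(5)[OF t(2) tn] t(3) by simp
  qed
  have kc: "?k \<subseteq> carrier \<kappa>" by (rule subfieldE(3)[OF k'])
  obtain bs S where bs: "set bs \<subseteq> ?k" "u.k.lexchain ?V bs" and S: "finite S" "alg_independent \<kappa> ?k S"
      and len: "length bs + card S = length (map \<psi> ?xr)"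
    using u.k.lexchain_split[OF Vb(1) k' kc lr] by (elim exE conjE) (rule that)
  obtain W zs where W: "u.k.valring (carrier \<kappa>) W" "?k \<subseteq> W" "u.k.lexchain W zs" "length zs = card S"
    using u.k.valuation_extension[OF S(1) u.k.trivial_valring(1)[OF k'] u.k.lexchain_Nil S(2)]
    by (elim exE conjE) (rule that, simp_all)
  obtain U' where U': "K.valring Q U'" "K.nonunits U \<subseteq> K.nonunits U'" "{t \<in> U. \<psi> t \<in> W} \<subseteq> U'" "u.compatible U' W"
    by (rule u.composite_valring[OF U(1) subset_refl W(1)])
  have "T \<subseteq> U'" using U'(3) U(2) W(2) by blast
  moreover obtain ys where "K.lexchain U' ys" "length ys = length ?xa + length zs"
    using u.composite_lexchain[OF U(1) subset_refl U'(2,4) W(1) xa W(3)] by blast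
  ultimately have j: "enat (length ?xa + card S) \<le> val_dim K T"
    unfolding K.val_dim_ge_iff[OF T] using U'(1) W(4) by metis
  have "\<exists>ts. set ts \<subseteq> T \<and> map \<psi> ts = bs" using bs(1)
  proof (induct bs)
    case Nil then show ?case by simp
  next
    case (Cons b bs)
    then obtain ts where "set ts \<subseteq> T" "map \<psi> ts = bs" by auto
    moreover obtain t where "t \<in> T" "\<psi> t = b" using Cons(2) by auto
    ultimately show ?case by (intro exI[of _ "t # ts"]) auto
  qed
  then obtain ts where ts: "set ts \<subseteq> T" "map \<psi> ts = bs" by blast
  have tn: "t \<notin> K.nonunits U" if "t \<in> set ts" for t
  proof -
    have "\<psi> t \<in> set bs" using ts(2) that by auto
    then have "\<psi> t \<noteq> \<zero>\<^bsub>\<kappa>\<^esub>" using bs(2) by (auto simp: u.k.lexchain_def)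
    moreover have "t \<in> U" using that ts(1) U(2) by blast
    ultimately show ?thesis using u.phi_zero_iff by blast
  qed
  then have "set ts \<subseteq> U - K.nonunits U" using ts(1) U(2) by blast
  then have "K.lexchain V ts" using u.compatible_lexchain[OF Vb(2)] ts(2) bs(2) by blast
  moreover have "set ts \<subseteq> T - M" using ts(1) tn U(4) by blast
  moreover have "length xs = length ts + (length ?xa + card S)"
    using len ts(2) sum_length_filter_compl[of "\<lambda>x. x \<in> K.nonunits U" xs] by auto
  ultimately show ?thesis using j by blast
qed

text \<open>If \<open>M\<close> is not contained in the maximal ideal of \<open>V\<close>, some \<open>m \<in> M\<close> is a unit of \<open>V\<close>, and \<open>t m \<in> A\<close> gives
  \<open>T \<subseteq> V\<close>. Otherwise \<open>V\<close> induces a valuation of \<open>k\<close>, whose restriction to \<open>F\<close> is a \<open>w\<close>-valuation overring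
  of \<open>D\<close> by lifting of generating sets.\<close>

lemma w_val_dim_upper:
  assumes n: "enat n \<le> w_val_dim K A"
  shows "\<exists>i j l. n = i + j + l \<and> enat i \<le> w_val_dim k D \<and> enat j \<le> val_dim K T \<and> enat l \<le> trans_degree k F"
proof -
  obtain V xs where V: "w_valuation_overring K A V" and xs: "K.lexchain V xs" "length xs = n"
    using n unfolding K.w_val_dim_ge_iff[OF A_subring] by blast
  have Vv: "K.valring Q V" "A \<subseteq> V" "\<And>us. K.gv_set A us \<Longrightarrow> \<not> us \<subseteq> K.nonunits V"
    using V unfolding K.w_valuation_overring_iff[OF A_subring] quot_field_A by auto
  have sV: "subring V K" using Vv(1) by (rule K.valringD)
  note Vc = K.valringD(5)[OF Vv(1)]
  show ?thesis
  proof (cases "M \<subseteq> K.nonunits V")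
    case False
    then obtain m where m: "m \<in> M" "m \<notin> K.nonunits V" by blast
    have mV: "m \<in> V" "m \<in> carrier K" using m M_A Vv(2) Vc by auto
    note mu = K.not_nonunit[OF sV mV(1) m(2)]
    have "T \<subseteq> V"
    proof
      fix t assume t: "t \<in> T"
      have "t \<otimes> m \<in> V" using M_closed(1)[OF t m(1)] M_A Vv(2) by blast
      then have "(t \<otimes> m) \<otimes> inv m \<in> V" using subringE(6)[OF sV _ mu(2)] by blast
      then show "t \<in> V" using t T_carrier mV mu by (simp add: K.m_assoc subset_iff)
    qed
    then have "enat n \<le> val_dim K T" unfolding K.val_dim_ge_iff[OF T] using Vv(1) xs by blast
    then show ?thesis by (intro exI[of _ 0] exI[of _ n]) (simp add: zero_enat_def[symmetric])
  next
    case True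
    obtain ts j where ts: "set ts \<subseteq> T - M" "K.lexchain V ts" "enat j \<le> val_dim K T" "length xs = length ts + j"
      using split_over_T[OF Vv(1,2) True xs(1)] by (elim exE conjE) (rule that)
    let ?W = "\<phi> ` (V \<inter> T)"
    have W: "k.valring (carrier k) ?W" "compatible V ?W"
      using residue_valring[OF Vv(1) T_Q True] by auto
    have lW: "k.lexchain ?W (map \<phi> ts)" using compatible_lexchain[OF W(2) ts(1)] ts(2) by blast
    note Fc = subfieldE(3)[OF F_subfield]
    obtain ys S where ys: "set ys \<subseteq> F" "k.lexchain ?W ys" and S: "finite S" "alg_independent k F S"
       and len: "length ys + card S = length (map \<phi> ts)"
      using k.lexchain_split[OF W(1) F_subfield Fc lW] by (elim exE conjE) (rule that)
    note r = k.valring_restrict[OF W(1) F_subfield Fc]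
    have DW: "D \<subseteq> ?W \<inter> F"
    proof
      fix d assume d: "d \<in> D"
      obtain a where "a \<in> A" "\<phi> a = d" using image_A[OF d] by blast
      then show "d \<in> ?W \<inter> F" using Vv(2) A_T k.quot_field_incl[OF D] d by blast
    qed
    have "\<not> vs \<subseteq> k.nonunits (?W \<inter> F)" if vs: "k.gv_set D vs" for vs
    proof -
      have "vs \<subseteq> \<phi> ` A" using vs image_A by (force simp: k.gv_set_def)
      then obtain us where us: "us \<subseteq> A" "\<phi> ` us = vs" "K.gv_set A us" by (rule gv_set_lift[OF vs subset_refl])
      obtain u where u: "u \<in> us" "u \<notin> K.nonunits V" using Vv(3)[OF us(3)] by blast
      then have "\<phi> u \<notin> k.nonunits ?W" using W(2) us(1) A_T by (auto simp: compatible_def)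
      then show ?thesis using u(1) us(2) r(2) by blast
    qed
    then have "w_valuation_overring k D (?W \<inter> F)"
      unfolding k.w_valuation_overring_iff[OF D] using r(1) DW by blast
    then have "enat (length ys) \<le> w_val_dim k D"
      unfolding k.w_val_dim_ge_iff[OF D] using r(3)[OF ys(2,1)] by blast
    moreover have "enat (card S) \<le> trans_degree k F"
      using k.trans_degree_ge_iff[OF Fc] S by blast
    moreover have "n = length ys + j + card S" using len ts(4) xs(2) by simp
    ultimately show ?thesis using ts(3) by blast
  qed
qed

theorem w_val_dim_pullback: "w_val_dim K A = w_val_dim k D + val_dim K T + trans_degree k F"
proof (rule antisym; rule enat_le_if_all)
  fix n assume "enat n \<le> w_val_dim K A"
  then show "enat n \<le> w_val_dim k D + val_dim K T + trans_degree k F"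
    using w_val_dim_upper[of n] by (metis add_mono plus_enat_simps(1))
next
  fix n assume "enat n \<le> w_val_dim k D + val_dim K T + trans_degree k F"
  then show "enat n \<le> w_val_dim K A"
    unfolding enat_le_plus_iff using w_val_dim_lower by blast
qed

section \<open>The \<open>w\<close>-dimension of a pullback\<close>

lemma prime_T_subset_M:
  assumes "primeideal P (K\<lparr>carrier := T\<rparr>)"
  shows "P \<subseteq> M"
proof
  note PD = K.primeidealD[OF T assms]
  fix p assume p: "p \<in> P"
  show "p \<in> M"
  proof (rule ccontr)
    assume n: "p \<notin> M"
    have pT: "p \<in> T" using p PD(1) by blast
    note u = unitD[OF pT n]
    have "inv p \<otimes> p \<in> P" by (rule PD(4)[OF u(2) p])
    then show False using u PD(5) by simp
  qed
qed

text \<open>For a prime \<open>P \<subset> M\<close> of \<open>A\<close>, choose \<open>m \<in> M\<close> outside of \<open>P\<close>: from \<open>m (t p) = (t m) p \<in> P\<close> follows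
  \<open>t p \<in> P\<close>, so \<open>P\<close> is even an ideal of \<open>T\<close>. Elements of \<open>T\<close> outside of \<open>M\<close> are units.\<close>

lemma prime_below_M_iff:
  assumes PM: "P \<subseteq> M"
  shows "primeideal P (K\<lparr>carrier := A\<rparr>) \<longleftrightarrow> primeideal P (K\<lparr>carrier := T\<rparr>)"
proof
  assume P: "primeideal P (K\<lparr>carrier := T\<rparr>)"
  note PD = K.primeidealD[OF T P]
  have AT: "a \<in> T" if "a \<in> A" for a using that A_T by blast
  have PA: "P \<subseteq> A" using PM M_A by (rule subset_trans)
  show "primeideal P (K\<lparr>carrier := A\<rparr>)" unfolding K.primeideal_subring_iff[OF A_subring]
    using PA PD(2,3,5) PD(4)[OF AT] PD(6)[OF AT AT] by (intro conjI ballI impI)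
next
  assume P: "primeideal P (K\<lparr>carrier := A\<rparr>)"
  note PD = K.primeidealD[OF A_subring P]
  have mult: "t \<otimes> p \<in> P" if t: "t \<in> T" and p: "p \<in> P" for t p
  proof (cases "P = M")
    case True then show ?thesis using M_closed(1) t p by blast
  next
    case False
    then obtain m where m: "m \<in> M" "m \<notin> P" using PM by blast
    have pM: "p \<in> M" using p PM by blast
    have c: "t \<in> carrier K" "p \<in> carrier K" "m \<in> carrier K" using t pM m M_subset T_carrier by auto
    have "m \<otimes> (t \<otimes> p) = (t \<otimes> m) \<otimes> p" using c by algebra
    moreover have "t \<otimes> m \<in> A" "t \<otimes> p \<in> A" "m \<in> A" using M_closed(1)[OF t] m pM M_A by auto
    ultimately show ?thesis using PD(4)[OF _ p, of "t \<otimes> m"] PD(6)[of m "t \<otimes> p"] m by auto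
  qed
  have prime: "s \<in> P \<or> t \<in> P" if st: "s \<in> T" "t \<in> T" "s \<otimes> t \<in> P" for s t
  proof -
    have c: "s \<in> carrier K" "t \<in> carrier K" using st T_carrier by auto
    show ?thesis
    proof (cases "s \<in> M \<and> t \<in> M")
      case True then show ?thesis using PD(6) st(3) M_A by blast
    next
      case False
      then consider "s \<notin> M" | "t \<notin> M" by blast
      then show ?thesis
      proof cases
        case 1
        note u = unitD[OF st(1) 1]
        have "inv s \<otimes> (s \<otimes> t) \<in> P" by (rule mult[OF u(2) st(3)])
        then show ?thesis using u c by simp
      next
        case 2
        note u = unitD[OF st(2) 2]
        have "inv t \<otimes> (s \<otimes> t) \<in> P" by (rule mult[OF u(2) st(3)])
        moreover have "inv t \<otimes> (s \<otimes> t) = s" using u c K.m_lcomm[of "inv t" s t] by simp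
        ultimately show ?thesis by simp
      qed
    qed
  qed
  show "primeideal P (K\<lparr>carrier := T\<rparr>)" unfolding K.primeideal_subring_iff[OF T]
    using subset_trans[OF PM M_subset] PD(2,3,5) mult prime by (intro conjI ballI impI)
qed

text \<open>An element \<open>s \<in> P\<close> outside of \<open>M\<close> is a unit of \<open>T\<close>, and \<open>m = (m / s) s\<close> with \<open>m / s \<in> M \<subseteq> A\<close>.\<close>

lemma prime_not_below_M:
  assumes P: "primeideal P (K\<lparr>carrier := A\<rparr>)" and n: "\<not> P \<subseteq> M"
  shows "M \<subseteq> P"
proof
  note PD = K.primeidealD[OF A_subring P]
  obtain s where s: "s \<in> P" "s \<notin> M" using n by blast
  have sT: "s \<in> T" using s PD(1) A_T by blast
  note u = unitD[OF sT s(2)]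
  fix m assume m: "m \<in> M"
  have mc: "m \<in> carrier K" using m M_subset T_carrier by blast
  have "inv s \<otimes> m \<in> A" using M_closed(1)[OF u(2) m] M_A by blast
  then have "(inv s \<otimes> m) \<otimes> s \<in> P" using PD(4) s by blast
  moreover have "(inv s \<otimes> m) \<otimes> s = m"
    using u mc K.m_comm[of "inv s \<otimes> m" s] by simp
  ultimately show "m \<in> P" by simp
qed

lemma image_mem_iff:
  assumes P: "primeideal P (K\<lparr>carrier := A\<rparr>)" "M \<subseteq> P" and a: "a \<in> A"
  shows "\<phi> a \<in> \<phi> ` P \<longleftrightarrow> a \<in> P"
proof
  note PD = K.primeidealD[OF A_subring P(1)]
  assume "\<phi> a \<in> \<phi> ` P"
  then obtain p where p: "p \<in> P" "\<phi> a = \<phi> p" by blast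
  have T': "a \<in> T" "p \<in> T" using a p PD(1) A_T by auto
  have "a \<oplus> \<ominus> p \<in> P" using phi_eq_iff[OF T'] p P(2) by blast
  then have "p \<oplus> (a \<oplus> \<ominus> p) \<in> P" using PD(3) p by blast
  moreover have c: "a \<in> carrier K" "p \<in> carrier K" using T' T_carrier by auto
  have "p \<oplus> (a \<oplus> \<ominus> p) = a" using c by algebra
  ultimately show "a \<in> P" by simp
qed blast

lemma image_prime:
  assumes P: "primeideal P (K\<lparr>carrier := A\<rparr>)" "M \<subseteq> P"
  shows "primeideal (\<phi> ` P) (k\<lparr>carrier := D\<rparr>)"
  unfolding k.primeideal_subring_iff[OF D]
proof (intro conjI ballI impI)
  note PD = K.primeidealD[OF A_subring P(1)]
  note mem = image_mem_iff[OF P]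
  have PT: "p \<in> T" if "p \<in> P" for p using that PD(1) A_T by blast
  show "\<phi> ` P \<subseteq> D" using PD(1) by (auto simp: A_def)
  show "\<zero>\<^bsub>k\<^esub> \<in> \<phi> ` P" using PD(2) phi_zero by force
  show "\<one>\<^bsub>k\<^esub> \<notin> \<phi> ` P" using mem[OF subringE(3)[OF A_subring]] PD(5) phi_one by simp
  fix x y assume "x \<in> \<phi> ` P" "y \<in> \<phi> ` P"
  then obtain p q where pq: "x = \<phi> p" "p \<in> P" "y = \<phi> q" "q \<in> P" by blast
  have "x \<oplus>\<^bsub>k\<^esub> y = \<phi> (p \<oplus> q)" unfolding pq by (rule phi_add[OF PT[OF pq(2)] PT[OF pq(4)], symmetric])
  then show "x \<oplus>\<^bsub>k\<^esub> y \<in> \<phi> ` P" using PD(3)[OF pq(2,4)] by blast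
next
  note PD = K.primeidealD[OF A_subring P(1)]
  fix x y assume x: "x \<in> D" and "y \<in> \<phi> ` P"
  then obtain p where p: "p \<in> P" "y = \<phi> p" by blast
  obtain a where a: "a \<in> A" "\<phi> a = x" using image_A[OF x] by blast
  have aT: "a \<in> T" "p \<in> T" using a(1) p(1) A_T PD(1) by auto
  have "x \<otimes>\<^bsub>k\<^esub> y = \<phi> (a \<otimes> p)" unfolding a(2)[symmetric] p(2) by (rule phi_mult[OF aT, symmetric])
  then show "x \<otimes>\<^bsub>k\<^esub> y \<in> \<phi> ` P" using PD(4)[OF a(1) p(1)] by blast
next
  note PD = K.primeidealD[OF A_subring P(1)]
  note mem = image_mem_iff[OF P]
  fix x y assume xy: "x \<in> D" "y \<in> D" "x \<otimes>\<^bsub>k\<^esub> y \<in> \<phi> ` P"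
  obtain a b where ab: "a \<in> A" "\<phi> a = x" "b \<in> A" "\<phi> b = y" using image_A[OF xy(1)] image_A[OF xy(2)] by blast
  have aT: "a \<in> T" "b \<in> T" using ab A_T by auto
  have "\<phi> (a \<otimes> b) = x \<otimes>\<^bsub>k\<^esub> y" unfolding ab(2,4)[symmetric] by (rule phi_mult[OF aT])
  then have "a \<otimes> b \<in> P" using mem[OF subringE(6)[OF A_subring ab(1,3)]] xy(3) by simp
  then have "a \<in> P \<or> b \<in> P" by (rule PD(6)[OF ab(1,3)])
  then show "x \<in> \<phi> ` P \<or> y \<in> \<phi> ` P" using ab by blast
qed

lemma preimage_prime:
  assumes P: "primeideal P (k\<lparr>carrier := D\<rparr>)"
  shows "primeideal {t \<in> T. \<phi> t \<in> P} (K\<lparr>carrier := A\<rparr>)"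
  unfolding K.primeideal_subring_iff[OF A_subring]
proof (intro conjI ballI impI)
  note PD = k.primeidealD[OF D P]
  show "{t \<in> T. \<phi> t \<in> P} \<subseteq> A" using PD(1) by (auto simp: A_def)
  show "\<zero> \<in> {t \<in> T. \<phi> t \<in> P}" using subringE(2)[OF T] phi_zero PD(2) by simp
  show "\<one> \<notin> {t \<in> T. \<phi> t \<in> P}" using phi_one PD(5) by simp
qed (use k.primeidealD[OF D P] subringE(6,7)[OF T] phi_add phi_mult in \<open>auto simp: A_def\<close>)

text \<open>A chain of \<open>w\<close>-primes of \<open>A\<close> breaks at \<open>M\<close>: the lower part consists of nonzero primes of \<open>T\<close>, all of
  which are \<open>w\<close>-primes of \<open>A\<close>, and the upper part comes from \<open>w\<close>-primes of \<open>D\<close>.\<close>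

theorem w_dim_pullback: "w_dim K A = w_dim k D + krull_dim (K\<lparr>carrier := T\<rparr>)"
proof (rule antisym; rule enat_le_if_all)
  fix n assume "enat n \<le> w_dim K A"
  then obtain Ps where Ps: "length Ps = n" "\<And>P. P \<in> set Ps \<Longrightarrow> w_prime K A P" "sorted_wrt (\<subset>) Ps"
    unfolding K.w_dim_ge_iff by blast
  have wp: "primeideal P (K\<lparr>carrier := A\<rparr>)" "P \<noteq> {\<zero>}" "\<And>us. K.gv_set A us \<Longrightarrow> \<not> us \<subseteq> P" if "P \<in> set Ps" for P
    using Ps(2)[OF that] unfolding K.w_prime_iff[OF A_subring] by auto
  let ?lo = "filter (\<lambda>P. P \<subseteq> M) Ps" and ?hi = "filter (\<lambda>P. \<not> P \<subseteq> M) Ps"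
  have "\<forall>P\<in>set ?lo. primeideal P (K\<lparr>carrier := T\<rparr>) \<and> P \<noteq> {\<zero>}"
    using wp(1,2) prime_below_M_iff by auto
  then have lo: "enat (length ?lo) \<le> krull_dim (K\<lparr>carrier := T\<rparr>)"
    unfolding K.krull_dim_ge_iff[OF T] using sorted_wrt_filter[OF Ps(3)] by blast
  have hi: "primeideal P (K\<lparr>carrier := A\<rparr>)" "M \<subseteq> P" "\<not> P \<subseteq> M" "\<And>us. K.gv_set A us \<Longrightarrow> \<not> us \<subseteq> P" if "P \<in> set ?hi" for P
    using that wp[of P] prime_not_below_M[of P] by auto
  have "w_prime k D (\<phi> ` P)" if P: "P \<in> set ?hi" for P
    unfolding k.w_prime_iff[OF D]
  proof (intro conjI allI impI)
    note h = hi[OF P]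
    show "primeideal (\<phi> ` P) (k\<lparr>carrier := D\<rparr>)" by (rule image_prime[OF h(1,2)])
    have PA: "P \<subseteq> A" by (rule K.primeidealD(1)[OF A_subring h(1)])
    obtain s where s: "s \<in> P" "s \<notin> M" using h(3) by blast
    then have "\<phi> s \<noteq> \<zero>\<^bsub>k\<^esub>" using phi_zero_iff[of s] PA A_T by blast
    then show "\<phi> ` P \<noteq> {\<zero>\<^bsub>k\<^esub>}" using s by blast
    fix vs assume vs: "k.gv_set D vs"
    show "\<not> vs \<subseteq> \<phi> ` P"
    proof
      assume "vs \<subseteq> \<phi> ` P"
      then obtain us where us: "us \<subseteq> P" "\<phi> ` us = vs" "K.gv_set A us" by (rule gv_set_lift[OF vs PA])
      then show False using h(4)[OF us(3)] by blast
    qed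
  qed
  then have hw: "\<forall>P\<in>set (map ((`) \<phi>) ?hi). w_prime k D P" by auto
  have "sorted_wrt (\<subset>) ?hi" by (rule sorted_wrt_filter[OF Ps(3)])
  then have "sorted_wrt (\<lambda>P P'. \<phi> ` P \<subset> \<phi> ` P') ?hi"
  proof (rule sorted_wrt_mono_rel[rotated])
    fix P P' assume P: "P \<in> set ?hi" "P' \<in> set ?hi" "P \<subset> P'"
    then obtain p where p: "p \<in> P'" "p \<notin> P" by blast
    have "p \<in> A" using p K.primeidealD(1)[OF A_subring hi(1)[OF P(2)]] by blast
    then have "\<phi> p \<notin> \<phi> ` P" using image_mem_iff[OF hi(1,2)[OF P(1)]] p by blast
    then show "\<phi> ` P \<subset> \<phi> ` P'" using P(3) p by blast
  qed
  then have "sorted_wrt (\<subset>) (map ((`) \<phi>) ?hi)" by (simp add: sorted_wrt_map)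
  then have "enat (length (map ((`) \<phi>) ?hi)) \<le> w_dim k D" unfolding k.w_dim_ge_iff using hw by blast
  moreover have "n = length ?hi + length ?lo" using Ps(1) sum_length_filter_compl[of "\<lambda>P. P \<subseteq> M" Ps] by simp
  ultimately show "enat n \<le> w_dim k D + krull_dim (K\<lparr>carrier := T\<rparr>)"
    unfolding enat_le_plus_iff using lo by auto
next
  fix n assume "enat n \<le> w_dim k D + krull_dim (K\<lparr>carrier := T\<rparr>)"
  then obtain i j where n: "n = i + j" "enat i \<le> w_dim k D" "enat j \<le> krull_dim (K\<lparr>carrier := T\<rparr>)"
    unfolding enat_le_plus_iff by blast
  obtain Ps where Ps: "length Ps = i" "\<And>P. P \<in> set Ps \<Longrightarrow> w_prime k D P" "sorted_wrt (\<subset>) Ps"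
    using n(2) unfolding k.w_dim_ge_iff by blast
  obtain Qs where Qs: "length Qs = j" "\<And>P. P \<in> set Qs \<Longrightarrow> primeideal P (K\<lparr>carrier := T\<rparr>) \<and> P \<noteq> {\<zero>}" "sorted_wrt (\<subset>) Qs"
    using n(3) unfolding K.krull_dim_ge_iff[OF T] by blast
  have wp: "primeideal P (k\<lparr>carrier := D\<rparr>)" "P \<noteq> {\<zero>\<^bsub>k\<^esub>}" "\<And>us. k.gv_set D us \<Longrightarrow> \<not> us \<subseteq> P" "P \<subseteq> D" "\<zero>\<^bsub>k\<^esub> \<in> P" if "P \<in> set Ps" for P
  proof -
    show p: "primeideal P (k\<lparr>carrier := D\<rparr>)" "P \<noteq> {\<zero>\<^bsub>k\<^esub>}" "\<And>us. k.gv_set D us \<Longrightarrow> \<not> us \<subseteq> P"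
      using Ps(2)[OF that] unfolding k.w_prime_iff[OF D] by auto
    show "P \<subseteq> D" "\<zero>\<^bsub>k\<^esub> \<in> P" using k.primeidealD(1,2)[OF D p(1)] by auto
  qed
  let ?f = "\<lambda>P. {t \<in> T. \<phi> t \<in> P}"
  let ?L = "Qs @ map ?f Ps"
  have Mf: "M \<subset> ?f P" if P: "P \<in> set Ps" for P
  proof
    show "M \<subseteq> ?f P"
    proof
      fix m assume m: "m \<in> M"
      then have "m \<in> T" "\<phi> m = \<zero>\<^bsub>k\<^esub>" using M_subset phi_zero_iff by auto
      then show "m \<in> ?f P" using wp(5)[OF P] by simp
    qed
    obtain d where d: "d \<in> P" "d \<noteq> \<zero>\<^bsub>k\<^esub>" using wp(2,5)[OF P] by blast
    then obtain a where a: "a \<in> A" "\<phi> a = d" using image_A[of d] wp(4)[OF P] by blast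
    then have aT: "a \<in> T" using A_T by blast
    then have "a \<in> ?f P" "a \<notin> M" using a d phi_zero_iff[OF aT] by auto
    then show "M \<noteq> ?f P" by blast
  qed
  have QM: "P \<subseteq> M" if "P \<in> set Qs" for P using prime_T_subset_M Qs(2)[OF that] by blast
  have w1: "w_prime K A P" if P: "P \<in> set Qs" for P
    unfolding K.w_prime_iff[OF A_subring]
    using Qs(2)[OF P] prime_below_M_iff[OF QM[OF P]] gv_set_not_in_M QM[OF P] by blast
  have w2: "w_prime K A (?f P)" if P: "P \<in> set Ps" for P
    unfolding K.w_prime_iff[OF A_subring]
  proof (intro conjI allI impI)
    show "primeideal (?f P) (K\<lparr>carrier := A\<rparr>)" by (rule preimage_prime[OF wp(1)[OF P]])
    show "?f P \<noteq> {\<zero>}" using Mf[OF P] zero_in_M M_nonzero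
      by (auto dest: subset_singletonD)
    fix us assume us: "K.gv_set A us"
    then have "finite us" "us \<subseteq> A" by (auto simp: K.gv_set_def)
    then have "k.gv_set D (\<phi> ` us)" using us gv_set_pullback by blast
    then have "\<not> \<phi> ` us \<subseteq> P" by (rule wp(3)[OF P])
    then show "\<not> us \<subseteq> ?f P" by blast
  qed
  have "sorted_wrt (\<lambda>P P'. ?f P \<subset> ?f P') Ps"
  proof (rule sorted_wrt_mono_rel[OF _ Ps(3)])
    fix P P' assume P: "P \<in> set Ps" "P' \<in> set Ps" "P \<subset> P'"
    then obtain d where d: "d \<in> P'" "d \<notin> P" by blast
    then obtain a where "a \<in> A" "\<phi> a = d" using image_A[of d] wp(4)[OF P(2)] by blast
    then have "a \<in> ?f P'" "a \<notin> ?f P" using d A_T by auto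
    then show "?f P \<subset> ?f P'" using P(3) by blast
  qed
  moreover have "P \<subset> ?f P'" if "P \<in> set Qs" "P' \<in> set Ps" for P P'
    using QM[OF that(1)] Mf[OF that(2)] by blast
  ultimately have "sorted_wrt (\<subset>) ?L" using Qs(3) by (auto simp: sorted_wrt_append sorted_wrt_map)
  moreover have "\<forall>P\<in>set ?L. w_prime K A P" using w1 w2 by auto
  moreover have "length ?L = n" using n(1) Ps(1) Qs(1) by simp
  ultimately show "enat n \<le> w_dim K A" unfolding K.w_dim_ge_iff by blast
qed

text \<open>Both summands of \<open>w_dim K A\<close> are bounded by the corresponding summands of \<open>w_val_dim K A\<close>. If the sums
  are equal and finite, then all summands agree and the transcendence degree vanishes.\<close>

theorem w_jaffard_pullback:
  "w_jaffard K A \<longleftrightarrow> w_jaffard k D \<and> jaffard K T \<and> trans_degree k F = 0"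
proof -
  have "w_dim k D \<le> w_val_dim k D" by (rule k.w_dim_le_w_val_dim[OF D])
  moreover have "krull_dim (K\<lparr>carrier := T\<rparr>) \<le> val_dim K T" by (rule K.krull_dim_le_val_dim[OF T])
  moreover have "a + b = a' + b' + c \<and> a' + b' + c < \<infinity> \<longleftrightarrow> (a = a' \<and> a' < \<infinity>) \<and> (b = b' \<and> b' < \<infinity>) \<and> c = 0"
    if "a \<le> a'" "b \<le> b'" for a a' b b' c :: enat
    using that by (cases a; cases a'; cases b; cases b'; cases c) (auto simp: zero_enat_def)
  ultimately show ?thesis
    unfolding w_jaffard_def jaffard_def w_dim_pullback w_val_dim_pullback by blast
qed

end

theorem theorem2p6:
  fixes K :: "('a, 'm) ring_scheme" and k :: "'a set ring"
    and T M R :: "'a set" and D F :: "'a set set" and \<phi> :: "'a \<Rightarrow> 'a set"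
  assumes "field K" and "subdomain T K"
    and "{N. maximalideal N (K\<lparr>carrier := T\<rparr>)} = {M}" and "M \<noteq> {\<zero>\<^bsub>K\<^esub>}"
    and "k = (K\<lparr>carrier := T\<rparr>) Quot M"
    and "\<phi> = (\<lambda>x. M +>\<^bsub>K\<lparr>carrier := T\<rparr>\<^esub> x)"
    and "subring D k" and "D \<noteq> carrier k"
    and "R = {x \<in> T. \<phi> x \<in> D}"
    and "F = quot_field k D"
  shows "w_val_dim K R = w_val_dim k D + val_dim K T + trans_degree k F \<and>
    (w_jaffard K R \<longleftrightarrow>
      w_jaffard k D \<and> jaffard K T \<and> (\<forall>x \<in> carrier k. ring.algebraic k F x))"
proof -
  interpret field K by fact
  have T: "subring T K"
    using assms(2) by (intro subcring.axioms(1) subdomain.axioms(1))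
  have M: "maximalideal M (K\<lparr>carrier := T\<rparr>)" using assms(3) by blast
  have unit: "inv\<^bsub>K\<^esub> t \<in> T" if t: "t \<in> T" "t \<notin> M" for t
    using exists_maximalideal_containing[OF T t(1)] t(2) assms(3) by blast
  interpret residue_field K k T M \<phi>
    unfolding assms(5,6) by (rule local_ring_residue_field[OF T M unit])
  interpret pullback K k T M \<phi> D
    by (rule pullback.intro[OF residue_field_axioms pullback_axioms.intro[OF assms(7,8,4)]])
  have "R = A" unfolding assms(9) A_def ..
  then show ?thesis
    using w_val_dim_pullback w_jaffard_pullback k.trans_degree_eq_0_iff[OF F_subfield]
    unfolding assms(10) by simp
qed

end
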